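(* Let $k$ be a field of characteristic $0$. Let $H$ be a connected $\Gamma$-graded Hopf algebra over $k$, where $\Gamma$ is a nontrivial free abelian monoid. Let $A\supseteq B$ be homogeneous left (resp. right) coideal subalgebras of $H$, of finite GK dimension $m$ and $n$ respectively. Then there is a sequence $B=K_0\subset K_1\subset\cdots\subset K_{m-n}=A$ of homogeneous left (resp. right) coideal subalgebras of $H$ such that each $K_i$ is a graded Ore extension of $K_{i-1}$ of derivation type. Moreover, if $A$ and $B$ are Hopf subalgebras of $H$, then the $K_i$ can be chosen to be Hopf subalgebras of $H$.
   Context: All algebras, coalgebras and tensor products are over $k$. GK dimension means Gelfand-Kirillov dimension. A $\Gamma$-graded Hopf algebra $H=\bigoplus_{\gamma\in\Gamma}H_\gamma$ is a Hopf algebra graded both as an algebra and as a coalgebra; it is connected ($\Gamma$-graded connected) if $\dim H_0=1$. A subspace is homogeneous if it is the direct sum of its intersections with the $H_\gamma$. A left (resp. right) coideal subalgebra of $H$ is a subalgebra $K$ with $\Delta_H(K)\subseteq H\otimes K$ (resp. $\Delta_H(K)\subseteq K\otimes H$). An Ore extension of an algebra $R$ is an algebra $S=R[x;\phi,\delta]$ containing $R$ as a subalgebra, with an element $x\in S$, an algebra automorphism $\phi$ of $R$ and a $\phi$-derivation $\delta$ of $R$, such that $S$ is a free left $R$-module with basis $\{1,x,x^2,\ldots\}$ and $xr=\phi(r)x+\delta(r)$ for all $r\in R$. It is of derivation type if $\phi=\mathrm{id}_R$. A graded Ore extension of a graded algebra is defined in the same way, requiring $S$ graded with $R$ as a graded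 subalgebra and $x,\phi,\delta$ homogeneous of the appropriate degrees ($x$ homogeneous, $\phi$ of degree $0$, $\delta$ of degree $\deg x$). *)

theory Defs
  imports Complex_Main "HOL-Library.Multiset" "HOL-Library.Poly_Mapping"
    "HOL-Library.Extended_Real" "HOL-Library.Liminf_Limsup"
begin

text \<open>
  The ground field is a type \<open>'k\<close>, the algebra is a type \<open>'h\<close> with a scalar multiplication \<open>s\<close>,
  and subspaces and subalgebras are sets.
\<close>

locale unital_algebra = vector_space s
  for s :: "'k::field \<Rightarrow> 'h::ring_1 \<Rightarrow> 'h" +
  assumes scale_mult_left: "s c (x * y) = s c x * y"
    and scale_mult_right: "s c (x * y) = x * s c y"

definition subalgebra :: "('k::field \<Rightarrow> 'h::ring_1 \<Rightarrow> 'h) \<Rightarrow> 'h set \<Rightarrow> bool" where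
  "subalgebra s K \<longleftrightarrow>
     module.subspace s K \<and> 1 \<in> K \<and> (\<forall>x\<in>K. \<forall>y\<in>K. x * y \<in> K)"

text \<open>
  The tensor square of \<open>H\<close> is the vector space with basis \<open>H \<times> H\<close> modulo the bilinearity
  relations, and similarly for the tensor cube. Elements of the quotient are handled through
  representatives: the formal sum \<open>\<Sum> c\<^sub>i (a\<^sub>i, b\<^sub>i)\<close> stands for \<open>\<Sum> c\<^sub>i a\<^sub>i \<otimes> b\<^sub>i\<close>, and
  equality in the tensor power is congruence modulo the span of the relations.
\<close>

definition fscale :: "'k::field \<Rightarrow> ('a \<Rightarrow>\<^sub>0 'k) \<Rightarrow> ('a \<Rightarrow>\<^sub>0 'k)" where
  "fscale c z = Poly_Mapping.map ((*) c) z"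

lemma lookup_fscale: "Poly_Mapping.lookup (fscale c z) a = c * Poly_Mapping.lookup z a"
  by (simp add: fscale_def Poly_Mapping.map.rep_eq when_def)

lemma vector_space_fscale: "vector_space fscale"
  by unfold_locales
    (auto intro!: poly_mapping_eqI simp: lookup_fscale lookup_add algebra_simps)

definition lin_ext :: "('k \<Rightarrow> 'v \<Rightarrow> 'v) \<Rightarrow> ('a \<Rightarrow> 'v) \<Rightarrow> ('a \<Rightarrow>\<^sub>0 'k::zero) \<Rightarrow> 'v::comm_monoid_add" where
  "lin_ext s f z = (\<Sum>a\<in>Poly_Mapping.keys z. s (Poly_Mapping.lookup z a) (f a))"

abbreviation pure :: "'a \<Rightarrow> ('a \<Rightarrow>\<^sub>0 'k::zero_neq_one)" where
  "pure a \<equiv> Poly_Mapping.single a 1"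

definition bilinear_relations ::
    "('k::field \<Rightarrow> 'h::ab_group_add \<Rightarrow> 'h) \<Rightarrow> ('h \<times> 'h \<Rightarrow>\<^sub>0 'k) set" where
  "bilinear_relations s =
     {pure (x + x', y) - pure (x, y) - pure (x', y) | x x' y. True} \<union>
     {pure (x, y + y') - pure (x, y) - pure (x, y') | x y y'. True} \<union>
     {pure (s c x, y) - fscale c (pure (x, y)) | c x y. True} \<union>
     {pure (x, s c y) - fscale c (pure (x, y)) | c x y. True}"

definition trilinear_relations ::
    "('k::field \<Rightarrow> 'h::ab_group_add \<Rightarrow> 'h) \<Rightarrow> ('h \<times> 'h \<times> 'h \<Rightarrow>\<^sub>0 'k) set" where
  "trilinear_relations s =
     {pure (x + x', y, z) - pure (x, y, z) - pure (x', y, z) | x x' y z. True} \<union>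
     {pure (x, y + y', z) - pure (x, y, z) - pure (x, y', z) | x y y' z. True} \<union>
     {pure (x, y, z + z') - pure (x, y, z) - pure (x, y, z') | x y z z'. True} \<union>
     {pure (s c x, y, z) - fscale c (pure (x, y, z)) | c x y z. True} \<union>
     {pure (x, s c y, z) - fscale c (pure (x, y, z)) | c x y z. True} \<union>
     {pure (x, y, s c z) - fscale c (pure (x, y, z)) | c x y z. True}"

definition tensor_eq ::
    "('k::field \<Rightarrow> 'h::ab_group_add \<Rightarrow> 'h) \<Rightarrow> ('h \<times> 'h \<Rightarrow>\<^sub>0 'k) \<Rightarrow> ('h \<times> 'h \<Rightarrow>\<^sub>0 'k) \<Rightarrow> bool" where
  "tensor_eq s z w \<longleftrightarrow> z - w \<in> module.span fscale (bilinear_relations s)"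

definition tensor3_eq ::
    "('k::field \<Rightarrow> 'h::ab_group_add \<Rightarrow> 'h) \<Rightarrow>
      ('h \<times> 'h \<times> 'h \<Rightarrow>\<^sub>0 'k) \<Rightarrow> ('h \<times> 'h \<times> 'h \<Rightarrow>\<^sub>0 'k) \<Rightarrow> bool" where
  "tensor3_eq s z w \<longleftrightarrow> z - w \<in> module.span fscale (trilinear_relations s)"

text \<open>
  The representatives of those tensors that are linear combinations of \<open>a \<otimes> b\<close> with
  \<open>(a, b) \<in> P\<close>. For subspaces \<open>U\<close> and \<open>V\<close>, the case \<open>P = U \<times> V\<close> gives \<open>U \<otimes> V\<close>, regarded as a
  subspace of the tensor square of \<open>H\<close>.
\<close>

definition tensor_span ::
    "('k::field \<Rightarrow> 'h::ab_group_add \<Rightarrow> 'h) \<Rightarrow> ('h \<times> 'h) set \<Rightarrow> ('h \<times> 'h \<Rightarrow>\<^sub>0 'k) set" where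
  "tensor_span s P = {z. \<exists>w \<in> module.span fscale (pure ` P). tensor_eq s z w}"

definition tensor_mult ::
    "('h \<times> 'h \<Rightarrow>\<^sub>0 'k::field) \<Rightarrow> ('h \<times> 'h \<Rightarrow>\<^sub>0 'k) \<Rightarrow> ('h::ring_1 \<times> 'h \<Rightarrow>\<^sub>0 'k)" where
  "tensor_mult z w =
     lin_ext fscale (\<lambda>(a, b). lin_ext fscale (\<lambda>(c, d). pure (a * c, b * d)) w) z"

text \<open>
  \<open>\<Delta> x\<close> is a representative of the coproduct of \<open>x\<close>. All laws for \<open>\<Delta>\<close>, including linearity, are
  imposed only modulo the tensor relations, so that \<open>\<Delta>\<close> amounts to an arbitrary comultiplication
  together with an arbitrary choice of representatives.
\<close>

locale hopf_algebra = unital_algebra s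
  for s :: "'k::field \<Rightarrow> 'h::ring_1 \<Rightarrow> 'h" +
  fixes \<Delta> :: "'h \<Rightarrow> ('h \<times> 'h \<Rightarrow>\<^sub>0 'k)"
    and \<epsilon> :: "'h \<Rightarrow> 'k"
    and S :: "'h \<Rightarrow> 'h"
  assumes comult_add: "tensor_eq s (\<Delta> (x + y)) (\<Delta> x + \<Delta> y)"
    and comult_scale: "tensor_eq s (\<Delta> (s c x)) (fscale c (\<Delta> x))"
    and coassoc: "tensor3_eq s
          (lin_ext fscale (\<lambda>(a, b). lin_ext fscale (\<lambda>(p, q). pure (p, q, b)) (\<Delta> a)) (\<Delta> x))
          (lin_ext fscale (\<lambda>(a, b). lin_ext fscale (\<lambda>(p, q). pure (a, p, q)) (\<Delta> b)) (\<Delta> x))"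
    and counit_linear: "Vector_Spaces.linear s (*) \<epsilon>"
    and counit_left: "lin_ext s (\<lambda>(a, b). s (\<epsilon> a) b) (\<Delta> x) = x"
    and counit_right: "lin_ext s (\<lambda>(a, b). s (\<epsilon> b) a) (\<Delta> x) = x"
    and comult_one: "tensor_eq s (\<Delta> 1) (pure (1, 1))"
    and comult_mult: "tensor_eq s (\<Delta> (x * y)) (tensor_mult (\<Delta> x) (\<Delta> y))"
    and counit_one: "\<epsilon> 1 = 1"
    and counit_mult: "\<epsilon> (x * y) = \<epsilon> x * \<epsilon> y"
    and antipode_linear: "Vector_Spaces.linear s s S"
    and antipode_left: "lin_ext s (\<lambda>(a, b). S a * b) (\<Delta> x) = s (\<epsilon> x) 1"
    and antipode_right: "lin_ext s (\<lambda>(a, b). a * S b) (\<Delta> x) = s (\<epsilon> x) 1"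

definition left_coideal_subalgebra ::
    "('k::field \<Rightarrow> 'h::ring_1 \<Rightarrow> 'h) \<Rightarrow> ('h \<Rightarrow> ('h \<times> 'h \<Rightarrow>\<^sub>0 'k)) \<Rightarrow> 'h set \<Rightarrow> bool" where
  "left_coideal_subalgebra s \<Delta> K \<longleftrightarrow>
     subalgebra s K \<and> (\<forall>x\<in>K. \<Delta> x \<in> tensor_span s (UNIV \<times> K))"

definition right_coideal_subalgebra ::
    "('k::field \<Rightarrow> 'h::ring_1 \<Rightarrow> 'h) \<Rightarrow> ('h \<Rightarrow> ('h \<times> 'h \<Rightarrow>\<^sub>0 'k)) \<Rightarrow> 'h set \<Rightarrow> bool" where
  "right_coideal_subalgebra s \<Delta> K \<longleftrightarrow>
     subalgebra s K \<and> (\<forall>x\<in>K. \<Delta> x \<in> tensor_span s (K \<times> UNIV))"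

definition hopf_subalgebra ::
    "('k::field \<Rightarrow> 'h::ring_1 \<Rightarrow> 'h) \<Rightarrow> ('h \<Rightarrow> ('h \<times> 'h \<Rightarrow>\<^sub>0 'k)) \<Rightarrow> ('h \<Rightarrow> 'h) \<Rightarrow> 'h set \<Rightarrow> bool" where
  "hopf_subalgebra s \<Delta> S K \<longleftrightarrow>
     subalgebra s K \<and> (\<forall>x\<in>K. \<Delta> x \<in> tensor_span s (K \<times> K)) \<and> (\<forall>x\<in>K. S x \<in> K)"

text \<open>The canonical map from the free commutative monoid on \<open>X\<close> (finite multisets) is bijective.\<close>

definition free_abelian_monoid :: "'g::comm_monoid_add itself \<Rightarrow> bool" where
  "free_abelian_monoid _ \<longleftrightarrow>
     (\<exists>X :: 'g set. bij_betw sum_mset {M. set_mset M \<subseteq> X} UNIV)"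

locale connected_graded_hopf_algebra = hopf_algebra s \<Delta> \<epsilon> S
  for s :: "'k::field \<Rightarrow> 'h::ring_1 \<Rightarrow> 'h"
    and \<Delta> :: "'h \<Rightarrow> ('h \<times> 'h \<Rightarrow>\<^sub>0 'k)"
    and \<epsilon> :: "'h \<Rightarrow> 'k"
    and S :: "'h \<Rightarrow> 'h" +
  fixes Hc :: "'g::comm_monoid_add \<Rightarrow> 'h set"
  assumes component_subspace: "subspace (Hc \<gamma>)"
    and direct_sum: "\<exists>!f :: 'g \<Rightarrow>\<^sub>0 'h. (\<forall>\<gamma>. Poly_Mapping.lookup f \<gamma> \<in> Hc \<gamma>) \<and>
          x = (\<Sum>\<gamma>\<in>Poly_Mapping.keys f. Poly_Mapping.lookup f \<gamma>)"
    and graded_one: "1 \<in> Hc 0"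
    and graded_mult: "x \<in> Hc \<alpha> \<Longrightarrow> y \<in> Hc \<beta> \<Longrightarrow> x * y \<in> Hc (\<alpha> + \<beta>)"
    and graded_comult: "x \<in> Hc \<gamma> \<Longrightarrow>
          \<Delta> x \<in> tensor_span s (\<Union>{Hc \<alpha> \<times> Hc \<beta> | \<alpha> \<beta>. \<alpha> + \<beta> = \<gamma>})"
    and graded_counit: "x \<in> Hc \<gamma> \<Longrightarrow> \<gamma> \<noteq> 0 \<Longrightarrow> \<epsilon> x = 0"
    and connected: "dim (Hc 0) = 1"

text \<open>For a subspace of a graded space, the sum of the intersections below is automatically direct.\<close>

definition homogeneous ::
    "('k::field \<Rightarrow> 'h::ab_group_add \<Rightarrow> 'h) \<Rightarrow> ('g \<Rightarrow> 'h set) \<Rightarrow> 'h set \<Rightarrow> bool" where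
  "homogeneous s Hc V \<longleftrightarrow> module.subspace s V \<and> V = module.span s (\<Union>\<gamma>. V \<inter> Hc \<gamma>)"

text \<open>The dimension of \<open>V\<^sup>0 + V\<^sup>1 + \<dots> + V\<^sup>n\<close>, where \<open>V\<^sup>0 = k\<close>.\<close>

definition growth ::
    "('k::field \<Rightarrow> 'h::ring_1 \<Rightarrow> 'h) \<Rightarrow> 'h set \<Rightarrow> nat \<Rightarrow> nat" where
  "growth s V n =
     vector_space.dim s (module.span s {prod_list ws | ws. set ws \<subseteq> V \<and> length ws \<le> n})"

definition gk_dim :: "('k::field \<Rightarrow> 'h::ring_1 \<Rightarrow> 'h) \<Rightarrow> 'h set \<Rightarrow> ereal" where
  "gk_dim s A =
     (SUP V \<in> {module.span s F | F. finite F \<and> F \<subseteq> A}.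
        limsup (\<lambda>n. ereal (log (real n) (real (growth s V n)))))"

definition algebra_automorphism ::
    "('k::field \<Rightarrow> 'h::ring_1 \<Rightarrow> 'h) \<Rightarrow> 'h set \<Rightarrow> ('h \<Rightarrow> 'h) \<Rightarrow> bool" where
  "algebra_automorphism s R \<phi> \<longleftrightarrow>
     bij_betw \<phi> R R \<and> \<phi> 1 = 1 \<and>
     (\<forall>a\<in>R. \<forall>b\<in>R. \<phi> (a + b) = \<phi> a + \<phi> b \<and> \<phi> (a * b) = \<phi> a * \<phi> b) \<and>
     (\<forall>c. \<forall>a\<in>R. \<phi> (s c a) = s c (\<phi> a))"

definition skew_derivation ::
    "('k::field \<Rightarrow> 'h::ring_1 \<Rightarrow> 'h) \<Rightarrow> 'h set \<Rightarrow> ('h \<Rightarrow> 'h) \<Rightarrow> ('h \<Rightarrow> 'h) \<Rightarrow> bool" where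
  "skew_derivation s R \<phi> \<delta> \<longleftrightarrow>
     (\<forall>a\<in>R. \<delta> a \<in> R) \<and>
     (\<forall>a\<in>R. \<forall>b\<in>R. \<delta> (a + b) = \<delta> a + \<delta> b \<and> \<delta> (a * b) = \<phi> a * \<delta> b + \<delta> a * b) \<and>
     (\<forall>c. \<forall>a\<in>R. \<delta> (s c a) = s c (\<delta> a))"

definition ore_extension ::
    "('k::field \<Rightarrow> 'h::ring_1 \<Rightarrow> 'h) \<Rightarrow> 'h set \<Rightarrow> 'h set \<Rightarrow> 'h \<Rightarrow> ('h \<Rightarrow> 'h) \<Rightarrow> ('h \<Rightarrow> 'h) \<Rightarrow> bool" where
  "ore_extension s R T x \<phi> \<delta> \<longleftrightarrow>
     subalgebra s R \<and> subalgebra s T \<and> R \<subseteq> T \<and> x \<in> T \<and>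
     algebra_automorphism s R \<phi> \<and> skew_derivation s R \<phi> \<delta> \<and>
     (\<forall>t\<in>T. \<exists>!f :: nat \<Rightarrow>\<^sub>0 'h. (\<forall>i. Poly_Mapping.lookup f i \<in> R) \<and>
        t = (\<Sum>i\<in>Poly_Mapping.keys f. Poly_Mapping.lookup f i * x ^ i)) \<and>
     (\<forall>r\<in>R. x * r = \<phi> r * x + \<delta> r)"

definition graded_ore_extension ::
    "('k::field \<Rightarrow> 'h::ring_1 \<Rightarrow> 'h) \<Rightarrow> ('g::comm_monoid_add \<Rightarrow> 'h set) \<Rightarrow> 'h set \<Rightarrow> 'h set \<Rightarrow>
      'h \<Rightarrow> ('h \<Rightarrow> 'h) \<Rightarrow> ('h \<Rightarrow> 'h) \<Rightarrow> bool" where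
  "graded_ore_extension s Hc R T x \<phi> \<delta> \<longleftrightarrow>
     ore_extension s R T x \<phi> \<delta> \<and> homogeneous s Hc R \<and> homogeneous s Hc T \<and>
     (\<exists>\<gamma>. x \<in> Hc \<gamma> \<and>
        (\<forall>\<alpha>. \<forall>r \<in> R \<inter> Hc \<alpha>. \<phi> r \<in> Hc \<alpha> \<and> \<delta> r \<in> Hc (\<alpha> + \<gamma>)))"

definition graded_ore_extension_of_derivation_type ::
    "('k::field \<Rightarrow> 'h::ring_1 \<Rightarrow> 'h) \<Rightarrow> ('g::comm_monoid_add \<Rightarrow> 'h set) \<Rightarrow> 'h set \<Rightarrow> 'h set \<Rightarrow> bool"
  where
  "graded_ore_extension_of_derivation_type s Hc R T \<longleftrightarrow>
     (\<exists>x \<phi> \<delta>. graded_ore_extension s Hc R T x \<phi> \<delta> \<and> (\<forall>r\<in>R. \<phi> r = r))"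

end

theory Submission
  imports Defs "HOL-Library.FuncSet"
begin

text \<open>
  Call \<open>x \<in> A\<close> primitive over \<open>B\<close> if \<open>\<Delta> x \<in> 1 \<otimes> x + H \<otimes> B\<close>. A homogeneous element of \<open>A - B\<close> of minimal
  degree is primitive over \<open>B\<close>. If \<open>x\<close> is primitive over \<open>B\<close> and \<open>b \<in> B\<close>, then, by induction on the
  degree of \<open>b\<close>, the commutator \<open>[x, b]\<close> is again primitive over \<open>B\<close>, and of larger degree than \<open>x\<close>. Hence
  \<open>[x, B] \<subseteq> B\<close> as soon as \<open>x\<close> has the largest possible degree among the homogeneous primitive elements
  outside \<open>B\<close>, and then \<open>B[x]\<close> is a coideal subalgebra and the next member of the chain.

  The largest degree exists, and \<open>B[x]\<close> is free over \<open>B\<close>, by one independence result. Let \<open>C\<^sub>0 = k\<close> and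
  \<open>C\<^sub>n = {x. \<Delta> x - 1 \<otimes> x \<in> H \<otimes> C\<^sub>n\<^sub>-\<^sub>1}\<close>. The associated graded algebra is commutative, and in characteristic
  \<open>0\<close> primitive elements with symbols linearly independent modulo \<open>gr B\<close> have symbols algebraically
  independent over \<open>gr B\<close>. Infinitely many independent primitive elements would thus make the
  Gelfand-Kirillov dimension of \<open>A\<close> infinite.

  Each Ore step raises the exponents of a lower bound for the growth and of an upper bound for the
  Hilbert function by one. Starting the chain at \<open>k\<close> and passing through \<open>B\<close>, this identifies
  the Gelfand-Kirillov dimensions of \<open>B\<close> and \<open>A\<close> with the numbers of steps.

  Right coideal subalgebras are the mirror image, and Hopf subalgebras are handled by using both sides
  at once; stability under the antipode is then automatic by induction on the degree.
\<close>

section \<open>Growth of algebras\<close>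

text \<open>Two obstacles shape the proof. In general the Gelfand-Kirillov dimension of
  \<open>R[x;\<delta>]\<close> can exceed that of \<open>R\<close> by more than one, so the
  dimension itself is not carried along the chain. Carried along are two elementary bounds with a
  common exponent: many independent words in one finite set (\<open>growth_ge\<close>) and few
  dimensions in low degrees (\<open>growth_le\<close>). The latter passes to \<open>B[x]\<close>
  because \<open>x\<close> is homogeneous of positive degree. Together they pin the dimension down.
  Secondly, relations have coefficients in \<open>B\<close>, whose structure is unknown, so
  independence is proved relative to \<open>B\<close>. As for polynomials in characteristic 0, this
  is done by differentiation: contracting one leg of \<open>\<Delta> x\<close> with a functional
  gives operators \<open>U f\<close> that lower the filtration and act as derivations on the
  associated graded algebra. Contraction also turns membership in a tensor product into membership
  in \<open>H\<close> for all \<open>f\<close>, so that the left, right and two-sided cases share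
  one locale whose axioms do not mention tensors.\<close>

context unital_algebra
begin

lemma mult_in_span:
  assumes "subspace Z" "\<And>x y. x \<in> X \<Longrightarrow> y \<in> Y \<Longrightarrow> x * y \<in> Z" "a \<in> span X" "b \<in> span Y"
  shows "a * b \<in> Z"
proof -
  have 1: "x * b \<in> Z" if "x \<in> X" for x
    using assms(4)
  proof (induction rule: span_induct)
    case base
    show ?case
      using assms(1) by (auto simp: subspace_def distrib_left scale_mult_right[symmetric])
  qed (use assms(2) that in auto)
  show ?thesis
    using assms(3)
  proof (induction rule: span_induct)
    case base
    show ?case
      using assms(1) by (auto simp: subspace_def distrib_right scale_mult_left[symmetric])
  qed (use 1 in auto)
qed

lemma subspace_mult_right_vimage: "subspace Z \<Longrightarrow> subspace {a. a * y \<in> Z}"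
  by (auto simp: subspace_def distrib_right scale_mult_left[symmetric])

definition words :: "'h set \<Rightarrow> nat \<Rightarrow> 'h set" where
  "words F n = {prod_list ws | ws. set ws \<subseteq> F \<and> length ws \<le> n}"

lemma words_mono: "F \<subseteq> G \<Longrightarrow> m \<le> n \<Longrightarrow> words F m \<subseteq> words G n"
  unfolding words_def by fastforce

lemma finite_words: "finite F \<Longrightarrow> finite (words F n)"
proof -
  assume "finite F"
  have "words F n = prod_list ` {ws. set ws \<subseteq> F \<and> length ws \<le> n}" by (auto simp: words_def)
  then show ?thesis using \<open>finite F\<close> by (simp add: finite_lists_length_le)
qed

lemma words_mult: "a \<in> words F m \<Longrightarrow> b \<in> words F n \<Longrightarrow> a * b \<in> words F (m + n)"
proof -
  assume "a \<in> words F m" "b \<in> words F n"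
  then obtain vs ws where "a = prod_list vs" "b = prod_list ws"
    "set vs \<subseteq> F" "set ws \<subseteq> F" "length vs \<le> m" "length ws \<le> n"
    by (auto simp: words_def)
  then show ?thesis unfolding words_def by (intro CollectI exI[of _ "vs @ ws"]) auto
qed

lemma span_words_mult:
  "a \<in> span (words F m) \<Longrightarrow> b \<in> span (words F n) \<Longrightarrow> a * b \<in> span (words F (m + n))"
  by (rule mult_in_span) (auto intro: span_base words_mult)

lemma power_in_words: "x \<in> F \<Longrightarrow> i \<le> n \<Longrightarrow> x ^ i \<in> words F n"
  unfolding words_def by (intro CollectI exI[of _ "replicate i x"]) auto

lemma words_span_subset: "words (span F) n \<subseteq> span (words F n)"
proof -
  have "prod_list ws \<in> span (words F (length ws))" if "set ws \<subseteq> span F" for ws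
    using that
  proof (induction ws)
    case Nil
    then show ?case by (auto simp: words_def intro: span_base)
  next
    case (Cons w ws)
    have "F \<subseteq> words F 1" by (auto simp: words_def intro!: exI[of _ "[_]"])
    then have "w \<in> span (words F 1)" using Cons.prems span_mono by auto
    then show ?case using span_words_mult[of w F 1] Cons by simp
  qed
  then show ?thesis
    using span_mono[OF words_mono[OF subset_refl]] by (fastforce simp: words_def[of "span F"])
qed

lemma span_words_span: "span (words (span F) n) = span (words F n)"
proof
  show "span (words (span F) n) \<subseteq> span (words F n)"
    by (rule span_minimal[OF words_span_subset subspace_span])
  show "span (words F n) \<subseteq> span (words (span F) n)"
    by (intro span_mono words_mono span_superset order_refl)
qed

lemma words_subalgebra: "subalgebra s K \<Longrightarrow> F \<subseteq> K \<Longrightarrow> words F n \<subseteq> K"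
proof -
  assume K: "subalgebra s K" "F \<subseteq> K"
  have "prod_list ws \<in> K" if "set ws \<subseteq> K" for ws
    using that K(1) by (induction ws) (auto simp: subalgebra_def)
  then show ?thesis using K by (auto simp: words_def)
qed

lemma growth_eq: "growth s (span F) n = dim (words F n)"
  unfolding growth_def words_def[symmetric] span_words_span by (rule dim_span)

lemma card_le_growth:
  assumes "finite F" "independent S" "S \<subseteq> span (words F n)"
  shows "card S \<le> growth s (span F) n"
proof -
  obtain T where T: "T \<subseteq> words F n" "independent T" "words F n \<subseteq> span T" "card T = dim (words F n)"
    using basis_exists by blast
  have "finite T" using T(1) finite_words[OF assms(1)] finite_subset by blast
  moreover have "S \<subseteq> span T" using assms(3) T(3) span_minimal[OF T(3) subspace_span] by blast
  ultimately show ?thesis using independent_span_bound[OF _ assms(2)] T(4) growth_eq by metis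
qed

text \<open>The constant \<open>c\<close> rescales the word length linearly, which leaves the
  exponent \<open>r\<close> intact; it makes room for boxes of monomials with every exponent at most
  \<open>n\<close>.\<close>

definition growth_ge :: "'h set \<Rightarrow> nat \<Rightarrow> bool" where
  "growth_ge K r \<longleftrightarrow> (\<exists>F c. finite F \<and> F \<subseteq> K \<and>
     (\<forall>n. \<exists>S. finite S \<and> independent S \<and> (n + 1) ^ r \<le> card S \<and> S \<subseteq> span (words F (c * n))))"

text \<open>To base \<open>n\<close> the factor \<open>C\<close> contributes only
  \<open>r * ln C / ln n\<close>, which tends to 0: neither constant factors nor a linear rescaling
  of \<open>n\<close> affect the dimension.\<close>

lemma tendsto_log_growth:
  fixes C :: real
  assumes "C > 0"
  shows "(\<lambda>n. ereal (log (real n) ((C * real n) ^ r))) \<longlonglongrightarrow> ereal (real r)"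
proof -
  have "(\<lambda>n. real r * (ln C / ln (real n) + 1)) \<longlonglongrightarrow> real r * (0 + 1)"
    by (intro tendsto_intros tendsto_divide_0[OF tendsto_const]
        filterlim_at_top_imp_at_infinity filterlim_compose[OF ln_at_top filterlim_real_sequentially])
  moreover have "\<forall>\<^sub>F n in sequentially. real r * (ln C / ln (real n) + 1) = log (real n) ((C * real n) ^ r)"
    using eventually_gt_at_top[of 1]
  proof eventually_elim
    case (elim n)
    then have "log (real n) ((C * real n) ^ r) = real r * ((ln C + ln (real n)) / ln (real n))"
      using assms by (simp add: log_def ln_realpow ln_mult)
    then show ?case using elim by (simp add: add_divide_distrib)
  qed
  ultimately have "(\<lambda>n. log (real n) ((C * real n) ^ r)) \<longlonglongrightarrow> real r"
    by (simp add: tendsto_cong)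
  then show ?thesis by (simp add: tendsto_ereal)
qed

lemma growth_ge_imp_gk_dim_ge:
  assumes "growth_ge K r"
  shows "ereal (real r) \<le> gk_dim s K"
proof -
  obtain F c where F: "finite F" "F \<subseteq> K" and
    S: "\<And>n. \<exists>S. finite S \<and> independent S \<and> (n + 1) ^ r \<le> card S \<and> S \<subseteq> span (words F (c * n))"
    using assms unfolding growth_ge_def by blast
  have bound: "(inverse (real (Suc c)) * real n) ^ r \<le> real (growth s (span F) n)" for n
  proof -
    \<comment> \<open>Words of length \<open>c * q\<close> must fit into length \<open>n\<close>,
      while \<open>q + 1\<close> must stay above a fixed multiple of \<open>n\<close>; dividing by
      \<open>Suc c\<close> also covers \<open>c = 0\<close>.\<close>
    define q where "q = n div Suc c"
    obtain S where S: "finite S" "independent S" "(q + 1) ^ r \<le> card S" "S \<subseteq> span (words F (c * q))"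
      using S[of q] by blast
    have "c * q \<le> Suc c * q" by simp
    also have "\<dots> \<le> n" by (simp add: q_def del: mult_Suc)
    finally have "S \<subseteq> span (words F n)"
      using S(4) span_mono[OF words_mono[OF subset_refl]] by blast
    then have "(q + 1) ^ r \<le> growth s (span F) n"
      using card_le_growth[OF F(1) S(2)] S(3) by fastforce
    then have "real (q + 1) ^ r \<le> real (growth s (span F) n)"
      by (metis of_nat_le_iff of_nat_power)
    moreover have "inverse (real (Suc c)) * real n \<le> real (q + 1)"
    proof -
      have "n < Suc c * (q + 1)" unfolding q_def
        by (metis Suc_eq_plus1 dividend_less_times_div mult.commute mult_Suc_right add.commute zero_less_Suc)
      then have "real n \<le> real (Suc c) * real (q + 1)" by (metis less_imp_le of_nat_le_iff of_nat_mult)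
      then show ?thesis by (simp add: field_simps)
    qed
    then have "(inverse (real (Suc c)) * real n) ^ r \<le> real (q + 1) ^ r"
      by (intro power_mono) auto
    ultimately show ?thesis by linarith
  qed
  have "ereal (real r) = limsup (\<lambda>n. ereal (log (real n) ((inverse (real (Suc c)) * real n) ^ r)))"
    by (rule lim_imp_Limsup[symmetric, OF _ tendsto_log_growth]) auto
  also have "\<dots> \<le> limsup (\<lambda>n. ereal (log (real n) (real (growth s (span F) n))))"
  proof (rule Limsup_mono)
    show "\<forall>\<^sub>F n in sequentially. ereal (log (real n) ((inverse (real (Suc c)) * real n) ^ r))
        \<le> ereal (log (real n) (real (growth s (span F) n)))"
      using eventually_gt_at_top[of 1]
    proof eventually_elim
      case (elim n)
      then have "0 < (inverse (real (Suc c)) * real n) ^ r" by simp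
      then have "log (real n) ((inverse (real (Suc c)) * real n) ^ r) \<le> log (real n) (real (growth s (span F) n))"
        using bound[of n] elim by (subst log_le_cancel_iff) linarith+
      then show ?case by simp
    qed
  qed
  also have "\<dots> \<le> gk_dim s K"
    unfolding gk_dim_def by (rule SUP_upper) (use F in blast)
  finally show ?thesis .
qed

lemma gk_dim_leI:
  assumes "\<And>F. finite F \<Longrightarrow> F \<subseteq> K \<Longrightarrow> \<exists>d. \<forall>n. growth s (span F) n \<le> (d * n + 1) ^ r"
  shows "gk_dim s K \<le> ereal (real r)"
  unfolding gk_dim_def
proof (rule SUP_least)
  fix V assume "V \<in> {span F | F. finite F \<and> F \<subseteq> K}"
  then obtain F where F: "finite F" "F \<subseteq> K" "V = span F" by blast
  obtain d where d: "\<And>n. growth s V n \<le> (d * n + 1) ^ r" using assms F by metis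
  have "limsup (\<lambda>n. ereal (log (real n) (real (growth s V n))))
    \<le> limsup (\<lambda>n. ereal (log (real n) ((real (Suc d) * real n) ^ r)))"
  proof (rule Limsup_mono)
    show "\<forall>\<^sub>F n in sequentially. ereal (log (real n) (real (growth s V n)))
        \<le> ereal (log (real n) ((real (Suc d) * real n) ^ r))"
      using eventually_gt_at_top[of 1]
    proof eventually_elim
      case (elim n)
      \<comment> \<open>The empty word keeps the growth positive, so that the logarithm is monotone
        there.\<close>
      have "0 < card {1::'h}" by simp
      also have "card {1::'h} \<le> growth s V n" unfolding F(3)
        by (rule card_le_growth[OF F(1)])
          (auto simp: independent_insert words_def intro!: span_base exI[of _ "[]"])
      finally have pos: "0 < growth s V n" .
      have "growth s V n \<le> (d * n + 1) ^ r" by (rule d)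
      also have "\<dots> \<le> (Suc d * n) ^ r" using elim by (intro power_mono) auto
      finally have "real (growth s V n) \<le> real ((Suc d * n) ^ r)" by (simp only: of_nat_le_iff)
      then have "real (growth s V n) \<le> (real (Suc d) * real n) ^ r" by (simp only: of_nat_power of_nat_mult)
      then show ?case using elim pos by simp
    qed
  qed
  also have "\<dots> = ereal (real r)"
    by (rule lim_imp_Limsup[OF _ tendsto_log_growth]) auto
  finally show "limsup (\<lambda>n. ereal (log (real n) (real (growth s V n)))) \<le> ereal (real r)" .
qed

lemma gk_dim_mono: "K \<subseteq> L \<Longrightarrow> gk_dim s K \<le> gk_dim s L"
  unfolding gk_dim_def by (rule SUP_subset_mono) auto

end

section \<open>Algebras with lowering operators\<close>

text \<open>
  For a bialgebra, \<open>U f x\<close> is \<open>(f \<otimes> id) (\<Delta> x) - f 1 \<cdot> x\<close> with \<open>f\<close> a linear functional, or its mirror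
  image. Then \<open>\<Delta> x = 1 \<otimes> x + u\<close> with \<open>u \<in> H \<otimes> K\<close> iff all \<open>U f x\<close> lie in \<open>K\<close>, so that \<open>U_mult\<close> is the
  expansion of \<open>\<Delta> (x y) = (1 \<otimes> x + u) (1 \<otimes> y + v)\<close>. Coassociativity plays no role.
\<close>

locale graded_coaction = unital_algebra s
  for s :: "'k::field_char_0 \<Rightarrow> 'h::ring_1 \<Rightarrow> 'h" +
  fixes U :: "'i \<Rightarrow> 'h \<Rightarrow> 'h"
    and Hc :: "'g::comm_monoid_add \<Rightarrow> 'h set"
    and deg :: "'g \<Rightarrow> nat"
  assumes U_linear: "Vector_Spaces.linear s s (U f)"
    and U_mult: "subspace K \<Longrightarrow> subspace L \<Longrightarrow> (\<And>g. U g x \<in> K) \<Longrightarrow> (\<And>g. U g y \<in> L) \<Longrightarrow>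
          U f (x * y) - x * U f y - U f x * y \<in> span {a * b | a b. a \<in> K \<and> b \<in> L}"
    and U_kernel: "(\<And>f. U f x = 0) \<Longrightarrow> x \<in> span {1}"
    and component_subspace: "subspace (Hc \<gamma>)"
    and direct_sum: "\<exists>!f :: 'g \<Rightarrow>\<^sub>0 'h. (\<forall>\<gamma>. Poly_Mapping.lookup f \<gamma> \<in> Hc \<gamma>) \<and>
          x = (\<Sum>\<gamma>\<in>Poly_Mapping.keys f. Poly_Mapping.lookup f \<gamma>)"
    and graded_one: "1 \<in> Hc 0"
    and graded_mult: "x \<in> Hc \<alpha> \<Longrightarrow> y \<in> Hc \<beta> \<Longrightarrow> x * y \<in> Hc (\<alpha> + \<beta>)"
    and U_graded: "x \<in> Hc \<gamma> \<Longrightarrow> U f x \<in> span (\<Union>\<beta>\<in>{\<beta>. deg \<beta> < deg \<gamma>}. Hc \<beta>)"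
    and deg_add: "deg (\<alpha> + \<beta>) = deg \<alpha> + deg \<beta>"
    and deg_eq_0: "deg \<gamma> = 0 \<longleftrightarrow> \<gamma> = 0"
begin

lemma U_hom: "module_hom s s (U f)"
  using U_linear by (simp add: Vector_Spaces.linear_def)

lemma U_add: "U f (x + y) = U f x + U f y"
  by (rule module_hom.add[OF U_hom])
lemma U_diff: "U f (x - y) = U f x - U f y"
  by (rule module_hom.diff[OF U_hom])
lemma U_scale: "U f (s c x) = s c (U f x)"
  by (rule module_hom.scale[OF U_hom])
lemma U_0: "U f 0 = 0"
  by (rule module_hom.zero[OF U_hom])
lemma U_sum: "U f (sum h I) = (\<Sum>i\<in>I. U f (h i))"
  by (rule module_hom.sum[OF U_hom])

lemma U_one: "U f 1 = 0"
  using U_graded[OF graded_one, of f] deg_eq_0[of 0] by (simp add: span_empty)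

lemma scale_one_mult: "s c 1 * x = s c x"
  using scale_mult_left[of c 1 x] by simp

lemma mult_scale_one: "x * s c 1 = s c x"
  using scale_mult_right[of c x 1] by simp

lemma of_nat_mult_eq_scale: "of_nat n * x = s (of_nat n) x"
  by (induction n) (simp_all add: scale_left_distrib distrib_right)

lemma span_1_iff: "x \<in> span {1} \<longleftrightarrow> (\<exists>c. x = s c 1)"
  by (auto simp: span_singleton)

lemma U_span_1: "x \<in> span {1} \<Longrightarrow> U f x = 0"
  by (auto simp: span_1_iff U_scale U_one)

subsection \<open>The coradical-type filtration\<close>

text \<open>\<open>filt (Suc n)\<close> is the \<open>C\<^sub>n\<close> of the overview. Starting
  one step earlier, at 0, lets the scalars come out of \<open>U_kernel\<close> and provides a level
  at which elements are known to vanish.\<close>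

primrec filt :: "nat \<Rightarrow> 'h set" where
  "filt 0 = {0}"
| "filt (Suc n) = {x. \<forall>f. U f x \<in> filt n}"

text \<open>Integer indices, with \<open>lv k = 0\<close> for negative \<open>k\<close> and \<open>lv 0\<close> the scalars, avoid truncated
  subtraction in degree counts.\<close>

definition lv :: "int \<Rightarrow> 'h set" where
  "lv k = filt (nat (k + 1))"

lemma lv_neg: "k < 0 \<Longrightarrow> lv k = {0}"
  by (simp add: lv_def)

lemma lv_nonneg: "k \<ge> 0 \<Longrightarrow> lv k = {x. \<forall>f. U f x \<in> lv (k - 1)}"
proof -
  assume "k \<ge> 0"
  then have "nat (k + 1) = Suc (nat (k - 1 + 1))" by simp
  then show ?thesis unfolding lv_def by simp
qed

lemma lv_U: "x \<in> lv k \<Longrightarrow> U f x \<in> lv (k - 1)"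
  by (cases "k \<ge> 0") (auto simp: lv_nonneg lv_neg U_0)

lemma lv_I: "k \<ge> 0 \<Longrightarrow> (\<And>f. U f x \<in> lv (k - 1)) \<Longrightarrow> x \<in> lv k"
  by (simp add: lv_nonneg)

lemma subspace_filt: "subspace (filt n)"
  by (induction n) (auto simp: subspace_def U_add U_scale U_0)

lemma subspace_lv: "subspace (lv k)"
  by (simp add: lv_def subspace_filt)

lemmas lv_add = subspace_add[OF subspace_lv]
  and lv_diff = subspace_diff[OF subspace_lv]
  and lv_scale = subspace_scale[OF subspace_lv]
  and lv_sum = subspace_sum[OF subspace_lv]
  and lv_0_in = subspace_0[OF subspace_lv]

lemma filt_Suc: "filt n \<subseteq> filt (Suc n)"
  by (induction n) (auto simp: U_0)

lemma lv_mono: "k \<le> l \<Longrightarrow> lv k \<subseteq> lv l"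
  unfolding lv_def by (rule lift_Suc_mono_le[of filt, OF filt_Suc]) simp

lemma lv_0: "lv 0 = span {1}"
  using U_kernel by (auto simp: lv_nonneg lv_neg U_span_1)

lemma span_mult_lv:
  assumes "\<And>x y. x \<in> lv a \<Longrightarrow> y \<in> lv b \<Longrightarrow> x * y \<in> lv c"
  shows "span {x * y | x y. x \<in> lv a \<and> y \<in> lv b} \<subseteq> lv c"
  by (rule span_minimal[OF _ subspace_lv]) (use assms in auto)

text \<open>In \<open>U f (x * y)\<close> two terms lower one factor by a level and the remainder
  lowers both, so induction on the total level \<open>a + b\<close> applies to each.\<close>

lemma lv_mult: "x \<in> lv a \<Longrightarrow> y \<in> lv b \<Longrightarrow> x * y \<in> lv (a + b)"
proof (induction "nat (a + b + 1)" arbitrary: a b x y rule: less_induct)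
  case less
  show ?case
  proof (cases "a < 0 \<or> b < 0")
    case True
    then have "x * y = 0" using less.prems lv_neg by auto
    then show ?thesis by (simp add: lv_0_in)
  next
    case False
    show ?thesis
    proof (rule lv_I)
      fix f
      have 1: "span {x * y | x y. x \<in> lv (a - 1) \<and> y \<in> lv (b - 1)} \<subseteq> lv (a + b - 1)"
      proof (rule span_mult_lv)
        fix x y assume "x \<in> lv (a - 1)" "y \<in> lv (b - 1)"
        then have "x * y \<in> lv ((a - 1) + (b - 1))"
          by (intro less.hyps) (use False in auto)
        then show "x * y \<in> lv (a + b - 1)" using lv_mono[of "(a - 1) + (b - 1)" "a + b - 1"] by auto
      qed
      have 2: "U f (x * y) - x * U f y - U f x * y \<in> lv (a + b - 1)"
        using 1 U_mult[OF subspace_lv subspace_lv lv_U[OF less.prems(1)] lv_U[OF less.prems(2)], of f]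
        by auto
      have 3: "x * U f y \<in> lv (a + (b - 1))"
        by (intro less.hyps less.prems lv_U) (use False in auto)
      have 4: "U f x * y \<in> lv ((a - 1) + b)"
        by (intro less.hyps less.prems lv_U) (use False in auto)
      have "U f (x * y) = (U f (x * y) - x * U f y - U f x * y) + x * U f y + U f x * y"
        by (simp add: algebra_simps)
      also have "\<dots> \<in> lv (a + b - 1)"
        by (rule lv_add[OF lv_add[OF 2]]) (use 3 4 in \<open>simp_all add: algebra_simps\<close>)
      finally show "U f (x * y) \<in> lv (a + b - 1)" .
    qed (use False in auto)
  qed
qed

lemma lv_mult': "x \<in> lv a \<Longrightarrow> y \<in> lv b \<Longrightarrow> a + b \<le> c \<Longrightarrow> x * y \<in> lv c"
  using lv_mult lv_mono by blast

text \<open>The remainder loses one level in each factor, two in all, whereas \<open>U f\<close>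
  itself costs one: on the associated graded algebra \<open>U f\<close> is a derivation.\<close>

lemma lv_U_mult:
  assumes "x \<in> lv a" "y \<in> lv b"
  shows "U f (x * y) - x * U f y - U f x * y \<in> lv (a + b - 2)"
proof -
  have "span {x * y | x y. x \<in> lv (a - 1) \<and> y \<in> lv (b - 1)} \<subseteq> lv (a + b - 2)"
    by (rule span_mult_lv) (auto intro!: lv_mult')
  then show ?thesis
    using U_mult[OF subspace_lv subspace_lv lv_U[OF assms(1)] lv_U[OF assms(2)], of f] by auto
qed

text \<open>The associated graded algebra is commutative.\<close>

lemma lv_commutator: "x \<in> lv a \<Longrightarrow> y \<in> lv b \<Longrightarrow> x * y - y * x \<in> lv (a + b - 1)"
proof (induction "nat (a + b + 1)" arbitrary: a b x y rule: less_induct)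
  case less
  \<comment> \<open>\<open>lv_I\<close> needs the target level \<open>a + b - 1\<close> to be
    nonnegative. For \<open>a = b = 0\<close> both factors are scalars and commute outright.\<close>
  consider "a < 0 \<or> b < 0" | "a = 0" "b = 0" | "a \<ge> 0" "b \<ge> 0" "a + b > 0" by linarith
  then show ?case
  proof cases
    case 1
    then have "x * y - y * x = 0" using less.prems lv_neg by auto
    then show ?thesis by (metis lv_0_in)
  next
    case 2
    then have "x * y - y * x = 0" using less.prems
      by (auto simp: lv_0 span_1_iff scale_one_mult mult_scale_one)
    then show ?thesis by (metis lv_0_in)
  next
    case 3
    show ?thesis
    proof (rule lv_I)
      fix f
      have e1: "U f (x * y) - x * U f y - U f x * y \<in> lv (a + b - 2)"
        by (rule lv_U_mult) (use less.prems in auto)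
      have e2: "U f (y * x) - y * U f x - U f y * x \<in> lv (a + b - 2)"
        using lv_U_mult[OF less.prems(2,1), of f] by (simp add: add.commute)
      have e3: "x * U f y - U f y * x \<in> lv (a + (b - 1) - 1)"
        by (intro less.hyps less.prems lv_U) (use 3 in auto)
      have e4: "U f x * y - y * U f x \<in> lv ((a - 1) + b - 1)"
        by (intro less.hyps less.prems lv_U) (use 3 in auto)
      have "U f (x * y - y * x) = (U f (x * y) - x * U f y - U f x * y)
          - (U f (y * x) - y * U f x - U f y * x) + (x * U f y - U f y * x) + (U f x * y - y * U f x)"
        by (simp add: U_diff algebra_simps)
      also have "\<dots> \<in> lv (a + b - 2)"
        by (rule lv_add[OF lv_add[OF lv_diff[OF e1 e2]]]) (use e3 e4 in \<open>simp_all add: algebra_simps\<close>)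
      finally show "U f (x * y - y * x) \<in> lv (a + b - 1 - 1)" by simp
    qed (use 3 in auto)
  qed
qed

end

subsection \<open>Monomials\<close>

lemma sum_mset_image_lessThan:
  fixes h :: "nat \<Rightarrow> 'a::semiring_1"
  assumes "set_mset M \<subseteq> {..<r}"
  shows "(\<Sum>i\<in>#M. h i) = (\<Sum>i<r. of_nat (count M i) * h i)"
  using assms
proof (induction M)
  case (add j M)
  have "(\<Sum>i<r. of_nat (count (add_mset j M) i) * h i)
      = (\<Sum>i<r. (if i = j then h j else 0) + of_nat (count M i) * h i)"
    by (intro sum.cong) (auto simp: distrib_right)
  also have "\<dots> = h j + (\<Sum>i<r. of_nat (count M i) * h i)"
    using add.prems by (simp add: sum.distrib)
  finally show ?case using add by simp
qed auto

lemma sum_mset_image_diff: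
  fixes h g :: "'b \<Rightarrow> 'a::ab_group_add"
  shows "(\<Sum>i\<in>#M. h i - g i) = (\<Sum>i\<in>#M. h i) - (\<Sum>i\<in>#M. g i)"
  by (induction M) auto

text \<open>Multisets over \<open>{..<r}\<close> serve as exponent vectors of monomials in
  \<open>r\<close> variables, so that differentiating by a variable removes one element;
  \<open>t\<close> is a cut-off that makes the sums finite.\<close>

definition msets_upto :: "nat \<Rightarrow> nat \<Rightarrow> nat multiset set" where
  "msets_upto r t = {M. set_mset M \<subseteq> {..<r} \<and> size M \<le> t}"

lemma finite_msets_upto: "finite (msets_upto r t)"
proof (rule finite_subset)
  show "msets_upto r t \<subseteq> mset ` {l. set l \<subseteq> {..<r} \<and> length l \<le> t}"
  proof
    fix M assume "M \<in> msets_upto r t"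
    moreover obtain l where "M = mset l" by (metis ex_mset)
    ultimately show "M \<in> mset ` {l. set l \<subseteq> {..<r} \<and> length l \<le> t}"
      by (auto simp: msets_upto_def)
  qed
  show "finite (mset ` {l. set l \<subseteq> {..<r} \<and> length l \<le> t})"
    by (intro finite_imageI finite_lists_length_le) auto
qed

text \<open>Differentiating by variable \<open>i\<close> moves the coefficient of
  \<open>add_mset i M\<close> to \<open>M\<close>. The vanishing hypotheses absorb the monomials
  without \<open>i\<close> and those pushed past the cut-off.\<close>

lemma sum_msets_upto_shift:
  fixes G :: "nat multiset \<Rightarrow> 'a::comm_monoid_add"
  assumes "i < r" "\<And>M. i \<notin># M \<Longrightarrow> G M = 0" "\<And>M. M \<notin> msets_upto r t \<Longrightarrow> G M = 0"
  shows "(\<Sum>M\<in>msets_upto r t. G M) = (\<Sum>M\<in>msets_upto r t. G (add_mset i M))"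
proof -
  let ?A = "msets_upto r t" and ?B = "add_mset i ` msets_upto r t"
  have fin: "finite (?A \<union> ?B)" by (simp add: finite_msets_upto)
  have "sum G ?A = sum G (?A \<union> ?B)"
    by (rule sum.mono_neutral_left[OF fin]) (use assms in auto)
  also have "\<dots> = sum G ?B"
  proof (rule sum.mono_neutral_right[OF fin])
    show "\<forall>M\<in>?A \<union> ?B - ?B. G M = 0"
    proof
      fix M assume M: "M \<in> ?A \<union> ?B - ?B"
      have "i \<notin># M"
      proof
        assume i: "i \<in># M"
        then have "M = add_mset i (M - {#i#})" by simp
        moreover have "M - {#i#} \<in> ?A" using M i
          by (auto simp: msets_upto_def size_Diff_singleton dest: in_diffD)
        ultimately show False using M by blast
      qed
      then show "G M = 0" by (rule assms(2))
    qed
  qed auto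
  also have "\<dots> = (\<Sum>M\<in>?A. G (add_mset i M))"
    by (subst sum.reindex) (auto simp: inj_on_def)
  finally show ?thesis .
qed

context graded_coaction
begin

section \<open>Degrees, filtration levels and ordered monomials\<close>

definition Hlt :: "nat \<Rightarrow> 'h set" where
  "Hlt n = span (\<Union>\<beta>\<in>{\<beta>. deg \<beta> < n}. Hc \<beta>)"

lemma subspace_Hlt: "subspace (Hlt n)"
  unfolding Hlt_def by (rule subspace_span)

lemma component_subset_Hlt: "deg \<gamma> < n \<Longrightarrow> Hc \<gamma> \<subseteq> Hlt n"
  unfolding Hlt_def by (rule subset_trans[OF _ span_superset]) (rule UN_upper, simp)

lemma Hlt_mono: "m \<le> n \<Longrightarrow> Hlt m \<subseteq> Hlt n"
  unfolding Hlt_def by (rule span_mono, rule UN_mono) auto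

lemma ex_Hlt: "\<exists>n. x \<in> Hlt n"
proof -
  obtain f :: "'g \<Rightarrow>\<^sub>0 'h" where f: "\<forall>\<gamma>. Poly_Mapping.lookup f \<gamma> \<in> Hc \<gamma>"
    "x = (\<Sum>\<gamma>\<in>Poly_Mapping.keys f. Poly_Mapping.lookup f \<gamma>)"
    using direct_sum[of x] by blast
  define n where "n = Suc (Max (deg ` Poly_Mapping.keys f))"
  have "x \<in> Hlt n" unfolding f(2)
  proof (rule subspace_sum[OF subspace_Hlt])
    fix \<gamma> assume "\<gamma> \<in> Poly_Mapping.keys f"
    then have "deg \<gamma> < n" by (simp add: n_def le_imp_less_Suc)
    then show "Poly_Mapping.lookup f \<gamma> \<in> Hlt n" using f(1) component_subset_Hlt by blast
  qed
  then show ?thesis by blast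
qed

text \<open>Each \<open>U f\<close> strictly lowers the degree, so any
  \<open>deg \<gamma> + 1\<close> of them in succession annihilate the component. This makes the
  filtration exhaust \<open>H\<close>.\<close>

lemma component_subset_lv: "Hc \<gamma> \<subseteq> lv (int (deg \<gamma>))"
proof (induction "deg \<gamma>" arbitrary: \<gamma> rule: less_induct)
  case less
  show ?case
  proof
    fix x assume x: "x \<in> Hc \<gamma>"
    show "x \<in> lv (int (deg \<gamma>))"
    proof (rule lv_I)
      fix f
      have "span (\<Union>\<beta>\<in>{\<beta>. deg \<beta> < deg \<gamma>}. Hc \<beta>) \<subseteq> lv (int (deg \<gamma>) - 1)"
      proof (rule span_minimal[OF _ subspace_lv], safe)
        fix \<beta> y assume "deg \<beta> < deg \<gamma>" "y \<in> Hc \<beta>"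
        then show "y \<in> lv (int (deg \<gamma>) - 1)"
          using less[of \<beta>] lv_mono[of "int (deg \<beta>)" "int (deg \<gamma>) - 1"] by auto
      qed
      then show "U f x \<in> lv (int (deg \<gamma>) - 1)" using U_graded[OF x, where f = f] by blast
    qed simp
  qed
qed

lemma Hlt_subset_lv: "Hlt n \<subseteq> lv (int n)"
  unfolding Hlt_def
proof (rule span_minimal[OF _ subspace_lv], safe)
  fix \<beta> y assume "deg \<beta> < n" "y \<in> Hc \<beta>"
  then show "y \<in> lv (int n)"
    using component_subset_lv[of \<beta>] lv_mono[of "int (deg \<beta>)" "int n"] by auto
qed

lemma ex_lv: "\<exists>n::nat. x \<in> lv (int n)"
  using ex_Hlt Hlt_subset_lv by blast

definition stable :: "'h set \<Rightarrow> bool" where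
  "stable B \<longleftrightarrow> subalgebra s B \<and> (\<forall>x\<in>B. \<forall>f. U f x \<in> B)"

lemma stable_subspace: "stable B \<Longrightarrow> subspace B"
  and stable_1: "stable B \<Longrightarrow> 1 \<in> B"
  and stable_mult: "stable B \<Longrightarrow> x \<in> B \<Longrightarrow> y \<in> B \<Longrightarrow> x * y \<in> B"
  and stable_U: "stable B \<Longrightarrow> x \<in> B \<Longrightarrow> U f x \<in> B"
  by (auto simp: stable_def subalgebra_def)

lemma stable_scalar: "stable B \<Longrightarrow> s c 1 \<in> B"
  using stable_subspace stable_1 subspace_scale by blast

text \<open>The factors stand in increasing order of their indices. Since the associated graded
  algebra is commutative, another order would change the product only at lower levels.\<close>

definition mon :: "(nat \<Rightarrow> 'h) \<Rightarrow> nat multiset \<Rightarrow> 'h" where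
  "mon x M = prod_list (map x (sorted_list_of_multiset M))"

definition wtm :: "(nat \<Rightarrow> int) \<Rightarrow> nat multiset \<Rightarrow> int" where
  "wtm wt M = (\<Sum>i\<in>#M. wt i)"

lemma wtm_add [simp]: "wtm wt (add_mset i M) = wt i + wtm wt M"
  by (simp add: wtm_def)

lemma mon_empty [simp]: "mon x {#} = 1"
  by (simp add: mon_def)

lemma prod_list_lv:
  "(\<And>i. i \<in> set l \<Longrightarrow> x i \<in> lv (wt i)) \<Longrightarrow> prod_list (map x l) \<in> lv (sum_list (map wt l))"
  by (induction l) (auto simp: lv_0 span_base intro: lv_mult)

lemma wtm_sorted_list: "wtm wt M = sum_list (map wt (sorted_list_of_multiset M))"
  unfolding wtm_def
  by (metis mset_map mset_sorted_list_of_multiset sum_mset_sum_list)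

lemma mon_lv:
  "(\<And>i. i \<in># M \<Longrightarrow> x i \<in> lv (wt i)) \<Longrightarrow> mon x M \<in> lv (wtm wt M)"
  unfolding mon_def wtm_sorted_list by (rule prod_list_lv) simp

text \<open>Sorting \<open>x i\<close> into place passes it over factors of smaller index, and every
  transposition costs a commutator, which is one level lower.\<close>

lemma prod_list_insort_lv:
  assumes "\<And>j. j \<in> set (i # l) \<Longrightarrow> x j \<in> lv (wt j)"
  shows "prod_list (map x (insort i l)) - x i * prod_list (map x l)
    \<in> lv (wt i + sum_list (map wt l) - 1)"
  using assms
proof (induction l)
  case (Cons j l)
  let ?p = "prod_list (map x l)"
  show ?case
  proof (cases "i \<le> j")
    case False
    have xi: "x i \<in> lv (wt i)" and xj: "x j \<in> lv (wt j)" using Cons.prems by auto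
    have IH: "prod_list (map x (insort i l)) - x i * ?p \<in> lv (wt i + sum_list (map wt l) - 1)"
      by (rule Cons.IH) (use Cons.prems in auto)
    have p: "?p \<in> lv (sum_list (map wt l))"
      by (rule prod_list_lv) (use Cons.prems in auto)
    have 1: "x j * (prod_list (map x (insort i l)) - x i * ?p)
        \<in> lv (wt i + sum_list (map wt (j # l)) - 1)"
      by (rule lv_mult'[OF xj IH]) simp
    have 2: "(x j * x i - x i * x j) * ?p \<in> lv (wt i + sum_list (map wt (j # l)) - 1)"
      by (rule lv_mult'[OF lv_commutator[OF xj xi] p]) simp
    have "prod_list (map x (insort i (j # l))) - x i * prod_list (map x (j # l))
      = x j * (prod_list (map x (insort i l)) - x i * ?p) + (x j * x i - x i * x j) * ?p"
      using False by (simp add: algebra_simps)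
    then show ?thesis using lv_add[OF 1 2] by simp
  qed (simp add: lv_0_in)
qed (simp add: lv_0_in)

lemma mon_add_mset_lv:
  assumes "\<And>j. j \<in># add_mset i M \<Longrightarrow> x j \<in> lv (wt j)"
  shows "mon x (add_mset i M) - x i * mon x M \<in> lv (wt i + wtm wt M - 1)"
  using prod_list_insort_lv[of i "sorted_list_of_multiset M" x wt] assms
  by (simp add: mon_def wtm_sorted_list)

lemma sum_mset_lv: "(\<And>i. i \<in># M \<Longrightarrow> h i \<in> lv k) \<Longrightarrow> (\<Sum>i\<in>#M. h i) \<in> lv k"
  by (induction M) (auto simp: lv_0_in intro: lv_add)

text \<open>Modulo lower terms, \<open>U f\<close> acts on monomials as a derivation.\<close>

lemma U_mon:
  assumes "\<And>i. i \<in># M \<Longrightarrow> x i \<in> lv (wt i)"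
  shows "U f (mon x M) - (\<Sum>i\<in>#M. U f (x i) * mon x (M - {#i#})) \<in> lv (wtm wt M - 2)"
  using assms
proof (induction M)
  case empty
  then show ?case by (simp add: U_one lv_0_in)
next
  case (add j M)
  let ?k = "wtm wt (add_mset j M) - 2"
  let ?S = "\<Sum>i\<in>#M. U f (x i) * mon x (M - {#i#})"
  have xj: "x j \<in> lv (wt j)" using add.prems by simp
  have mM: "mon x M \<in> lv (wtm wt M)" using add.prems by (intro mon_lv) auto
  have 1: "U f (mon x (add_mset j M) - x j * mon x M) \<in> lv ?k"
    using lv_U[OF mon_add_mset_lv[where x = x and wt = wt and i = j and M = M], where f = f] add.prems
    by simp
  have 2: "U f (x j * mon x M) - x j * U f (mon x M) - U f (x j) * mon x M \<in> lv ?k"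
    using lv_U_mult[OF xj mM, where f = f] by simp
  have 3: "x j * (U f (mon x M) - ?S) \<in> lv ?k"
    by (rule lv_mult'[OF xj add.IH]) (use add.prems in simp_all)
  \<comment> \<open>Moving \<open>x j\<close> past \<open>U f (x i)\<close> and sorting it into the
    monomial each cost one level, in addition to the one lost by \<open>U f\<close>.\<close>
  have 4: "(\<Sum>i\<in>#M. x j * (U f (x i) * mon x (M - {#i#}))
        - U f (x i) * mon x (add_mset j M - {#i#})) \<in> lv ?k"
  proof (rule sum_mset_lv)
    fix i assume i: "i \<in># M"
    let ?m = "mon x (M - {#i#})"
    have xi: "U f (x i) \<in> lv (wt i - 1)" using add.prems i by (intro lv_U) auto
    have w: "wtm wt M = wt i + wtm wt (M - {#i#})"
      by (metis i insert_DiffM wtm_add)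
    have m: "?m \<in> lv (wtm wt (M - {#i#}))"
      using add.prems by (intro mon_lv) (auto dest: in_diffD)
    have a: "(x j * U f (x i) - U f (x i) * x j) * ?m \<in> lv ?k"
      by (rule lv_mult'[OF lv_commutator[OF xj xi] m]) (simp add: w)
    have b0: "mon x (add_mset j (M - {#i#})) - x j * ?m \<in> lv (wt j + wtm wt (M - {#i#}) - 1)"
      using add.prems by (intro mon_add_mset_lv) (auto dest: in_diffD)
    have b: "U f (x i) * (mon x (add_mset j (M - {#i#})) - x j * ?m) \<in> lv ?k"
      by (rule lv_mult'[OF xi b0]) (simp add: w)
    have "add_mset j M - {#i#} = add_mset j (M - {#i#})" using i by simp
    then show "x j * (U f (x i) * ?m) - U f (x i) * mon x (add_mset j M - {#i#}) \<in> lv ?k"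
      using lv_diff[OF a b] by (simp add: algebra_simps)
  qed
  have 5: "(\<Sum>i\<in>#M. x j * (U f (x i) * mon x (M - {#i#})) - U f (x i) * mon x (add_mset j M - {#i#}))
     = x j * ?S - (\<Sum>i\<in>#M. U f (x i) * mon x (add_mset j M - {#i#}))" (is "_ = _ - ?S'")
    unfolding sum_mset_distrib_left by (rule sum_mset_image_diff)
  have 6: "(\<Sum>i\<in>#add_mset j M. U f (x i) * mon x (add_mset j M - {#i#})) = U f (x j) * mon x M + ?S'"
    by simp
  have "U f (mon x (add_mset j M)) - (U f (x j) * mon x M + ?S')
     = U f (mon x (add_mset j M) - x j * mon x M)
     + (U f (x j * mon x M) - x j * U f (mon x M) - U f (x j) * mon x M)
     + x j * (U f (mon x M) - ?S) + (x j * ?S - ?S')"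
    unfolding U_diff right_diff_distrib by simp
  also have "\<dots> \<in> lv ?k"
    by (rule lv_add[OF lv_add[OF lv_add[OF 1 2] 3] 4[unfolded 5]])
  finally show ?case unfolding 6 .
qed

end

subsection \<open>Independence of symbols\<close>

lemma (in vector_space) independent_family:
  assumes fin: "finite I" and zero: "\<And>c i. (\<Sum>j\<in>I. scale (c j) (v j)) = 0 \<Longrightarrow> i \<in> I \<Longrightarrow> c i = 0"
  shows "inj_on v I" "independent (v ` I)"
proof -
  show inj: "inj_on v I"
  proof (rule inj_onI, rule ccontr)
    fix i j assume ij: "i \<in> I" "j \<in> I" "v i = v j" "i \<noteq> j"
    define c :: "'c \<Rightarrow> 'a" where "c = (\<lambda>k. if k = i then 1 else if k = j then -1 else 0)"
    have "(\<Sum>k\<in>I. scale (c k) (v k)) = (\<Sum>k\<in>{i, j}. scale (c k) (v k))"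
      by (rule sum.mono_neutral_right[OF fin]) (use ij in \<open>auto simp: c_def\<close>)
    also have "\<dots> = 0" using ij by (simp add: c_def)
    finally have "c i = 0" by (rule zero) fact
    then show False by (simp add: c_def)
  qed
  show "independent (v ` I)"
  proof (rule independent_if_scalars_zero)
    fix g y assume *: "(\<Sum>y\<in>v ` I. scale (g y) y) = 0" "y \<in> v ` I"
    then obtain i where i: "i \<in> I" "y = v i" by auto
    have "(\<Sum>j\<in>I. scale (g (v j)) (v j)) = 0"
      using * by (simp add: sum.reindex[OF inj])
    then have "g (v i) = 0" using i(1) by (rule zero[where c = "\<lambda>j. g (v j)"])
    then show "g y = 0" using i by simp
  qed (simp add: fin)
qed

context graded_coaction
begin

text \<open>The symbols of the \<open>x\<^sub>i\<close> in the associated graded algebra are linearly independent modulo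
  the associated graded algebra of \<open>B\<close>.\<close>

definition adapted :: "'h set \<Rightarrow> nat \<Rightarrow> (nat \<Rightarrow> 'h) \<Rightarrow> (nat \<Rightarrow> int) \<Rightarrow> bool" where
  "adapted B r x wt \<longleftrightarrow>
     (\<forall>i<r. 1 \<le> wt i \<and> x i \<in> lv (wt i) \<and> (\<forall>f. U f (x i) \<in> B)) \<and>
     (\<forall>n c b. b \<in> B \<longrightarrow> b + (\<Sum>i | i < r \<and> wt i = n. s (c i) (x i)) \<in> lv (n - 1) \<longrightarrow>
        (\<forall>i<r. wt i = n \<longrightarrow> c i = 0))"

lemma wtm_nonneg: "(\<And>i. i \<in># M \<Longrightarrow> 0 \<le> wt i) \<Longrightarrow> 0 \<le> wtm wt M"
  by (induction M) (auto simp: wtm_def)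

lemma of_nat_mult_in_subspace: "subspace V \<Longrightarrow> y \<in> V \<Longrightarrow> of_nat n * y \<in> V"
  by (simp add: of_nat_mult_eq_scale subspace_scale)

text \<open>
  Induction on \<open>N\<close>: applying \<open>U f\<close> to a relation at level \<open>N\<close> gives a relation at level \<open>N - 1\<close> with
  coefficients \<open>U f (b M) + (\<Sum>i<r. (count M i + 1) b (M + i) U f (x i))\<close>, which are therefore of lower
  order. Going down in the size of \<open>M\<close>, this lowers \<open>b M\<close>, except when \<open>b M\<close> is a scalar; such a scalar
  is, up to a positive integer factor, a coefficient in a linear relation between the \<open>x i\<close> that
  adaptedness excludes. This is where characteristic \<open>0\<close> is needed.
\<close>

lemma adapted_symbols_independent:
  assumes B: "stable B" and ad: "adapted B r x wt"
  shows "(\<And>M. b M \<in> B) \<Longrightarrow> (\<And>M. b M \<in> lv (N - wtm wt M)) \<Longrightarrow>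
    (\<And>M. M \<notin> msets_upto r t \<Longrightarrow> b M = 0) \<Longrightarrow>
    (\<Sum>M\<in>msets_upto r t. b M * mon x M) \<in> lv (N - 1) \<Longrightarrow> b M \<in> lv (N - 1 - wtm wt M)"
proof (induction "nat (N + 1)" arbitrary: N b M rule: less_induct)
  case less
  note bB = less.prems(1) and blv = less.prems(2) and b0 = less.prems(3) and bsum = less.prems(4)
  have x: "1 \<le> wt i" "x i \<in> lv (wt i)" "\<And>f. U f (x i) \<in> B" if "i < r" for i
    using ad that by (auto simp: adapted_def)
  have wtm0: "0 \<le> wtm wt M" if "M \<in> msets_upto r t" for M
    using that x(1) by (intro wtm_nonneg) (force simp: msets_upto_def)
  show ?case
  proof (cases "N < 0")
    case True
    have "b M = 0"
    proof (cases "M \<in> msets_upto r t")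
      case True
      then show ?thesis using blv[of M] wtm0[of M] \<open>N < 0\<close> lv_neg[of "N - wtm wt M"] by auto
    qed (rule b0)
    then show ?thesis by (simp add: lv_0_in)
  next
    case False
    define b' where "b' f M = U f (b M) + (\<Sum>i<r. of_nat (Suc (count M i)) * (b (add_mset i M) * U f (x i)))"
      for f M
    have b'B: "b' f M \<in> B" for f M
      unfolding b'_def
      by (intro subspace_add subspace_sum of_nat_mult_in_subspace stable_subspace[OF B]
          stable_U[OF B] stable_mult[OF B] bB x(3)) simp
    have bUx: "b (add_mset i M) * U f (x i) \<in> lv k"
      if "i < r" "b (add_mset i M) \<in> lv l" "l + wt i - 1 \<le> k" for f M i k l
      by (rule lv_mult'[OF that(2) lv_U[OF x(2)[OF that(1)]]]) (use that in simp)
    have b'lv: "b' f M \<in> lv (N - 1 - wtm wt M)" for f M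
      unfolding b'_def
    proof (intro lv_add lv_sum of_nat_mult_in_subspace subspace_lv)
      show "U f (b M) \<in> lv (N - 1 - wtm wt M)"
        using lv_U[OF blv[of M], of f] by (simp add: algebra_simps)
      fix i assume "i \<in> {..<r}"
      then show "b (add_mset i M) * U f (x i) \<in> lv (N - 1 - wtm wt M)"
        by (intro bUx[OF _ blv]) auto
    qed
    have b'0: "b' f M = 0" if "M \<notin> msets_upto r t" for f M
    proof -
      have "add_mset i M \<notin> msets_upto r t" for i using that by (auto simp: msets_upto_def)
      then show ?thesis using that b0 by (simp add: b'_def U_0)
    qed
    have b'sum: "(\<Sum>M\<in>msets_upto r t. b' f M * mon x M) \<in> lv (N - 1 - 1)" for f
    proof -
      \<comment> \<open>\<open>G i M\<close> is what \<open>U f\<close> produces from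
        \<open>b M * mon x M\<close> by differentiating \<open>x i\<close>. It multiplies the
        monomial of \<open>M - {#i#}\<close>, and \<open>shift\<close> below re-attaches it
        there.\<close>
      define G where "G i M = of_nat (count M i) * (b M * U f (x i) * mon x (M - {#i#}))" for i M
      have D: "U f (b M * mon x M) - U f (b M) * mon x M - (\<Sum>i<r. G i M) \<in> lv (N - 2)"
        if M: "M \<in> msets_upto r t" for M
      proof -
        have xM: "x i \<in> lv (wt i)" if "i \<in># M" for i using M that x(2) by (auto simp: msets_upto_def)
        let ?S = "\<Sum>i\<in>#M. U f (x i) * mon x (M - {#i#})"
        have 1: "U f (b M * mon x M) - b M * U f (mon x M) - U f (b M) * mon x M \<in> lv (N - 2)"
          using lv_U_mult[OF blv[of M] mon_lv[of M x wt, OF xM], of f] by simp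
        have 2: "b M * (U f (mon x M) - ?S) \<in> lv (N - 2)"
          by (rule lv_mult'[OF blv U_mon[where wt = wt, OF xM]]) auto
        have "b M * ?S = (\<Sum>i\<in>#M. b M * (U f (x i) * mon x (M - {#i#})))"
          by (rule sum_mset_distrib_left)
        also have "\<dots> = (\<Sum>i<r. G i M)"
          using M by (subst sum_mset_image_lessThan[of M r]) (auto simp: msets_upto_def G_def mult.assoc)
        finally have "U f (b M * mon x M) - U f (b M) * mon x M - (\<Sum>i<r. G i M)
          = (U f (b M * mon x M) - b M * U f (mon x M) - U f (b M) * mon x M)
            + b M * (U f (mon x M) - ?S)"
          by (simp add: right_diff_distrib)
        then show ?thesis using lv_add[OF 1 2] by (simp only:)
      qed
      have shift: "(\<Sum>M\<in>msets_upto r t. G i M) = (\<Sum>M\<in>msets_upto r t. G i (add_mset i M))"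
        if "i < r" for i
      proof (rule sum_msets_upto_shift[OF that])
        show "G i M = 0" if "i \<notin># M" for M using that unfolding G_def not_in_iff by simp
        show "G i M = 0" if "M \<notin> msets_upto r t" for M using b0[OF that] by (simp add: G_def)
      qed
      have "(\<Sum>M\<in>msets_upto r t. \<Sum>i<r. G i M) = (\<Sum>i<r. \<Sum>M\<in>msets_upto r t. G i M)"
        by (rule sum.swap)
      also have "\<dots> = (\<Sum>i<r. \<Sum>M\<in>msets_upto r t. G i (add_mset i M))"
        by (intro sum.cong refl shift) simp
      also have "\<dots> = (\<Sum>M\<in>msets_upto r t. \<Sum>i<r. G i (add_mset i M))"
        by (rule sum.swap)
      finally have sw: "(\<Sum>M\<in>msets_upto r t. \<Sum>i<r. G i M)
        = (\<Sum>M\<in>msets_upto r t. \<Sum>i<r. G i (add_mset i M))" .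
      have "b' f M * mon x M = U f (b M) * mon x M + (\<Sum>i<r. G i (add_mset i M))" for M
        by (simp add: b'_def G_def distrib_right sum_distrib_right mult.assoc)
      then have "(\<Sum>M\<in>msets_upto r t. b' f M * mon x M)
        = (\<Sum>M\<in>msets_upto r t. U f (b M) * mon x M) + (\<Sum>M\<in>msets_upto r t. \<Sum>i<r. G i M)"
        by (simp add: sum.distrib sw)
      also have "\<dots> = U f (\<Sum>M\<in>msets_upto r t. b M * mon x M)
        - (\<Sum>M\<in>msets_upto r t. U f (b M * mon x M) - U f (b M) * mon x M - (\<Sum>i<r. G i M))"
        by (simp add: U_sum sum_subtractf)
      also have "\<dots> \<in> lv (N - 1 - 1)"
        by (rule lv_diff[OF lv_U[OF bsum] lv_sum]) (use D in simp)
      finally show ?thesis .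
    qed
    have IH: "b' f M \<in> lv (N - 2 - wtm wt M)" for f M
      using less.hyps[of "N - 1" "b' f" M] b'B b'lv b'0 b'sum False by simp
    let ?Q = "\<lambda>M. b M \<in> lv (N - 1 - wtm wt M)"
    \<comment> \<open>If all coefficients one size up are already lowered, the sum inside
      \<open>b' f M\<close> is low, and so is \<open>U f (b M)\<close>. The bound \<open>w\<close>
      keeps the target level nonnegative, as \<open>lv_I\<close> demands.\<close>
    have step: "?Q M" if Q: "\<And>i. i < r \<Longrightarrow> ?Q (add_mset i M)" and w: "wtm wt M < N" for M
    proof (rule lv_I)
      fix f
      have "b (add_mset i M) * U f (x i) \<in> lv (N - 2 - wtm wt M)" if "i < r" for i
        by (rule bUx[OF that Q[OF that]]) simp
      then have "b' f M - (\<Sum>i<r. of_nat (Suc (count M i)) * (b (add_mset i M) * U f (x i)))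
          \<in> lv (N - 2 - wtm wt M)"
        by (intro lv_diff IH lv_sum of_nat_mult_in_subspace subspace_lv) simp
      then show "U f (b M) \<in> lv (N - 1 - wtm wt M - 1)" by (simp add: b'_def algebra_simps)
    qed (use w in simp)
    show "?Q M"
    proof (induction "Suc t - size M" arbitrary: M rule: less_induct)
      case (less M)
      have bigger: "?Q M'" if "size M < size M'" for M'
      proof (cases "size M \<le> t")
        case True
        then show ?thesis using that by (intro less) simp
      next
        case False
        then have "b M' = 0" using that by (intro b0) (simp add: msets_upto_def)
        then show ?thesis by (simp add: lv_0_in)
      qed
      \<comment> \<open>For \<open>wtm wt M > N\<close> the coefficient lies in a negative level and
        is 0. At equality it is a scalar, which has to be shown to vanish.\<close>
      consider "b M = 0" | "M \<in> msets_upto r t" "wtm wt M < N" | "M \<in> msets_upto r t" "wtm wt M = N"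
        using b0[of M] blv[of M] lv_neg[of "N - wtm wt M"] by fastforce
      then show ?case
      proof cases
        case 1
        then show ?thesis by (simp add: lv_0_in)
      next
        case 2
        show ?thesis by (rule step[OF bigger 2(2)]) simp
      next
        case 3
        show ?thesis
        \<comment> \<open>For the empty monomial \<open>N = 0\<close>; all other monomials have
          positive weight, hence zero coefficient, and the relation itself says that
          \<open>b {#}\<close> lies in \<open>lv (- 1)\<close>.\<close>
        proof (cases "M = {#}")
          case True
          have "b M' * mon x M' = 0" if "M' \<in> msets_upto r t - {{#}}" for M'
          proof -
            from that obtain i e where M': "M' = add_mset i e" using multiset_cases by blast
            then have "i < r" "e \<in> msets_upto r t" using that by (auto simp: msets_upto_def)
            then have "wtm wt M' > 0" using x(1)[of i] wtm0[of e] M' by simp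
            then have "b M' = 0" using blv[of M'] lv_neg[of "N - wtm wt M'"] 3 True
              by (simp add: wtm_def)
            then show ?thesis by simp
          qed
          then have "(\<Sum>M\<in>msets_upto r t. b M * mon x M) = (\<Sum>M\<in>{{#}}. b M * mon x M)"
            by (intro sum.mono_neutral_right finite_msets_upto) (auto simp: msets_upto_def)
          then show ?thesis using bsum True 3 by (simp add: wtm_def)
        next
          case False
          then obtain i e where M: "M = add_mset i e" using multiset_cases by blast
          have i: "i < r" using 3 M by (auto simp: msets_upto_def)
          define n where "n = wt i"
          have n: "N = n + wtm wt e" "1 \<le> n" using 3 M x(1)[OF i] by (auto simp: n_def)
          let ?J = "{j. j < r \<and> wt j = n}"
          have "\<exists>c. b (add_mset j e) = s c 1" if "j \<in> ?J" for j
            using blv[of "add_mset j e"] that n lv_0 span_1_iff by auto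
          then obtain c where c: "\<And>j. j \<in> ?J \<Longrightarrow> b (add_mset j e) = s (c j) 1" by metis
          define c' where "c' j = of_nat (Suc (count e j)) * c j" for j
          \<comment> \<open>\<open>U f y\<close> agrees with \<open>b' f e\<close> modulo
            \<open>lv (n - 2)\<close>: variables heavier than \<open>n\<close> have zero
            coefficient, and lighter ones are lowered by \<open>step\<close>. So \<open>y\<close>
            drops to level \<open>n - 1\<close>, and adaptedness kills its coefficients.\<close>
          define y where "y = b e + (\<Sum>j\<in>?J. s (c' j) (x j))"
          have "y \<in> lv (n - 1)"
          proof (rule lv_I)
            fix f
            let ?T = "\<lambda>j. of_nat (Suc (count e j)) * (b (add_mset j e) * U f (x j))"
            have "?T j \<in> lv (n - 2)" if j: "j \<in> {..<r} - ?J" for j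
            proof -
              have "b (add_mset j e) \<in> lv (n - wt j - 1)"
              proof (cases "wt j < n")
                case True
                \<comment> \<open>\<open>add_mset j e\<close> has the same size as \<open>M\<close>,
                  out of reach of the size induction; \<open>step\<close> asks only for monomials
                  one size larger.\<close>
                have "?Q (add_mset j e)"
                  by (rule step[OF bigger]) (use True n M in auto)
                then show ?thesis using n by (simp add: algebra_simps)
              next
                case False
                then have "b (add_mset j e) = 0"
                  using blv[of "add_mset j e"] j n lv_neg[of "N - wtm wt (add_mset j e)"] by auto
                then show ?thesis by (simp add: lv_0_in)
              qed
              then have "b (add_mset j e) * U f (x j) \<in> lv (n - 2)"
                by (rule bUx[rotated]) (use j in auto)
              then show ?thesis by (rule of_nat_mult_in_subspace[OF subspace_lv])
            qed
            then have "(\<Sum>j\<in>{..<r} - ?J. ?T j) \<in> lv (n - 2)" by (rule lv_sum)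
            moreover have "b' f e \<in> lv (n - 2)" using IH[of f e] n by simp
            moreover have "(\<Sum>j<r. ?T j) = (\<Sum>j\<in>{..<r} - ?J. ?T j) + (\<Sum>j\<in>?J. ?T j)"
              by (rule sum.subset_diff) auto
            ultimately have "U f (b e) + (\<Sum>j\<in>?J. ?T j) \<in> lv (n - 2)"
              using lv_diff[of "b' f e" "n - 2" "\<Sum>j\<in>{..<r} - ?J. ?T j"] by (simp add: b'_def)
            moreover have "(\<Sum>j\<in>?J. ?T j) = (\<Sum>j\<in>?J. s (c' j) (U f (x j)))"
              by (rule sum.cong)
                (simp_all add: c c'_def scale_one_mult of_nat_mult_eq_scale del: of_nat_Suc)
            ultimately show "U f y \<in> lv (n - 1 - 1)"
              by (simp add: y_def U_add U_sum U_scale)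
          qed (use n in simp)
          then have "c' i = 0"
            using ad bB[of e] i unfolding y_def adapted_def n_def by blast
          then have "c i = 0" unfolding c'_def using of_nat_neq_0 by (metis mult_eq_0_iff)
          then have "b M = 0" using c[of i] i M by (simp add: n_def)
          then show ?thesis by (simp add: lv_0_in)
        qed
      qed
    qed
  qed
qed

text \<open>A sum equal to 0 lies in every level, so the statement on symbols lowers all
  \<open>b M\<close> again and again, from a start \<open>N\<close> that covers the finitely many
  nonzero coefficients. Negative levels are zero.\<close>

lemma adapted_monomials_independent:
  assumes B: "stable B" and ad: "adapted B r x wt"
    and bB: "\<And>M. b M \<in> B" and b0: "\<And>M. M \<notin> msets_upto r t \<Longrightarrow> b M = 0"
    and sum: "(\<Sum>M\<in>msets_upto r t. b M * mon x M) = 0"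
  shows "b M = 0"
proof -
  have "\<forall>M. \<exists>n. b M \<in> lv (int n)" using ex_lv by blast
  then obtain n where n: "\<And>M. b M \<in> lv (int (n M))" by metis
  define N where "N = Max ((\<lambda>M. int (n M) + wtm wt M) ` msets_upto r t)"
  have "\<forall>M. b M \<in> lv (N - int k - wtm wt M)" for k
  proof (induction k)
    case 0
    show ?case
    proof
      fix M
      show "b M \<in> lv (N - int 0 - wtm wt M)"
      proof (cases "M \<in> msets_upto r t")
        case True
        then have "int (n M) + wtm wt M \<le> N" unfolding N_def
          by (intro Max_ge) (auto simp: finite_msets_upto)
        then have "lv (int (n M)) \<subseteq> lv (N - int 0 - wtm wt M)" by (intro lv_mono) simp
        then show ?thesis using n by blast
      qed (simp add: b0 lv_0_in)
    qed
  next
    case (Suc k)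
    have "b M \<in> lv (N - int k - 1 - wtm wt M)" for M
    proof (rule adapted_symbols_independent[OF B ad bB _ b0])
      show "b M \<in> lv (N - int k - wtm wt M)" for M using Suc by blast
      show "(\<Sum>M\<in>msets_upto r t. b M * mon x M) \<in> lv (N - int k - 1)"
        unfolding sum by (rule lv_0_in)
    qed
    then show ?case by (simp add: algebra_simps)
  qed
  then have "b M \<in> lv (N - int (nat (N - wtm wt M + 1)) - wtm wt M)" by blast
  moreover have "N - int (nat (N - wtm wt M + 1)) - wtm wt M < 0" by simp
  ultimately show ?thesis using lv_neg by auto
qed

text \<open>The monomials with every exponent at most \<open>n\<close> are independent over the
  scalars, which lie in \<open>B\<close>; there are \<open>(n + 1) ^ r\<close> of them, and they are
  words of length at most \<open>r * n\<close>.\<close>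

lemma adapted_growth_ge:
  assumes B: "stable B" and ad: "adapted B r x wt" and xA: "\<And>i. i < r \<Longrightarrow> x i \<in> A"
  shows "growth_ge A r"
proof -
  have "\<exists>S. finite S \<and> independent S \<and> (n + 1) ^ r \<le> card S \<and> S \<subseteq> span (words (x ` {..<r}) (r * n))"
    for n
  proof -
    let ?E = "{..<r} \<rightarrow>\<^sub>E {..n}"
    define \<mu> where "\<mu> g = (\<Sum>i<r. replicate_mset (g i) i)" for g :: "nat \<Rightarrow> nat"
    have count: "count (\<mu> g) i = (if i < r then g i else 0)" for g i
      by (simp add: \<mu>_def count_sum)
    have inj\<mu>: "inj_on \<mu> ?E"
    proof (rule inj_onI)
      fix g h assume "g \<in> ?E" "h \<in> ?E" "\<mu> g = \<mu> h"
      then show "g = h" using count[of g] count[of h] by (intro PiE_ext) (auto, metis)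
    qed
    define \<F> where "\<F> = \<mu> ` ?E"
    have fin: "finite \<F>" unfolding \<F>_def by (intro finite_imageI finite_PiE) auto
    have card\<F>: "card \<F> = (n + 1) ^ r"
      unfolding \<F>_def by (subst card_image[OF inj\<mu>]) (simp add: card_PiE)
    have sub: "\<F> \<subseteq> msets_upto r (r * n)"
    proof
      fix M assume "M \<in> \<F>"
      then obtain g where g: "g \<in> ?E" "M = \<mu> g" by (auto simp: \<F>_def)
      have "size M = (\<Sum>i<r. g i)" by (simp add: g \<mu>_def size_multiset_sum)
      also have "\<dots> \<le> (\<Sum>i<r. n)" by (rule sum_mono) (use g in auto)
      finally have "size M \<le> r * n" by simp
      moreover have "set_mset M \<subseteq> {..<r}"
      proof
        fix i assume "i \<in># M"
        then have "count M i > 0" by simp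
        then show "i \<in> {..<r}" using count[of g i] g by (auto split: if_splits)
      qed
      ultimately show "M \<in> msets_upto r (r * n)" by (simp add: msets_upto_def)
    qed
    have ind: "inj_on (mon x) \<F>" "independent (mon x ` \<F>)"
    proof -
      have "c M = 0" if c: "(\<Sum>M\<in>\<F>. s (c M) (mon x M)) = 0" and M: "M \<in> \<F>" for c M
      proof -
        define b where "b M = (if M \<in> \<F> then s (c M) 1 else 0)" for M
        have "b M = 0"
        proof (rule adapted_monomials_independent[OF B ad])
          show "b M \<in> B" for M
            using stable_scalar[OF B] subspace_0[OF stable_subspace[OF B]] by (simp add: b_def)
          show "b M = 0" if "M \<notin> msets_upto r (r * n)" for M using that sub by (auto simp: b_def)
          have "(\<Sum>M\<in>msets_upto r (r * n). b M * mon x M) = (\<Sum>M\<in>\<F>. b M * mon x M)"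
            by (rule sum.mono_neutral_right[OF finite_msets_upto sub]) (simp add: b_def)
          then show "(\<Sum>M\<in>msets_upto r (r * n). b M * mon x M) = 0"
            using c by (simp add: b_def scale_one_mult)
        qed
        then show ?thesis using M by (simp add: b_def)
      qed
      then show "inj_on (mon x) \<F>" "independent (mon x ` \<F>)"
        using independent_family[OF fin, of "mon x"] by blast+
    qed
    have "mon x ` \<F> \<subseteq> words (x ` {..<r}) (r * n)"
    proof safe
      fix M assume "M \<in> \<F>"
      then have M: "set_mset M \<subseteq> {..<r}" "size M \<le> r * n" using sub by (auto simp: msets_upto_def)
      have "length (sorted_list_of_multiset M) = size M"
        by (metis mset_sorted_list_of_multiset size_mset)
      then show "mon x M \<in> words (x ` {..<r}) (r * n)" unfolding words_def mon_def
        using M by (intro CollectI exI[of _ "map x (sorted_list_of_multiset M)"]) auto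
    qed
    then have "mon x ` \<F> \<subseteq> span (words (x ` {..<r}) (r * n))" using span_superset by blast
    then show ?thesis
      using fin ind card\<F> by (intro exI[of _ "mon x ` \<F>"]) (auto simp: card_image)
  qed
  then show ?thesis unfolding growth_ge_def
    using xA by (intro exI[of _ "x ` {..<r}"] exI[of _ r]) auto
qed

subsection \<open>Homogeneous components and the degree filtration\<close>

definition decomposition :: "'h \<Rightarrow> 'g \<Rightarrow>\<^sub>0 'h" where
  "decomposition x = (THE f. (\<forall>\<gamma>. Poly_Mapping.lookup f \<gamma> \<in> Hc \<gamma>) \<and>
     x = (\<Sum>\<gamma>\<in>Poly_Mapping.keys f. Poly_Mapping.lookup f \<gamma>))"

definition proj :: "'g \<Rightarrow> 'h \<Rightarrow> 'h" where
  "proj \<gamma> x = Poly_Mapping.lookup (decomposition x) \<gamma>"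

lemma decomposition_unique:
  assumes "\<And>\<gamma>. Poly_Mapping.lookup f \<gamma> \<in> Hc \<gamma>"
    "x = (\<Sum>\<gamma>\<in>Poly_Mapping.keys f. Poly_Mapping.lookup f \<gamma>)"
  shows "decomposition x = f"
  unfolding decomposition_def using direct_sum[of x] assms by (intro the1_equality) auto

lemma decomposition:
  "(\<forall>\<gamma>. Poly_Mapping.lookup (decomposition x) \<gamma> \<in> Hc \<gamma>) \<and>
    x = (\<Sum>\<gamma>\<in>Poly_Mapping.keys (decomposition x). Poly_Mapping.lookup (decomposition x) \<gamma>)"
  unfolding decomposition_def by (rule theI'[OF direct_sum])

lemma proj_in: "proj \<gamma> x \<in> Hc \<gamma>"
  using decomposition by (simp add: proj_def)

lemma sum_proj_keys: "x = (\<Sum>\<gamma>\<in>Poly_Mapping.keys (decomposition x). proj \<gamma> x)"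
  using decomposition by (simp add: proj_def)

lemma sum_lookup_keys:
  fixes f :: "'a \<Rightarrow>\<^sub>0 'b::comm_monoid_add"
  shows "finite I \<Longrightarrow> Poly_Mapping.keys f \<subseteq> I \<Longrightarrow>
    (\<Sum>i\<in>Poly_Mapping.keys f. Poly_Mapping.lookup f i) = (\<Sum>i\<in>I. Poly_Mapping.lookup f i)"
  by (rule sum.mono_neutral_left) (auto simp: in_keys_iff)

lemma proj_add: "proj \<gamma> (x + y) = proj \<gamma> x + proj \<gamma> y"
proof -
  let ?f = "decomposition x" and ?g = "decomposition y"
  let ?I = "Poly_Mapping.keys ?f \<union> Poly_Mapping.keys ?g"
  have "decomposition (x + y) = ?f + ?g"
  proof (rule decomposition_unique)
    show "Poly_Mapping.lookup (?f + ?g) \<gamma> \<in> Hc \<gamma>" for \<gamma>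
      using decomposition subspace_add[OF component_subspace] by (simp add: lookup_add)
    have "(\<Sum>\<gamma>\<in>Poly_Mapping.keys (?f + ?g). Poly_Mapping.lookup (?f + ?g) \<gamma>)
        = (\<Sum>\<gamma>\<in>?I. Poly_Mapping.lookup (?f + ?g) \<gamma>)"
      by (rule sum_lookup_keys[OF _ keys_add]) simp
    also have "\<dots> = (\<Sum>\<gamma>\<in>?I. Poly_Mapping.lookup ?f \<gamma>) + (\<Sum>\<gamma>\<in>?I. Poly_Mapping.lookup ?g \<gamma>)"
      by (simp add: lookup_add sum.distrib)
    also have "(\<Sum>\<gamma>\<in>?I. Poly_Mapping.lookup ?f \<gamma>) = x"
      using decomposition[of x] by (subst sum_lookup_keys[symmetric]) auto
    also have "(\<Sum>\<gamma>\<in>?I. Poly_Mapping.lookup ?g \<gamma>) = y"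
      using decomposition[of y] by (subst sum_lookup_keys[symmetric]) auto
    finally show "x + y = (\<Sum>\<gamma>\<in>Poly_Mapping.keys (?f + ?g). Poly_Mapping.lookup (?f + ?g) \<gamma>)" ..
  qed
  then show ?thesis by (simp add: proj_def lookup_add)
qed

lemma proj_component: "x \<in> Hc \<beta> \<Longrightarrow> proj \<gamma> x = (if \<gamma> = \<beta> then x else 0)"
proof -
  assume x: "x \<in> Hc \<beta>"
  have "decomposition x = Poly_Mapping.single \<beta> x"
  proof (rule decomposition_unique)
    show "Poly_Mapping.lookup (Poly_Mapping.single \<beta> x) \<gamma> \<in> Hc \<gamma>" for \<gamma>
      using x subspace_0[OF component_subspace] by (auto simp: lookup_single when_def)
    show "x = (\<Sum>\<gamma>\<in>Poly_Mapping.keys (Poly_Mapping.single \<beta> x). Poly_Mapping.lookup (Poly_Mapping.single \<beta> x) \<gamma>)"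
      by simp
  qed
  then show ?thesis by (auto simp: proj_def lookup_single when_def)
qed

lemma proj_0: "proj \<gamma> 0 = 0"
  using proj_add[of \<gamma> 0 0] by simp

lemma proj_scale: "proj \<gamma> (s c x) = s c (proj \<gamma> x)"
proof -
  have "proj \<gamma> (\<Sum>\<beta>\<in>I. s c (proj \<beta> x)) = (\<Sum>\<beta>\<in>I. s c (proj \<gamma> (proj \<beta> x)))" if "finite I" for I
    using that
  proof (induction I)
    case (insert \<beta> I)
    have "s c (proj \<beta> x) \<in> Hc \<beta>" by (rule subspace_scale[OF component_subspace proj_in])
    then show ?case using insert by (simp add: proj_add proj_component[OF proj_in] proj_component)
  qed (simp add: proj_0)
  moreover have "proj \<gamma> (\<Sum>\<beta>\<in>I. proj \<beta> x) = (\<Sum>\<beta>\<in>I. proj \<gamma> (proj \<beta> x))" if "finite I" for I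
    using that by (induction I) (simp_all add: proj_0 proj_add)
  ultimately have "proj \<gamma> (\<Sum>\<beta>\<in>I. s c (proj \<beta> x)) = s c (proj \<gamma> (\<Sum>\<beta>\<in>I. proj \<beta> x))" if "finite I" for I
    using that by (simp add: scale_sum_right)
  then show ?thesis
    using sum_proj_keys[of x] finite_keys[of "decomposition x"] scale_sum_right by metis
qed

lemma subspace_proj_vimage: "subspace V \<Longrightarrow> subspace {x. proj \<gamma> x \<in> V}"
  by (auto simp: subspace_def proj_add proj_scale proj_0)

lemma in_span_of_proj:
  "subspace V \<Longrightarrow> (\<And>\<gamma>. proj \<gamma> x \<in> V) \<Longrightarrow> x \<in> V"
  using sum_proj_keys[of x] subspace_sum by metis

lemma homogeneous_subspace: "homogeneous s Hc V \<Longrightarrow> subspace V"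
  by (simp add: homogeneous_def)

lemma homogeneous_proj:
  assumes V: "homogeneous s Hc V" and "x \<in> V"
  shows "proj \<gamma> x \<in> V"
proof -
  have "span (\<Union>\<gamma>. V \<inter> Hc \<gamma>) \<subseteq> {x. proj \<gamma> x \<in> V}"
    by (rule span_minimal[OF _ subspace_proj_vimage])
      (use V subspace_0 in \<open>auto simp: proj_component homogeneous_def\<close>)
  moreover have "V = span (\<Union>\<gamma>. V \<inter> Hc \<gamma>)" using V by (simp add: homogeneous_def)
  ultimately show ?thesis using assms(2) by blast
qed

lemma homogeneousI:
  assumes "subspace V" "V \<subseteq> span (\<Union>\<gamma>. V \<inter> Hc \<gamma>)"
  shows "homogeneous s Hc V"
  unfolding homogeneous_def using assms span_minimal[of "\<Union>\<gamma>. V \<inter> Hc \<gamma>" V] by blast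

lemma homogeneous_component_subset:
  assumes "homogeneous s Hc V" "subspace W" "\<And>\<gamma> x. x \<in> V \<Longrightarrow> x \<in> Hc \<gamma> \<Longrightarrow> x \<in> W"
  shows "V \<subseteq> W"
proof
  fix x assume "x \<in> V"
  then show "x \<in> W"
    using in_span_of_proj[OF assms(2)] assms(3)[OF homogeneous_proj[OF assms(1)] proj_in] by blast
qed

lemma proj_Hlt: "x \<in> Hlt n \<Longrightarrow> n \<le> deg \<gamma> \<Longrightarrow> proj \<gamma> x = 0"
proof -
  assume x: "x \<in> Hlt n" and n: "n \<le> deg \<gamma>"
  have "Hlt n \<subseteq> {x. proj \<gamma> x \<in> {0}}"
    unfolding Hlt_def
    by (rule span_minimal[OF _ subspace_proj_vimage])
      (use n in \<open>auto simp: proj_component subspace_def split: if_splits\<close>)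
  then show ?thesis using x by auto
qed

lemma component_0_subset: "x \<in> Hc 0 \<Longrightarrow> x \<in> span {1}"
proof (rule U_kernel)
  fix f assume "x \<in> Hc 0"
  then have "U f x \<in> span (\<Union>\<beta>\<in>{\<beta>. deg \<beta> < deg 0}. Hc \<beta>)" by (rule U_graded)
  then show "U f x = 0" using deg_eq_0[of 0] by (simp add: span_empty)
qed

lemma Hlt_1: "Hlt 1 = span {1}"
proof
  show "Hlt 1 \<subseteq> span {1}"
    unfolding Hlt_def using component_0_subset
    by (intro span_minimal subspace_span) (auto simp: deg_eq_0)
  show "span {1} \<subseteq> Hlt 1"
    using graded_one component_subset_Hlt[of 0 1] deg_eq_0[of 0]
    by (intro span_minimal subspace_Hlt) auto
qed

lemma Hlt_mult: "x \<in> Hlt (Suc m) \<Longrightarrow> y \<in> Hlt (Suc n) \<Longrightarrow> x * y \<in> Hlt (Suc (m + n))"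
proof -
  assume "x \<in> Hlt (Suc m)" "y \<in> Hlt (Suc n)"
  then show ?thesis unfolding Hlt_def[of "Suc m"] Hlt_def[of "Suc n"]
  proof (rule mult_in_span[OF subspace_Hlt, rotated])
    fix x y assume "x \<in> (\<Union>\<beta>\<in>{\<beta>. deg \<beta> < Suc m}. Hc \<beta>)" "y \<in> (\<Union>\<beta>\<in>{\<beta>. deg \<beta> < Suc n}. Hc \<beta>)"
    then obtain \<alpha> \<beta> where "x \<in> Hc \<alpha>" "y \<in> Hc \<beta>" "deg \<alpha> < Suc m" "deg \<beta> < Suc n" by blast
    then show "x * y \<in> Hlt (Suc (m + n))"
      using graded_mult[of x \<alpha> y \<beta>] component_subset_Hlt[of "\<alpha> + \<beta>" "Suc (m + n)"] by (auto simp: deg_add)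
  qed
qed

lemma finite_subset_Hlt: "finite F \<Longrightarrow> \<exists>d. F \<subseteq> Hlt (Suc d)"
proof (induction F rule: finite_induct)
  case (insert x F)
  then obtain d where d: "F \<subseteq> Hlt (Suc d)" by blast
  obtain n where n: "x \<in> Hlt n" using ex_Hlt by blast
  have "insert x F \<subseteq> Hlt (Suc (d + n))"
    using n d Hlt_mono[of n "Suc (d + n)"] Hlt_mono[of "Suc d" "Suc (d + n)"] by auto
  then show ?case by blast
qed auto

section \<open>Upper bounds by the Hilbert function\<close>

definition growth_le :: "'h set \<Rightarrow> nat \<Rightarrow> bool" where
  "growth_le K r \<longleftrightarrow> (\<forall>n. \<exists>T. finite T \<and> card T \<le> (n + 1) ^ r \<and> K \<inter> Hlt (Suc n) \<subseteq> span T)"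

text \<open>A finite set sits in degrees at most some \<open>d\<close>, so its words of length
  \<open>n\<close> sit in degrees at most \<open>d * n\<close>, where the Hilbert function bounds
  their span with an exponent independent of the set.\<close>

lemma growth_le_imp_gk_dim_le:
  assumes K: "subalgebra s K" and le: "growth_le K r"
  shows "gk_dim s K \<le> ereal (real r)"
proof (rule gk_dim_leI)
  fix F assume F: "finite F" "F \<subseteq> K"
  obtain d where d: "F \<subseteq> Hlt (Suc d)" using finite_subset_Hlt[OF F(1)] by blast
  have words_Hlt: "words F n \<subseteq> Hlt (Suc (d * n))" for n
  proof -
    have "prod_list ws \<in> Hlt (Suc (d * length ws))" if "set ws \<subseteq> F" for ws
      using that
    proof (induction ws)
      case Nil
      then show ?case using Hlt_1 by (simp add: span_base)
    next
      case (Cons w ws)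
      then show ?case using Hlt_mult[of w d "prod_list ws" "d * length ws"] d by auto
    qed
    moreover have "Hlt (Suc (d * m)) \<subseteq> Hlt (Suc (d * n))" if "m \<le> n" for m
      using that by (intro Hlt_mono) simp
    ultimately show ?thesis by (fastforce simp: words_def)
  qed
  have "growth s (span F) n \<le> (d * n + 1) ^ r" for n
  proof -
    obtain T where T: "finite T" "card T \<le> (d * n + 1) ^ r" "K \<inter> Hlt (Suc (d * n)) \<subseteq> span T"
      using le unfolding growth_le_def by blast
    have "words F n \<subseteq> span T"
      using T(3) words_Hlt[of n] words_subalgebra[OF K F(2), of n] by blast
    then have "dim (words F n) \<le> card T" by (rule dim_le_card[OF _ T(1)])
    then show ?thesis using T(2) growth_eq by simp
  qed
  then show "\<exists>d. \<forall>n. growth s (span F) n \<le> (d * n + 1) ^ r" by blast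
qed

section \<open>Primitive elements over a stable subalgebra\<close>

lemma span_1_subset_stable: "stable B \<Longrightarrow> span {1} \<subseteq> B"
  by (rule span_minimal) (auto intro: stable_1 stable_subspace)

text \<open>For stable \<open>B\<close> these are the elements of \<open>H\<close> primitive over
  \<open>B\<close>, on whichever sides the operators \<open>U\<close> look at.\<close>

definition preimage :: "'h set \<Rightarrow> 'h set" where
  "preimage B = {x. \<forall>f. U f x \<in> B}"

lemma preimageI: "(\<And>f. U f x \<in> B) \<Longrightarrow> x \<in> preimage B"
  and preimageD: "x \<in> preimage B \<Longrightarrow> U f x \<in> B"
  by (auto simp: preimage_def)

lemma subspace_preimage: "subspace B \<Longrightarrow> subspace (preimage B)"
  by (auto simp: subspace_def preimage_def U_add U_scale U_0)

lemma stable_subset_preimage: "stable B \<Longrightarrow> B \<subseteq> preimage B"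
  by (auto simp: preimage_def stable_U)

text \<open>Greedy choice: each new member is taken from the lowest possible level of the filtration.\<close>

lemma ex_adapted:
  assumes B: "stable B" and A: "subspace A" "B \<subseteq> A"
    and inf: "\<And>X. finite X \<Longrightarrow> \<not> A \<inter> preimage B \<subseteq> span (B \<union> X)"
  shows "\<exists>x wt. adapted B r x wt \<and> (\<forall>i<r. x i \<in> A)"
proof (induction r)
  case 0
  show ?case by (auto simp: adapted_def)
next
  case (Suc r)
  then obtain x wt where ad: "adapted B r x wt" and xA: "\<And>i. i < r \<Longrightarrow> x i \<in> A" by blast
  let ?P = "A \<inter> preimage B" and ?W = "span (B \<union> x ` {..<r})"
  have P: "subspace ?P" by (intro subspace_inter A subspace_preimage stable_subspace[OF B])
  have xP: "x i \<in> ?P" if "i < r" for i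
    using ad xA that by (auto simp: adapted_def preimage_def)
  obtain z where z: "z \<in> ?P" "z \<notin> ?W" using inf[of "x ` {..<r}"] by auto
  define n where "n = (LEAST n. \<exists>y. y \<in> ?P \<and> y \<notin> ?W \<and> y \<in> lv (int n))"
  have "\<exists>n y. y \<in> ?P \<and> y \<notin> ?W \<and> y \<in> lv (int n)" using z ex_lv by blast
  then have "\<exists>y. y \<in> ?P \<and> y \<notin> ?W \<and> y \<in> lv (int n)" unfolding n_def by (rule LeastI_ex)
  then obtain y where y: "y \<in> ?P" "y \<notin> ?W" "y \<in> lv (int n)" by blast
  have least: "v \<in> ?W" if "v \<in> ?P" "v \<in> lv (int n - 1)" "1 \<le> n" for v
  proof (rule ccontr)
    assume "v \<notin> ?W"
    moreover have "v \<in> lv (int (n - 1))" using that by (simp add: of_nat_diff)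
    ultimately have "n \<le> n - 1" unfolding n_def using that(1) by (intro Least_le) blast
    then show False using that by simp
  qed
  have BW: "B \<subseteq> ?W" using span_superset by blast
  have n1: "1 \<le> n"
  proof (rule ccontr)
    assume "\<not> 1 \<le> n"
    then have "int n = 0" by simp
    then have "y \<in> span {1}" using y(3) lv_0 by metis
    then show False using y(2) BW span_1_subset_stable[OF B] by blast
  qed
  let ?x = "x(r := y)" and ?wt = "wt(r := int n)"
  have "c i = 0" if b: "b \<in> B" and rel: "b + (\<Sum>i | i < Suc r \<and> ?wt i = N. s (c i) (?x i)) \<in> lv (N - 1)"
    and i: "i < Suc r" "?wt i = N" for N c b i
  proof -
    let ?J = "{i. i < r \<and> wt i = N}"
    let ?S = "\<Sum>i\<in>?J. s (c i) (x i)"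
    have J: "{i. i < Suc r \<and> ?wt i = N} = (if int n = N then insert r ?J else ?J)"
      by (auto simp: less_Suc_eq)
    have old: "(\<Sum>i\<in>?J. s (c i) (?x i)) = ?S" by (rule sum.cong) auto
    have sum: "(\<Sum>i | i < Suc r \<and> ?wt i = N. s (c i) (?x i)) = (if int n = N then s (c r) y else 0) + ?S"
      unfolding J using old by (auto simp del: fun_upd_apply simp: fun_upd_same)
    \<comment> \<open>A relation involving the new \<open>y\<close> would be a primitive element
      \<open>?v\<close> of \<open>A\<close> at level \<open>n - 1\<close>. By minimality of
      \<open>n\<close> it lies in \<open>?W\<close>, and then so does \<open>y\<close>.\<close>
    have cr: "c r = 0" if N: "int n = N"
    proof (rule ccontr)
      assume c: "c r \<noteq> 0"
      let ?v = "b + (s (c r) y + ?S)"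
      have S: "?S \<in> ?P" by (intro subspace_sum[OF P] subspace_scale[OF P] xP) auto
      have "b \<in> ?P" using b A stable_subset_preimage[OF B] by blast
      then have "?v \<in> ?P" by (intro subspace_add[OF P] subspace_scale[OF P] y(1) S)
      moreover have "?v \<in> lv (int n - 1)" using rel N unfolding sum by simp
      ultimately have v: "?v \<in> ?W" using least n1 by blast
      have "?S \<in> ?W" by (intro span_sum span_scale span_base) auto
      moreover have "b \<in> ?W" using b BW by blast
      ultimately have "?v - b - ?S \<in> ?W" using v by (intro span_diff)
      then have "s (c r) y \<in> ?W" by (simp add: algebra_simps)
      then have "s (inverse (c r)) (s (c r) y) \<in> ?W" by (rule span_scale)
      then show False using y(2) c by simp
    qed
    then have "b + ?S \<in> lv (N - 1)" using rel unfolding sum by (cases "int n = N") auto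
    then have "\<forall>i<r. wt i = N \<longrightarrow> c i = 0" using ad b unfolding adapted_def by blast
    then show "c i = 0" using i cr by (cases "i = r") auto
  qed
  then have "adapted B (Suc r) ?x ?wt"
    using ad y n1 unfolding adapted_def by (auto simp: less_Suc_eq preimageD)
  moreover have "\<forall>i<Suc r. ?x i \<in> A" using xA y by (auto simp: less_Suc_eq)
  ultimately show ?case by blast
qed

lemma ex_finite_generators:
  assumes B: "stable B" and A: "subspace A" "B \<subseteq> A" and gk: "gk_dim s A = ereal m"
  shows "\<exists>X. finite X \<and> A \<inter> preimage B \<subseteq> span (B \<union> X)"
proof (rule ccontr)
  assume "\<not> ?thesis"
  then have inf: "\<And>X. finite X \<Longrightarrow> \<not> A \<inter> preimage B \<subseteq> span (B \<union> X)" by blast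
  have "real r \<le> m" for r
  proof -
    obtain x wt where "adapted B r x wt" "\<forall>i<r. x i \<in> A" using ex_adapted[OF B A inf] by blast
    then have "growth_ge A r" using adapted_growth_ge[OF B] by blast
    then show ?thesis using growth_ge_imp_gk_dim_ge gk by fastforce
  qed
  then have "real (nat \<lceil>m\<rceil> + 1) \<le> m" .
  then show False by linarith
qed

end

section \<open>Ore extensions of derivation type\<close>

lemma poly_mapping_of_bounded:
  fixes c :: "nat \<Rightarrow> 'a::zero"
  shows "\<exists>f :: nat \<Rightarrow>\<^sub>0 'a. \<forall>i. Poly_Mapping.lookup f i = (if i < n then c i else 0)"
proof -
  have "finite {i. (if i < n then c i else 0) \<noteq> 0}"
    by (rule finite_subset[of _ "{..<n}"]) auto
  then have "Poly_Mapping.lookup (Abs_poly_mapping (\<lambda>i. if i < n then c i else 0))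
      = (\<lambda>i. if i < n then c i else 0)"
    by (rule lookup_Abs_poly_mapping)
  then show ?thesis by (intro exI[of _ "Abs_poly_mapping (\<lambda>i. if i < n then c i else 0)"]) simp
qed

lemma sum_keys_mult_power:
  fixes f :: "nat \<Rightarrow>\<^sub>0 'a::ring_1"
  shows "Poly_Mapping.keys f \<subseteq> {..<n} \<Longrightarrow>
    (\<Sum>i\<in>Poly_Mapping.keys f. Poly_Mapping.lookup f i * x ^ i) = (\<Sum>i<n. Poly_Mapping.lookup f i * x ^ i)"
  by (rule sum.mono_neutral_left) (auto simp: in_keys_iff)

lemma keys_subset_lessThan: "\<exists>n. Poly_Mapping.keys (f :: nat \<Rightarrow>\<^sub>0 'a::zero) \<subseteq> {..<n}"
  using finite_nat_bounded[OF finite_keys] .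

context unital_algebra
begin

definition left_polys :: "'h set \<Rightarrow> 'h \<Rightarrow> nat \<Rightarrow> 'h set" where
  "left_polys B y n = {\<Sum>j<n. c j * y ^ j | c. \<forall>j. c j \<in> B}"

lemma left_polysE:
  assumes "v \<in> left_polys B y n"
  obtains c where "v = (\<Sum>j<n. c j * y ^ j)" "\<And>j. c j \<in> B"
proof -
  have "\<exists>c. v = (\<Sum>j<n. c j * y ^ j) \<and> (\<forall>j. c j \<in> B)" using assms by (simp add: left_polys_def)
  then show ?thesis using that by auto
qed

lemma subspace_left_polys: "subspace B \<Longrightarrow> subspace (left_polys B y n)"
  unfolding subspace_def
proof (intro conjI ballI allI)
  assume B: "0 \<in> B \<and> (\<forall>x\<in>B. \<forall>y\<in>B. x + y \<in> B) \<and> (\<forall>c. \<forall>x\<in>B. s c x \<in> B)"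
  show "0 \<in> left_polys B y n" unfolding left_polys_def
    using B by (intro CollectI exI[of _ "\<lambda>_. 0"]) simp
  show "u + v \<in> left_polys B y n" if uv: "u \<in> left_polys B y n" "v \<in> left_polys B y n" for u v
  proof -
    obtain c d where "u = (\<Sum>j<n. c j * y ^ j)" "v = (\<Sum>j<n. d j * y ^ j)" "\<And>j. c j \<in> B" "\<And>j. d j \<in> B"
      using uv by (auto simp: left_polys_def)
    then show ?thesis unfolding left_polys_def using B
      by (intro CollectI exI[of _ "\<lambda>j. c j + d j"]) (simp add: distrib_right sum.distrib)
  qed
  show "s k u \<in> left_polys B y n" if u: "u \<in> left_polys B y n" for k u
  proof -
    obtain c where "u = (\<Sum>j<n. c j * y ^ j)" "\<And>j. c j \<in> B"
      using u by (auto simp: left_polys_def)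
    then show ?thesis unfolding left_polys_def using B
      by (intro CollectI exI[of _ "\<lambda>j. s k (c j)"]) (simp add: scale_sum_right scale_mult_left)
  qed
qed

lemma left_polys_monom:
  assumes "subspace B" "b \<in> B" "j < n"
  shows "b * y ^ j \<in> left_polys B y n"
proof -
  let ?c = "\<lambda>i. if i = j then b else 0"
  have "(\<Sum>i<n. ?c i * y ^ i) = (\<Sum>i<n. if i = j then b * y ^ j else 0)"
    by (rule sum.cong) auto
  also have "\<dots> = b * y ^ j" using assms(3) by simp
  finally have "b * y ^ j = (\<Sum>i<n. ?c i * y ^ i)" ..
  moreover have "\<forall>i. ?c i \<in> B" using assms subspace_0 by simp
  ultimately show ?thesis unfolding left_polys_def by (intro CollectI exI[of _ ?c]) blast
qed

lemma left_polys_mono: "subspace B \<Longrightarrow> m \<le> n \<Longrightarrow> left_polys B y m \<subseteq> left_polys B y n"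
proof
  fix v assume *: "subspace B" "m \<le> n" "v \<in> left_polys B y m"
  then obtain c where v: "v = (\<Sum>j<m. c j * y ^ j)" "\<And>j. c j \<in> B" by (auto simp: left_polys_def)
  show "v \<in> left_polys B y n" unfolding v(1)
    by (rule subspace_sum[OF subspace_left_polys[OF *(1)]]) (use * v in \<open>auto intro: left_polys_monom\<close>)
qed

text \<open>Moving \<open>z\<close> past a coefficient costs a commutator in \<open>B\<close>, and
  replacing \<open>z\<close> by \<open>y\<close> costs \<open>z - y\<close> in \<open>B\<close>, so
  the degree in \<open>y\<close> rises by just one. Used for \<open>z = y\<close> and for translates
  of \<open>y\<close> by \<open>B\<close>.\<close>

lemma left_polys_mult_left:
  assumes B: "subalgebra s B" and comm: "\<And>b. b \<in> B \<Longrightarrow> z * b - b * z \<in> B" and zy: "z - y \<in> B"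
    and v: "v \<in> left_polys B y n"
  shows "z * v \<in> left_polys B y (Suc n)"
proof -
  have sB: "subspace B" and mB: "\<And>a b. a \<in> B \<Longrightarrow> b \<in> B \<Longrightarrow> a * b \<in> B"
    using B by (auto simp: subalgebra_def)
  obtain c where c: "v = (\<Sum>j<n. c j * y ^ j)" "\<And>j. c j \<in> B" using v by (auto simp: left_polys_def)
  have "z * (c j * y ^ j) \<in> left_polys B y (Suc n)" if "j < n" for j
  proof -
    have "z * (c j * y ^ j) = c j * y ^ Suc j + (c j * (z - y) + (z * c j - c j * z)) * y ^ j"
      by (simp add: algebra_simps)
    also have "\<dots> \<in> left_polys B y (Suc n)"
      using that by (intro subspace_add[OF subspace_left_polys[OF sB]] left_polys_monom[OF sB]
          subspace_add[OF sB] mB c comm zy) auto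
    finally show ?thesis .
  qed
  then show ?thesis unfolding c(1) sum_distrib_left
    by (intro subspace_sum[OF subspace_left_polys[OF sB]]) simp
qed

definition free_powers :: "'h set \<Rightarrow> 'h \<Rightarrow> bool" where
  "free_powers B y \<longleftrightarrow> (\<forall>n c. (\<forall>j. c j \<in> B) \<longrightarrow> (\<Sum>j<n. c j * y ^ j) = 0 \<longrightarrow> (\<forall>j<n. c j = 0))"

lemma free_powersD:
  "free_powers B y \<Longrightarrow> (\<And>j. c j \<in> B) \<Longrightarrow> (\<Sum>j<n. c j * y ^ j) = 0 \<Longrightarrow> j < n \<Longrightarrow> c j = 0"
  unfolding free_powers_def by blast

text \<open>Each \<open>z ^ i\<close> is \<open>y ^ i\<close> plus lower powers of \<open>y\<close>
  with coefficients in \<open>B\<close>, a unitriangular change of family. Freeness is proved for a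
  translate low in the filtration, which need not be homogeneous, whereas the Ore variable must
  be.\<close>

lemma free_powers_translate:
  assumes B: "subalgebra s B" and comm: "\<And>b. b \<in> B \<Longrightarrow> z * b - b * z \<in> B" and zy: "z - y \<in> B"
    and free: "free_powers B y"
  shows "free_powers B z"
proof -
  have sB: "subspace B" and 1: "1 \<in> B" and mB: "\<And>a b. a \<in> B \<Longrightarrow> b \<in> B \<Longrightarrow> a * b \<in> B"
    using B by (auto simp: subalgebra_def)
  have Bmult: "b * v \<in> left_polys B y n" if b: "b \<in> B" and v: "v \<in> left_polys B y n" for b v n
  proof -
    obtain c where "v = (\<Sum>j<n. c j * y ^ j)" "\<And>j. c j \<in> B" using v by (rule left_polysE) blast
    then show ?thesis unfolding left_polys_def using b mB
      by (intro CollectI exI[of _ "\<lambda>j. b * c j"]) (simp add: sum_distrib_left mult.assoc)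
  qed
  have pow: "z ^ i - y ^ i \<in> left_polys B y i" for i
  proof (induction i)
    case 0
    then show ?case by (simp add: subspace_0[OF subspace_left_polys[OF sB]])
  next
    case (Suc i)
    have "z ^ Suc i - y ^ Suc i = z * (z ^ i - y ^ i) + (z - y) * y ^ i"
      by (simp add: algebra_simps)
    also have "\<dots> \<in> left_polys B y (Suc i)"
      by (intro subspace_add[OF subspace_left_polys[OF sB]] left_polys_mult_left[OF B comm zy Suc]
          left_polys_monom[OF sB zy]) auto
    finally show ?case .
  qed
  show ?thesis unfolding free_powers_def
  proof (intro allI impI)
    fix n c j
    assume "\<forall>j. c j \<in> B" "(\<Sum>j<n. c j * z ^ j) = 0" "j < n"
    then show "c j = 0"
    proof (induction n arbitrary: j)
      case (Suc n)
      have cB: "c j \<in> B" for j using Suc.prems by blast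
      have "(\<Sum>j<n. c j * z ^ j) \<in> left_polys B y n"
      proof (rule subspace_sum[OF subspace_left_polys[OF sB]])
        fix i assume i: "i \<in> {..<n}"
        have "c i * (z ^ i - y ^ i) + c i * y ^ i \<in> left_polys B y n"
          using Bmult[OF cB pow[of i], of i] left_polys_mono[OF sB, of i n] i
          by (intro subspace_add[OF subspace_left_polys[OF sB]] left_polys_monom[OF sB cB]) auto
        then show "c i * z ^ i \<in> left_polys B y n" by (simp add: algebra_simps)
      qed
      moreover have "c n * (z ^ n - y ^ n) \<in> left_polys B y n" by (rule Bmult[OF cB pow])
      ultimately have "(\<Sum>j<n. c j * z ^ j) + c n * (z ^ n - y ^ n) \<in> left_polys B y n"
        by (rule subspace_add[OF subspace_left_polys[OF sB]])
      then obtain d where d: "(\<Sum>j<n. c j * z ^ j) + c n * (z ^ n - y ^ n) = (\<Sum>j<n. d j * y ^ j)"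
        "\<And>j. d j \<in> B"
        by (rule left_polysE) blast
      let ?e = "d(n := c n)"
      have "(\<Sum>j<n. ?e j * y ^ j) = (\<Sum>j<n. d j * y ^ j)" by (rule sum.cong) auto
      then have "(\<Sum>j<Suc n. ?e j * y ^ j) = (\<Sum>j<n. d j * y ^ j) + c n * y ^ n" by simp
      also have "\<dots> = (\<Sum>j<Suc n. c j * z ^ j)"
        unfolding d(1)[symmetric] by (simp add: algebra_simps)
      finally have "(\<Sum>j<Suc n. ?e j * y ^ j) = 0" using Suc.prems by simp
      then have "?e n = 0"
        by (rule free_powersD[OF free, rotated]) (use d cB in simp_all)
      then have cn: "c n = 0" by simp
      then have "(\<Sum>j<n. c j * z ^ j) = 0" using Suc.prems(2) by simp
      then have "c j = 0" if "j < n" using Suc.IH[OF Suc.prems(1) _ that] by blast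
      then show ?case using Suc.prems(3) cn less_Suc_eq by blast
    qed simp
  qed
qed

definition adjoin :: "'h set \<Rightarrow> 'h \<Rightarrow> 'h set" where
  "adjoin B x = (\<Union>n. left_polys B x n)"

lemma adjoinE:
  assumes "v \<in> adjoin B x"
  obtains n c where "v = (\<Sum>j<n. c j * x ^ j)" "\<And>j. c j \<in> B"
proof -
  obtain n where "v \<in> left_polys B x n" using assms unfolding adjoin_def by blast
  then obtain c where "v = (\<Sum>j<n. c j * x ^ j)" "\<And>j. c j \<in> B" by (rule left_polysE) blast
  then show ?thesis by (rule that)
qed

lemma subspace_adjoin:
  assumes B: "subspace B"
  shows "subspace (adjoin B x)"
  unfolding subspace_def adjoin_def
proof (intro conjI ballI allI)
  note sub = subspace_left_polys[OF B]
  show "0 \<in> (\<Union>n. left_polys B x n)" using subspace_0[OF sub] by blast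
  fix u assume "u \<in> (\<Union>n. left_polys B x n)"
  then obtain m where u: "u \<in> left_polys B x m" by blast
  show "s k u \<in> (\<Union>n. left_polys B x n)" for k
    using u subspace_scale[OF sub] by blast
  fix v assume "v \<in> (\<Union>n. left_polys B x n)"
  then obtain n where v: "v \<in> left_polys B x n" by blast
  have "u \<in> left_polys B x (m + n)" "v \<in> left_polys B x (m + n)"
    using u v left_polys_mono[OF B, of m "m + n" x] left_polys_mono[OF B, of n "m + n" x] by auto
  then show "u + v \<in> (\<Union>n. left_polys B x n)" using subspace_add[OF sub] by blast
qed

lemma adjoin_monom: "subspace B \<Longrightarrow> b \<in> B \<Longrightarrow> b * x ^ j \<in> adjoin B x"
  unfolding adjoin_def by (rule UN_I[of "Suc j"]) (simp_all add: left_polys_monom)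

lemma subset_adjoin: "subspace B \<Longrightarrow> B \<subseteq> adjoin B x"
proof
  fix b assume "subspace B" "b \<in> B"
  then show "b \<in> adjoin B x" using adjoin_monom[of B b x 0] by simp
qed

lemma in_adjoin: "subalgebra s B \<Longrightarrow> x \<in> adjoin B x"
  using adjoin_monom[of B 1 x 1] by (simp add: subalgebra_def)

lemma adjoin_subset:
  assumes "subspace V" "\<And>b j. b \<in> B \<Longrightarrow> b * x ^ j \<in> V"
  shows "adjoin B x \<subseteq> V"
proof
  fix v assume "v \<in> adjoin B x"
  then obtain n c where c: "v = (\<Sum>j<n. c j * x ^ j)" "\<And>j. c j \<in> B" by (rule adjoinE) blast
  show "v \<in> V" unfolding c(1) by (intro subspace_sum[OF assms(1)] assms(2) c(2))
qed

lemma subalgebra_adjoin: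
  assumes B: "subalgebra s B" and comm: "\<And>b. b \<in> B \<Longrightarrow> x * b - b * x \<in> B"
  shows "subalgebra s (adjoin B x)"
proof -
  have sB: "subspace B" and 1: "1 \<in> B" and mB: "\<And>a b. a \<in> B \<Longrightarrow> b \<in> B \<Longrightarrow> a * b \<in> B"
    using B by (auto simp: subalgebra_def)
  note sA = subspace_adjoin[OF sB, of x]
  have xmult: "x * v \<in> adjoin B x" if "v \<in> adjoin B x" for v
    using that left_polys_mult_left[OF B comm, where y = x] subspace_0[OF sB] unfolding adjoin_def by fastforce
  then have xpow: "x ^ j * v \<in> adjoin B x" if "v \<in> adjoin B x" for v j
    using that by (induction j) (auto simp: mult.assoc)
  have bmult: "b * v \<in> adjoin B x" if b: "b \<in> B" and v: "v \<in> adjoin B x" for b v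
  proof -
    obtain n c where c: "v = (\<Sum>j<n. c j * x ^ j)" "\<And>j. c j \<in> B" using v by (rule adjoinE) blast
    show ?thesis unfolding c(1) sum_distrib_left mult.assoc[symmetric]
      by (intro subspace_sum[OF sA] adjoin_monom[OF sB] mB b c(2))
  qed
  have "u * v \<in> adjoin B x" if u: "u \<in> adjoin B x" and v: "v \<in> adjoin B x" for u v
  proof -
    obtain n c where c: "u = (\<Sum>j<n. c j * x ^ j)" "\<And>j. c j \<in> B" using u by (rule adjoinE) blast
    show ?thesis unfolding c(1) sum_distrib_right mult.assoc
      by (intro subspace_sum[OF sA] bmult xpow v c(2))
  qed
  then show ?thesis using 1 sA subset_adjoin[OF sB] by (auto simp: subalgebra_def)
qed

lemma adjoin_subset_subalgebra:
  assumes A: "subalgebra s A" and "B \<subseteq> A" "x \<in> A"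
  shows "adjoin B x \<subseteq> A"
proof (rule adjoin_subset)
  show "subspace A" using A by (simp add: subalgebra_def)
  have "x ^ j \<in> A" for j using assms by (induction j) (auto simp: subalgebra_def)
  then show "b * x ^ j \<in> A" if "b \<in> B" for b j using that assms by (auto simp: subalgebra_def)
qed

lemma ex1_expansion:
  assumes sB: "subspace B" and free: "free_powers B x" and t: "t \<in> adjoin B x"
  shows "\<exists>!f :: nat \<Rightarrow>\<^sub>0 'h. (\<forall>i. Poly_Mapping.lookup f i \<in> B) \<and>
    t = (\<Sum>i\<in>Poly_Mapping.keys f. Poly_Mapping.lookup f i * x ^ i)"
proof (rule ex_ex1I)
  obtain n c where c: "t = (\<Sum>j<n. c j * x ^ j)" "\<And>j. c j \<in> B" using t by (rule adjoinE) blast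
  obtain f :: "nat \<Rightarrow>\<^sub>0 'h" where f: "\<And>i. Poly_Mapping.lookup f i = (if i < n then c i else 0)"
    using poly_mapping_of_bounded[of n c] by blast
  have "Poly_Mapping.keys f \<subseteq> {..<n}" by (auto simp: in_keys_iff f split: if_splits)
  then have "(\<Sum>i\<in>Poly_Mapping.keys f. Poly_Mapping.lookup f i * x ^ i) = (\<Sum>i<n. Poly_Mapping.lookup f i * x ^ i)"
    by (rule sum_keys_mult_power)
  also have "\<dots> = t" unfolding c(1) by (rule sum.cong) (simp_all add: f)
  finally have "t = (\<Sum>i\<in>Poly_Mapping.keys f. Poly_Mapping.lookup f i * x ^ i)" ..
  moreover have "\<forall>i. Poly_Mapping.lookup f i \<in> B" using c(2) subspace_0[OF sB] by (simp add: f)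
  ultimately show "\<exists>f :: nat \<Rightarrow>\<^sub>0 'h. (\<forall>i. Poly_Mapping.lookup f i \<in> B) \<and>
      t = (\<Sum>i\<in>Poly_Mapping.keys f. Poly_Mapping.lookup f i * x ^ i)" by blast
next
  fix f g :: "nat \<Rightarrow>\<^sub>0 'h"
  assume f: "(\<forall>i. Poly_Mapping.lookup f i \<in> B) \<and> t = (\<Sum>i\<in>Poly_Mapping.keys f. Poly_Mapping.lookup f i * x ^ i)"
    and g: "(\<forall>i. Poly_Mapping.lookup g i \<in> B) \<and> t = (\<Sum>i\<in>Poly_Mapping.keys g. Poly_Mapping.lookup g i * x ^ i)"
  obtain m where m: "Poly_Mapping.keys f \<subseteq> {..<m}" using keys_subset_lessThan by blast
  obtain n where n: "Poly_Mapping.keys g \<subseteq> {..<n}" using keys_subset_lessThan by blast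
  let ?N = "m + n"
  have fN: "Poly_Mapping.keys f \<subseteq> {..<?N}" and gN: "Poly_Mapping.keys g \<subseteq> {..<?N}" using m n by force+
  have "(\<Sum>i<?N. Poly_Mapping.lookup f i * x ^ i) = (\<Sum>i<?N. Poly_Mapping.lookup g i * x ^ i)"
    using f g sum_keys_mult_power[OF fN, of x] sum_keys_mult_power[OF gN, of x] by simp
  then have "(\<Sum>i<?N. (Poly_Mapping.lookup f i - Poly_Mapping.lookup g i) * x ^ i) = 0"
    by (simp add: left_diff_distrib sum_subtractf)
  then have *: "Poly_Mapping.lookup f i - Poly_Mapping.lookup g i = 0" if "i < ?N" for i
    by (rule free_powersD[OF free, rotated]) (use f g subspace_diff[OF sB] that in auto)
  show "f = g"
  proof (rule poly_mapping_eqI)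
    fix i show "Poly_Mapping.lookup f i = Poly_Mapping.lookup g i"
    proof (cases "i < ?N")
      case True
      then show ?thesis using *[of i] by simp
    next
      case False
      then have "i \<notin> Poly_Mapping.keys f" "i \<notin> Poly_Mapping.keys g" using fN gN by auto
      then show ?thesis by (simp add: in_keys_iff)
    qed
  qed
qed

text \<open>By freeness the products \<open>a * x ^ i\<close>, with \<open>a\<close> from the given
  independent set and \<open>i \<le> n\<close>, are independent: the count gains a factor
  \<open>n + 1\<close>, the word length only a summand \<open>n\<close>.\<close>

lemma growth_ge_adjoin:
  assumes B: "subalgebra s B" and free: "free_powers B x" and ge: "growth_ge B r"
  shows "growth_ge (adjoin B x) (Suc r)"
proof -
  have sB: "subspace B" using B by (simp add: subalgebra_def)
  obtain F c where F: "finite F" "F \<subseteq> B" and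
    S: "\<And>n. \<exists>S. finite S \<and> independent S \<and> (n + 1) ^ r \<le> card S \<and> S \<subseteq> span (words F (c * n))"
    using ge unfolding growth_ge_def by blast
  have "\<exists>S. finite S \<and> independent S \<and> (n + 1) ^ Suc r \<le> card S \<and> S \<subseteq> span (words (insert x F) ((c + 1) * n))"
    for n
  proof -
    obtain S where S: "finite S" "independent S" "(n + 1) ^ r \<le> card S" "S \<subseteq> span (words F (c * n))"
      using S by blast
    have SB: "S \<subseteq> B"
      using S(4) span_minimal[OF words_subalgebra[OF B F(2)] sB] by blast
    let ?I = "S \<times> {..n}" and ?v = "\<lambda>(a, i). a * x ^ i"
    have "k p = 0" if k: "(\<Sum>p\<in>?I. s (k p) (?v p)) = 0" and p: "p \<in> ?I" for k p
    proof -
      have "(\<Sum>p\<in>?I. s (k p) (?v p)) = (\<Sum>a\<in>S. \<Sum>i\<in>{..n}. s (k (a, i)) (a * x ^ i))"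
        by (simp add: sum.cartesian_product case_prod_beta')
      also have "\<dots> = (\<Sum>i\<in>{..n}. \<Sum>a\<in>S. s (k (a, i)) (a * x ^ i))" by (rule sum.swap)
      also have "\<dots> = (\<Sum>i<Suc n. (\<Sum>a\<in>S. s (k (a, i)) a) * x ^ i)"
        by (simp add: sum_distrib_right scale_mult_left lessThan_Suc_atMost del: sum.lessThan_Suc)
      finally have "(\<Sum>i<Suc n. (\<Sum>a\<in>S. s (k (a, i)) a) * x ^ i) = 0" using k by simp
      then have z: "(\<Sum>a\<in>S. s (k (a, i)) a) = 0" if "i < Suc n" for i
        by (rule free_powersD[OF free, rotated])
          (use SB that in \<open>auto intro!: subspace_sum[OF sB] subspace_scale[OF sB]\<close>)
      obtain a i where ai: "p = (a, i)" "a \<in> S" "i < Suc n" using p by auto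
      then show ?thesis using independentD[OF S(2,1) order_refl, of "\<lambda>a. k (a, i)" a] z by auto
    qed
    then have inj: "inj_on ?v ?I" and ind: "independent (?v ` ?I)"
      using independent_family[of ?I ?v] S(1) by blast+
    have "card (?v ` ?I) = card S * (n + 1)" using card_image[OF inj] by (simp add: card_cartesian_product)
    then have "(n + 1) ^ Suc r \<le> card (?v ` ?I)"
      using mult_le_mono1[OF S(3), of "n + 1"] by (simp add: mult.commute)
    moreover have "?v ` ?I \<subseteq> span (words (insert x F) ((c + 1) * n))"
    proof safe
      fix a i assume a: "a \<in> S" "i \<le> n"
      have "span (words F (c * n)) \<subseteq> span (words (insert x F) (c * n))"
        by (intro span_mono words_mono subset_insertI order_refl)
      then have "a \<in> span (words (insert x F) (c * n))" using a S(4) by blast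
      moreover have "x ^ i \<in> span (words (insert x F) n)"
        using a by (intro span_base power_in_words) auto
      ultimately show "a * x ^ i \<in> span (words (insert x F) ((c + 1) * n))"
        using span_words_mult[of a "insert x F" "c * n" "x ^ i" n] by (simp add: add.commute)
    qed
    ultimately show ?thesis using ind S(1) by (intro exI[of _ "?v ` ?I"] conjI finite_imageI finite_cartesian_product) auto
  qed
  moreover have "insert x F \<subseteq> adjoin B x" using F(2) subset_adjoin[OF sB, of x] in_adjoin[OF B, of x] by blast
  moreover have "finite (insert x F)" using F(1) by simp
  ultimately show ?thesis unfolding growth_ge_def
    by - (rule exI[of _ "insert x F"], rule exI[of _ "c + 1"], simp)
qed

end

context graded_coaction
begin

lemma power_component: "x \<in> Hc \<gamma> \<Longrightarrow> \<exists>\<beta>. x ^ i \<in> Hc \<beta> \<and> deg \<beta> = i * deg \<gamma>"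
proof (induction i)
  case 0
  have "x ^ 0 \<in> Hc 0 \<and> deg 0 = 0 * deg \<gamma>" using graded_one deg_eq_0[of 0] by simp
  then show ?case by blast
next
  case (Suc i)
  then obtain \<beta> where "x ^ i \<in> Hc \<beta>" "deg \<beta> = i * deg \<gamma>" by blast
  then have "x ^ Suc i \<in> Hc (\<gamma> + \<beta>) \<and> deg (\<gamma> + \<beta>) = Suc i * deg \<gamma>"
    using graded_mult[OF Suc.prems] by (simp add: deg_add)
  then show ?case by blast
qed

text \<open>By \<open>U_mult\<close>, the elements of \<open>adjoin B x\<close> that all
  \<open>U f\<close> send into \<open>adjoin B x\<close> are closed under products, and both
  \<open>B\<close> and \<open>x\<close> are among them.\<close>

lemma stable_adjoin:
  assumes B: "stable B" and x: "x \<in> preimage B" and comm: "\<And>b. b \<in> B \<Longrightarrow> x * b - b * x \<in> B"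
  shows "stable (adjoin B x)"
proof -
  have alg: "subalgebra s B" using B by (simp add: stable_def)
  note sB = stable_subspace[OF B]
  let ?K = "adjoin B x"
  have K: "subalgebra s ?K" by (rule subalgebra_adjoin[OF alg comm])
  have sK: "subspace ?K" and mK: "\<And>a b. a \<in> ?K \<Longrightarrow> b \<in> ?K \<Longrightarrow> a * b \<in> ?K" and 1: "1 \<in> ?K"
    using K by (auto simp: subalgebra_def)
  have mult: "u * v \<in> preimage ?K" if u: "u \<in> ?K" "u \<in> preimage ?K" and v: "v \<in> ?K" "v \<in> preimage ?K" for u v
  proof (rule preimageI)
    fix f
    have "U f (u * v) - u * U f v - U f u * v \<in> span {a * b | a b. a \<in> ?K \<and> b \<in> ?K}"
      by (rule U_mult[OF sK sK]) (use u v in \<open>auto dest: preimageD\<close>)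
    also have "span {a * b | a b. a \<in> ?K \<and> b \<in> ?K} \<subseteq> ?K"
      by (rule span_minimal[OF _ sK]) (use mK in auto)
    finally have "U f (u * v) - u * U f v - U f u * v \<in> ?K" .
    then have "(U f (u * v) - u * U f v - U f u * v) + u * U f v + U f u * v \<in> ?K"
      by (intro subspace_add[OF sK] mK u v preimageD[of _ ?K])
    then show "U f (u * v) \<in> ?K" by simp
  qed
  note BK = subset_adjoin[OF sB, of x]
  have xp: "x \<in> preimage ?K" and bp: "b \<in> preimage ?K" if "b \<in> B" for b
    using x BK that stable_U[OF B] by (auto simp: preimage_def)
  have x': "x \<in> preimage ?K" using x BK by (auto simp: preimage_def)
  have pow: "x ^ j \<in> ?K \<and> x ^ j \<in> preimage ?K" for j
  proof (induction j)
    case 0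
    then show ?case using 1 subspace_0[OF sK] by (auto simp: preimage_def U_one)
  next
    case (Suc j)
    then show ?case using mult[of x "x ^ j"] mK[of x "x ^ j"] in_adjoin[OF alg, of x] x' by auto
  qed
  have "?K \<subseteq> preimage ?K"
    by (rule adjoin_subset[OF subspace_preimage[OF sK]]) (use mult pow bp BK in blast)
  then show ?thesis using K by (auto simp: stable_def preimage_def)
qed

lemma homogeneous_adjoin:
  assumes B: "homogeneous s Hc B" and x: "x \<in> Hc \<gamma>"
  shows "homogeneous s Hc (adjoin B x)"
proof (rule homogeneousI)
  note sB = homogeneous_subspace[OF B]
  show "subspace (adjoin B x)" by (rule subspace_adjoin[OF sB])
  show "adjoin B x \<subseteq> span (\<Union>\<gamma>. adjoin B x \<inter> Hc \<gamma>)" (is "_ \<subseteq> ?S")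
  proof (rule adjoin_subset[OF subspace_span])
    fix b j assume b: "b \<in> B"
    have "B \<subseteq> {b. b * x ^ j \<in> ?S}"
    proof (rule homogeneous_component_subset[OF B subspace_mult_right_vimage[OF subspace_span]])
      fix \<alpha> b assume "b \<in> B" "b \<in> Hc \<alpha>"
      moreover obtain \<beta> where "x ^ j \<in> Hc \<beta>" using power_component[OF x] by blast
      ultimately have "b * x ^ j \<in> adjoin B x" "b * x ^ j \<in> Hc (\<alpha> + \<beta>)"
        by (auto intro: adjoin_monom[OF sB] graded_mult)
      then have "b * x ^ j \<in> (\<Union>\<gamma>. adjoin B x \<inter> Hc \<gamma>)" by blast
      then show "b \<in> {b. b * x ^ j \<in> ?S}" by (simp add: span_base)
    qed
    then show "b * x ^ j \<in> ?S" using b by blast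
  qed
qed

text \<open>As \<open>1 \<le> deg \<gamma>\<close>, a homogeneous monomial \<open>b * x ^ i\<close>
  of degree at most \<open>n\<close> has \<open>i \<le> n\<close> and \<open>b\<close> of degree at
  most \<open>n\<close>. Projecting to components is what permits arguing monomial by
  monomial.\<close>

lemma growth_le_adjoin:
  assumes B: "homogeneous s Hc B" and x: "x \<in> Hc \<gamma>" and d: "1 \<le> deg \<gamma>" and le: "growth_le B r"
  shows "growth_le (adjoin B x) (Suc r)"
  unfolding growth_le_def
proof
  fix n
  obtain T where T: "finite T" "card T \<le> (n + 1) ^ r" "B \<inter> Hlt (Suc n) \<subseteq> span T"
    using le unfolding growth_le_def by blast
  let ?T = "(\<lambda>(t, i). t * x ^ i) ` (T \<times> {..n})"
  have "card ?T \<le> card (T \<times> {..n})" by (rule card_image_le) (use T in simp)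
  also have "\<dots> \<le> (n + 1) ^ Suc r" using mult_le_mono1[OF T(2), of "n + 1"] by (simp add: card_cartesian_product mult.commute)
  finally have card: "card ?T \<le> (n + 1) ^ Suc r" .
  have proj: "adjoin B x \<subseteq> {y. proj \<delta> y \<in> span ?T}" if \<delta>: "deg \<delta> \<le> n" for \<delta>
  proof (rule adjoin_subset[OF subspace_proj_vimage[OF subspace_span]])
    fix b i assume b: "b \<in> B"
    obtain \<beta> where \<beta>: "x ^ i \<in> Hc \<beta>" "deg \<beta> = i * deg \<gamma>" using power_component[OF x] by blast
    have "B \<subseteq> {b. b * x ^ i \<in> {y. proj \<delta> y \<in> span ?T}}"
    proof (rule homogeneous_component_subset[OF B])
      show "subspace {b. b * x ^ i \<in> {y. proj \<delta> y \<in> span ?T}}"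
        by (intro subspace_mult_right_vimage subspace_proj_vimage subspace_span)
      fix \<alpha> b assume b: "b \<in> B" "b \<in> Hc \<alpha>"
      have bx: "b * x ^ i \<in> Hc (\<alpha> + \<beta>)" using graded_mult b \<beta> by blast
      have "b * x ^ i \<in> span ?T" if "\<delta> = \<alpha> + \<beta>"
      proof -
        have *: "deg \<alpha> + i * deg \<gamma> \<le> n" using \<delta> that \<beta> by (simp add: deg_add)
        have "i * 1 \<le> i * deg \<gamma>" using d by (rule mult_le_mono2)
        then have "i \<le> i * deg \<gamma>" by (simp only: mult_1_right)
        then have i: "i \<le> n" using * by linarith
        have "deg \<alpha> < Suc n" using * by simp
        then have "b \<in> span T" using b component_subset_Hlt[of \<alpha> "Suc n"] T(3) by blast
        moreover have "span T \<subseteq> {a. a * x ^ i \<in> span ?T}"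
          by (rule span_minimal[OF _ subspace_mult_right_vimage[OF subspace_span]])
            (use i in \<open>auto intro!: span_base\<close>)
        ultimately show ?thesis by blast
      qed
      then show "b \<in> {b. b * x ^ i \<in> {y. proj \<delta> y \<in> span ?T}}"
        by (simp add: proj_component[OF bx] span_zero)
    qed
    then show "b * x ^ i \<in> {y. proj \<delta> y \<in> span ?T}" using b by blast
  qed
  have "adjoin B x \<inter> Hlt (Suc n) \<subseteq> span ?T"
  proof
    fix y assume y: "y \<in> adjoin B x \<inter> Hlt (Suc n)"
    show "y \<in> span ?T"
    proof (rule in_span_of_proj[OF subspace_span])
      fix \<delta> show "proj \<delta> y \<in> span ?T"
        using y proj[of \<delta>] proj_Hlt[of y "Suc n" \<delta>] span_zero by (cases "deg \<delta> \<le> n") auto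
    qed
  qed
  then show "\<exists>T. finite T \<and> card T \<le> (n + 1) ^ Suc r \<and> adjoin B x \<inter> Hlt (Suc n) \<subseteq> span T"
    using card T(1) by (intro exI[of _ ?T] conjI finite_imageI finite_cartesian_product) auto
qed

lemma mon_const: "mon (\<lambda>_. y) M = y ^ size M"
proof -
  have "length (sorted_list_of_multiset M) = size M"
    by (metis mset_sorted_list_of_multiset size_mset)
  then show ?thesis by (simp add: mon_def map_replicate_const)
qed

text \<open>Translating \<open>x\<close> by an element of \<open>B\<close> brings it as low as possible in the filtration, and
  such a translate is an adapted family with one member.\<close>

lemma free_powers_preimage:
  assumes B: "stable B" and x: "x \<in> preimage B" "x \<notin> B"
    and comm: "\<And>b. b \<in> B \<Longrightarrow> x * b - b * x \<in> B"
  shows "free_powers B x"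
proof -
  have alg: "subalgebra s B" using B by (simp add: stable_def)
  note sB = stable_subspace[OF B]
  define n where "n = (LEAST n. \<exists>b\<in>B. x - b \<in> lv (int n))"
  have "\<exists>n. \<exists>b\<in>B. x - b \<in> lv (int n)"
    using ex_lv[of "x - 0"] subspace_0[OF sB] by blast
  then have "\<exists>b\<in>B. x - b \<in> lv (int n)" unfolding n_def by (rule LeastI_ex)
  then obtain b0 where b0: "b0 \<in> B" "x - b0 \<in> lv (int n)" by blast
  define y where "y = x - b0"
  have n: "1 \<le> n"
  proof (rule ccontr)
    assume "\<not> 1 \<le> n"
    then have "int n = 0" by simp
    then have "y \<in> span {1}" using b0(2) lv_0 unfolding y_def by metis
    then have "y + b0 \<in> B" using span_1_subset_stable[OF B] b0(1) by (intro subspace_add[OF sB]) auto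
    then show False using x(2) by (simp add: y_def)
  qed
  have Uy: "U f y \<in> B" for f
    unfolding y_def U_diff
    by (intro subspace_diff[OF sB] stable_U[OF B] b0(1) preimageD[OF x(1)])
  \<comment> \<open>Otherwise \<open>x\<close> minus some element of \<open>B\<close> would lie at
    level \<open>n - 1\<close>, against the choice of \<open>n\<close>. This is the one-member case
    of adaptedness.\<close>
  have least: "c = 0" if b: "b \<in> B" and v: "b + s c y \<in> lv (int n - 1)" for b c
  proof (rule ccontr)
    assume c: "c \<noteq> 0"
    have "s (inverse c) (b + s c y) \<in> lv (int n - 1)" by (rule lv_scale[OF v])
    then have "x - (b0 - s (inverse c) b) \<in> lv (int (n - 1))"
      using c n by (simp add: scale_right_distrib y_def algebra_simps of_nat_diff)
    moreover have "b0 - s (inverse c) b \<in> B"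
      by (intro subspace_diff[OF sB] subspace_scale[OF sB] b b0(1))
    ultimately have "n \<le> n - 1" unfolding n_def by (intro Least_le) blast
    then show False using n by simp
  qed
  have ad: "adapted B 1 (\<lambda>_. y) (\<lambda>_. int n)"
    unfolding adapted_def
  proof (intro conjI allI impI)
    show "1 \<le> int n" "y \<in> lv (int n)" "\<And>f. U f y \<in> B" using n b0 Uy by (auto simp: y_def)
    fix N b and c :: "nat \<Rightarrow> 'k" and i :: nat
    assume b: "b \<in> B" and rel: "b + (\<Sum>i | i < 1 \<and> int n = N. s (c i) y) \<in> lv (N - 1)"
      and i: "i < 1" "int n = N"
    have "{i. i < (1::nat) \<and> int n = N} = {0}" using i by auto
    then have "b + s (c 0) y \<in> lv (int n - 1)" using rel i by simp
    then show "c i = 0" using least[OF b] i by simp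
  qed
  have "free_powers B y" unfolding free_powers_def
  proof (intro allI impI)
    fix k c j assume c: "\<forall>j. c j \<in> B" and sum: "(\<Sum>j<k. c j * y ^ j) = 0" and j: "j < k"
    \<comment> \<open>Powers of \<open>y\<close> are the monomials in one variable, and exponents
      below \<open>k\<close> fit under the cut-off \<open>k\<close>.\<close>
    define b where "b M = (if M \<in> msets_upto 1 k \<and> size M < k then c (size M) else 0)" for M
    let ?\<rho> = "\<lambda>j. replicate_mset j (0::nat)"
    have inj: "inj_on ?\<rho> {..<k}" by (rule inj_onI) (metis size_replicate_mset)
    have \<rho>: "?\<rho> j \<in> msets_upto 1 k" if "j < k" for j using that by (auto simp: msets_upto_def)
    have zero: "b M = 0" if "M \<in> msets_upto 1 k - ?\<rho> ` {..<k}" for M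
    proof -
      have "set_mset M \<subseteq> {0}" using that by (auto simp: msets_upto_def)
      then have "M = ?\<rho> (size M)" by (metis set_mset_subset_singletonD)
      then have "\<not> size M < k" using that by blast
      then show ?thesis by (simp add: b_def)
    qed
    have "(\<Sum>M\<in>msets_upto 1 k. b M * mon (\<lambda>_. y) M) = (\<Sum>M\<in>?\<rho> ` {..<k}. b M * mon (\<lambda>_. y) M)"
      by (rule sum.mono_neutral_right[OF finite_msets_upto]) (use \<rho> zero in auto)
    also have "\<dots> = (\<Sum>j<k. c j * y ^ j)"
      by (subst sum.reindex[OF inj]) (use \<rho> in \<open>auto simp: b_def mon_const intro!: sum.cong\<close>)
    finally have "(\<Sum>M\<in>msets_upto 1 k. b M * mon (\<lambda>_. y) M) = 0" using sum by simp
    then have "b (?\<rho> j) = 0"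
      by (rule adapted_monomials_independent[OF B ad, rotated 2])
        (use c subspace_0[OF sB] in \<open>auto simp: b_def\<close>)
    then show "c j = 0" using j \<rho>[OF j] by (simp add: b_def)
  qed
  then show ?thesis by (rule free_powers_translate[OF alg comm, rotated 2]) (use b0 in \<open>auto simp: y_def\<close>)
qed

lemma graded_ore_extension_adjoin:
  assumes B: "stable B" "homogeneous s Hc B" and x: "x \<in> preimage B" "x \<notin> B" "x \<in> Hc \<gamma>"
    and comm: "\<And>b. b \<in> B \<Longrightarrow> x * b - b * x \<in> B"
  shows "graded_ore_extension_of_derivation_type s Hc B (adjoin B x)"
proof -
  have alg: "subalgebra s B" using B by (simp add: stable_def)
  note sB = stable_subspace[OF B(1)]
  \<comment> \<open>With the identity as automorphism, the Ore relation forces the derivation to be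
    the commutator with \<open>x\<close>.\<close>
  let ?\<delta> = "\<lambda>r. x * r - r * x"
  have "algebra_automorphism s B id" by (auto simp: algebra_automorphism_def)
  moreover have "skew_derivation s B id ?\<delta>"
    using comm by (auto simp: skew_derivation_def algebra_simps scale_right_diff_distrib
        scale_mult_left[symmetric] scale_mult_right[symmetric])
  moreover have "\<forall>t\<in>adjoin B x. \<exists>!f :: nat \<Rightarrow>\<^sub>0 'h. (\<forall>i. Poly_Mapping.lookup f i \<in> B) \<and>
        t = (\<Sum>i\<in>Poly_Mapping.keys f. Poly_Mapping.lookup f i * x ^ i)"
    using ex1_expansion[OF sB free_powers_preimage[OF B(1) x(1,2) comm]] by blast
  ultimately have "ore_extension s B (adjoin B x) x id ?\<delta>"
    unfolding ore_extension_def
    using alg subalgebra_adjoin[OF alg comm] subset_adjoin[OF sB] in_adjoin[OF alg] by auto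
  moreover have "?\<delta> r \<in> Hc (\<alpha> + \<gamma>)" if "r \<in> Hc \<alpha>" for r \<alpha>
    using graded_mult[OF x(3) that] graded_mult[OF that x(3)]
    by (simp add: add.commute subspace_diff[OF component_subspace])
  ultimately have "graded_ore_extension s Hc B (adjoin B x) x id ?\<delta>"
    unfolding graded_ore_extension_def using x B(2) homogeneous_adjoin[OF B(2) x(3)] by auto
  then show ?thesis unfolding graded_ore_extension_of_derivation_type_def
    by (intro exI[of _ x] exI[of _ id] exI[of _ ?\<delta>]) simp
qed

section \<open>Commutators and the choice of the Ore variable\<close>

lemma commutator_in_preimage:
  assumes B: "stable B" and x: "x \<in> preimage B" and b: "b \<in> B"
    and comm: "\<And>f. x * U f b - U f b * x \<in> B"
  shows "x * b - b * x \<in> preimage B"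
proof (rule preimageI)
  fix f
  note sB = stable_subspace[OF B]
  have sub: "span {a * b | a b. a \<in> B \<and> b \<in> B} \<subseteq> B"
    by (rule span_minimal[OF _ sB]) (use stable_mult[OF B] in auto)
  have Ux: "\<And>g. U g x \<in> B" and Ub: "\<And>g. U g b \<in> B"
    using preimageD[OF x] stable_U[OF B b] by auto
  have 1: "U f (x * b) - x * U f b - U f x * b \<in> B"
    using U_mult[OF sB sB Ux Ub] sub by blast
  have 2: "U f (b * x) - b * U f x - U f b * x \<in> B"
    using U_mult[OF sB sB Ub Ux] sub by blast
  \<comment> \<open>Modulo \<open>B\<close>, \<open>U f\<close> acts on the commutator as a
    derivation. The commutator of \<open>U f x\<close> with \<open>b\<close> stays in
    \<open>B\<close>; that of \<open>x\<close> with \<open>U f b\<close> is covered by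
    \<open>comm\<close>, the form in which the induction on the degree of \<open>b\<close>
    enters.\<close>
  have "U f (x * b - b * x) = (U f (x * b) - x * U f b - U f x * b) - (U f (b * x) - b * U f x - U f b * x)
      + (x * U f b - U f b * x) + (U f x * b - b * U f x)"
    by (simp add: U_diff algebra_simps)
  also have "\<dots> \<in> B"
    by (intro subspace_add[OF sB] subspace_diff[OF sB, OF 1 2] comm
        subspace_diff[OF sB, of "U f x * b"] stable_mult[OF B] Ux b)
  finally show "U f (x * b - b * x) \<in> B" .
qed

text \<open>Since \<open>[x, b]\<close> has larger degree than \<open>x\<close>, choosing \<open>x\<close> of maximal degree makes \<open>B\<close> stable
  under \<open>[x, -]\<close>. A maximal degree exists because the Gelfand-Kirillov dimension of \<open>A\<close> is finite.\<close>

lemma ex_normalizing_element: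
  assumes B: "stable B" "homogeneous s Hc B" and A: "stable A" "homogeneous s Hc A"
    and BA: "B \<subseteq> A" "A \<noteq> B" and gk: "gk_dim s A = ereal m"
  shows "\<exists>x \<gamma>. x \<in> A \<and> x \<in> preimage B \<and> x \<notin> B \<and> x \<in> Hc \<gamma> \<and> (\<forall>b\<in>B. x * b - b * x \<in> B)"
proof -
  note sA = stable_subspace[OF A(1)] and sB = stable_subspace[OF B(1)]
  define Q where "Q k \<longleftrightarrow> (\<exists>x \<gamma>. deg \<gamma> = k \<and> x \<in> A \<and> x \<in> preimage B \<and> x \<notin> B \<and> x \<in> Hc \<gamma>)" for k
  have ex: "\<exists>k. Q k"
  proof -
    define R where "R k \<longleftrightarrow> (\<exists>x \<gamma>. deg \<gamma> = k \<and> x \<in> A \<and> x \<notin> B \<and> x \<in> Hc \<gamma>)" for k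
    have "\<not> A \<subseteq> B" using BA by blast
    then have "\<exists>k. R k" using homogeneous_component_subset[OF A(2) sB] unfolding R_def by blast
    then have "R (LEAST k. R k)" by (rule LeastI_ex)
    then obtain x \<gamma> where x: "deg \<gamma> = (LEAST k. R k)" "x \<in> A" "x \<notin> B" "x \<in> Hc \<gamma>" unfolding R_def by blast
    \<comment> \<open>The components of \<open>U f x\<close> lie in \<open>A\<close> and have
      smaller degree than \<open>x\<close>, so minimality places them in \<open>B\<close>.\<close>
    have "U f x \<in> B" for f
    proof (rule in_span_of_proj[OF sB])
      fix \<beta>
      have UA: "U f x \<in> A" by (rule stable_U[OF A(1) x(2)])
      have "U f x \<in> Hlt (deg \<gamma>)" unfolding Hlt_def by (rule U_graded[OF x(4)])
      show "proj \<beta> (U f x) \<in> B"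
      proof (cases "deg \<beta> < deg \<gamma>")
        case True
        then have "\<not> R (deg \<beta>)" using not_less_Least x(1) by metis
        then show ?thesis using homogeneous_proj[OF A(2) UA] proj_in unfolding R_def by blast
      next
        case False
        then show ?thesis using proj_Hlt[OF \<open>U f x \<in> Hlt (deg \<gamma>)\<close>] subspace_0[OF sB] by simp
      qed
    qed
    then have "Q (deg \<gamma>)" unfolding Q_def using x preimageI by blast
    then show ?thesis by blast
  qed
  obtain X where X: "finite X" "A \<inter> preimage B \<subseteq> span (B \<union> X)"
    using ex_finite_generators[OF B(1) sA BA(1) gk] by blast
  obtain d where d: "X \<subseteq> Hlt (Suc d)" using finite_subset_Hlt[OF X(1)] by blast
  \<comment> \<open>Projection to a component of degree above \<open>d\<close> kills
    \<open>X\<close>, so it maps \<open>A \<inter> preimage B\<close> into \<open>B\<close>; but a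
    homogeneous element of that component is its own projection.\<close>
  have bound: "k \<le> d" if Qk: "Q k" for k
  proof (rule ccontr)
    assume "\<not> k \<le> d"
    obtain x \<gamma> where x: "deg \<gamma> = k" "x \<in> A" "x \<in> preimage B" "x \<notin> B" "x \<in> Hc \<gamma>"
      using Qk unfolding Q_def by blast
    have "span (B \<union> X) \<subseteq> {v. proj \<gamma> v \<in> B}"
    proof (rule span_minimal[OF _ subspace_proj_vimage[OF sB]], safe)
      show "proj \<gamma> v \<in> B" if "v \<in> B" for v by (rule homogeneous_proj[OF B(2) that])
      show "proj \<gamma> v \<in> B" if "v \<in> X" for v
        using proj_Hlt[of v "Suc d" \<gamma>] d that x(1) \<open>\<not> k \<le> d\<close> subspace_0[OF sB] by auto
    qed
    then have "proj \<gamma> x \<in> B" using X(2) x by blast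
    then show False using x proj_component by simp
  qed
  define K where "K = (GREATEST k. Q k)"
  have "Q K" unfolding K_def using ex bound by (blast intro: GreatestI_ex_nat)
  then obtain x \<gamma> where x: "deg \<gamma> = K" "x \<in> A" "x \<in> preimage B" "x \<notin> B" "x \<in> Hc \<gamma>"
    unfolding Q_def by blast
  have subsp: "subspace {b. x * b - b * x \<in> B}"
  proof -
    have "subspace {b. x * b - b * x \<in> V}" if "subspace V" for V
    proof (rule subspaceI)
      show "u + v \<in> {b. x * b - b * x \<in> V}" if "u \<in> {b. x * b - b * x \<in> V}" "v \<in> {b. x * b - b * x \<in> V}" for u v
        using subspace_add[OF \<open>subspace V\<close>, of "x * u - u * x" "x * v - v * x"] that by (simp add: algebra_simps)
      show "s c u \<in> {b. x * b - b * x \<in> V}" if "u \<in> {b. x * b - b * x \<in> V}" for c u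
        using subspace_scale[OF \<open>subspace V\<close>, of "x * u - u * x" c] that
        by (simp add: scale_right_diff_distrib scale_mult_left[symmetric] scale_mult_right[symmetric])
    qed (use subspace_0[OF that] in simp)
    then show ?thesis using sB by blast
  qed
  have comm: "x * b - b * x \<in> B" if "b \<in> B" "b \<in> Hc \<beta>" for b \<beta>
    using that
  proof (induction "deg \<beta>" arbitrary: b \<beta> rule: less_induct)
    case less
    show ?case
    proof (cases "deg \<beta> = 0")
      case True
      then have "b \<in> span {1}" using less.prems component_0_subset by (simp add: deg_eq_0)
      then have "x * b - b * x = 0" by (auto simp: span_1_iff scale_one_mult mult_scale_one)
      then show ?thesis using subspace_0[OF sB] by simp
    next
      case False
      let ?z = "x * b - b * x"
      have "x * U f b - U f b * x \<in> B" for f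
      proof -
        have "U f b \<in> {b. x * b - b * x \<in> B}"
        proof (rule in_span_of_proj[OF subsp])
          fix \<alpha>
          have "U f b \<in> Hlt (deg \<beta>)" unfolding Hlt_def by (rule U_graded[OF less.prems(2)])
          then have "proj \<alpha> (U f b) = 0" if "\<not> deg \<alpha> < deg \<beta>" using that proj_Hlt by simp
          moreover have "proj \<alpha> (U f b) \<in> B"
            by (rule homogeneous_proj[OF B(2) stable_U[OF B(1) less.prems(1)]])
          ultimately show "proj \<alpha> (U f b) \<in> {b. x * b - b * x \<in> B}"
            using less.hyps[OF _ _ proj_in, of \<alpha> "U f b"] subspace_0[OF sB] by (cases "deg \<alpha> < deg \<beta>") auto
        qed
        then show ?thesis by simp
      qed
      then have "?z \<in> preimage B"
        by (rule commutator_in_preimage[OF B(1) x(3) less.prems(1)])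
      moreover have "?z \<in> A"
        using less.prems BA(1) x(2) by (intro subspace_diff[OF sA] stable_mult[OF A(1)]) auto
      moreover have "?z \<in> Hc (\<gamma> + \<beta>)"
        using graded_mult[OF x(5) less.prems(2)] graded_mult[OF less.prems(2) x(5)]
        by (simp add: add.commute subspace_diff[OF component_subspace])
      \<comment> \<open>Since \<open>deg \<beta> \<noteq> 0\<close>, the commutator has degree above
        the maximum \<open>K\<close>. Being homogeneous, primitive over \<open>B\<close> and in
        \<open>A\<close>, it can only lie in \<open>B\<close>.\<close>
      moreover have "\<not> Q (deg (\<gamma> + \<beta>))"
      proof
        assume "Q (deg (\<gamma> + \<beta>))"
        then have "deg (\<gamma> + \<beta>) \<le> K" unfolding K_def by (rule Greatest_le_nat) (rule bound)
        then show False using False x(1) by (simp add: deg_add)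
      qed
      ultimately show ?thesis unfolding Q_def by blast
    qed
  qed
  have "B \<subseteq> {b. x * b - b * x \<in> B}"
    by (rule homogeneous_component_subset[OF B(2) subsp]) (simp add: comm)
  then show ?thesis using x by blast
qed

section \<open>Chains of Ore extensions\<close>

lemma ex_ore_step:
  assumes B: "stable B" "homogeneous s Hc B" and A: "stable A" "homogeneous s Hc A"
    and BA: "B \<subseteq> A" "A \<noteq> B" and gk: "gk_dim s A = ereal m"
  shows "\<exists>K. stable K \<and> homogeneous s Hc K \<and> B \<subset> K \<and> K \<subseteq> A \<and>
    graded_ore_extension_of_derivation_type s Hc B K \<and>
    (\<forall>r. growth_ge B r \<longrightarrow> growth_ge K (Suc r)) \<and> (\<forall>r. growth_le B r \<longrightarrow> growth_le K (Suc r))"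
proof -
  obtain x \<gamma> where x: "x \<in> A" "x \<in> preimage B" "x \<notin> B" "x \<in> Hc \<gamma>"
    and comm: "\<And>b. b \<in> B \<Longrightarrow> x * b - b * x \<in> B"
    using ex_normalizing_element[OF assms] by blast
  have alg: "subalgebra s B" "subalgebra s A" using A B by (auto simp: stable_def)
  have "\<gamma> \<noteq> 0"
  proof
    assume "\<gamma> = 0"
    then have "x \<in> span {1}" using x(4) component_0_subset by simp
    then show False using x(3) span_1_subset_stable[OF B(1)] by blast
  qed
  then have deg: "1 \<le> deg \<gamma>" using deg_eq_0[of \<gamma>] by linarith
  note sB = stable_subspace[OF B(1)]
  have "B \<subset> adjoin B x" using subset_adjoin[OF sB] in_adjoin[OF alg(1)] x(3) by blast
  then show ?thesis
    by (intro exI[of _ "adjoin B x"] conjI allI impI stable_adjoin homogeneous_adjoin adjoin_subset_subalgebra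
        graded_ore_extension_adjoin growth_ge_adjoin growth_le_adjoin free_powers_preimage)
      (use B x comm deg alg BA(1) in auto)
qed

text \<open>Every step raises the exponent \<open>p\<close> while \<open>growth_ge\<close> keeps it
  at most \<open>m\<close>, which gives the termination measure. \<open>growth_le\<close> is carried
  along so that the final exponent can be identified with the dimension.\<close>

lemma ex_ore_chain:
  assumes A: "stable A" "homogeneous s Hc A" and gk: "gk_dim s A = ereal m"
  shows "stable B \<Longrightarrow> homogeneous s Hc B \<Longrightarrow> B \<subseteq> A \<Longrightarrow> growth_ge B p \<Longrightarrow> growth_le B p \<Longrightarrow>
    \<exists>N K. K 0 = B \<and> K N = A \<and> (\<forall>i\<le>N. stable (K i) \<and> homogeneous s Hc (K i)) \<and>
      (\<forall>i<N. K i \<subset> K (Suc i) \<and> graded_ore_extension_of_derivation_type s Hc (K i) (K (Suc i))) \<and>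
      growth_ge A (p + N) \<and> growth_le A (p + N)"
proof (induction "nat \<lfloor>m\<rfloor> - p" arbitrary: B p rule: less_induct)
  case less
  show ?case
  proof (cases "A = B")
    case True
    then show ?thesis using less.prems by (intro exI[of _ 0] exI[of _ "\<lambda>_. B"]) simp
  next
    case False
    obtain L where L: "stable L" "homogeneous s Hc L" "B \<subset> L" "L \<subseteq> A"
      "graded_ore_extension_of_derivation_type s Hc B L" "growth_ge L (Suc p)" "growth_le L (Suc p)"
      using ex_ore_step[OF less.prems(1,2) A less.prems(3) False gk] less.prems(4,5) by blast
    have "ereal (real (Suc p)) \<le> gk_dim s L" by (rule growth_ge_imp_gk_dim_ge[OF L(6)])
    also have "\<dots> \<le> ereal m" using gk_dim_mono[OF L(4)] gk by simp
    finally have "real (Suc p) \<le> m" by simp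
    then have "Suc p \<le> nat \<lfloor>m\<rfloor>" by linarith
    then have "nat \<lfloor>m\<rfloor> - Suc p < nat \<lfloor>m\<rfloor> - p" by simp
    from less.hyps[OF this L(1,2,4,6,7)] obtain N K where
      K: "K 0 = L" "K N = A" "\<And>i. i \<le> N \<Longrightarrow> stable (K i) \<and> homogeneous s Hc (K i)"
        "\<And>i. i < N \<Longrightarrow> K i \<subset> K (Suc i) \<and> graded_ore_extension_of_derivation_type s Hc (K i) (K (Suc i))"
        "growth_ge A (Suc p + N)" "growth_le A (Suc p + N)" by blast
    let ?K = "\<lambda>i. case i of 0 \<Rightarrow> B | Suc i \<Rightarrow> K i"
    have "stable (?K i) \<and> homogeneous s Hc (?K i)" if "i \<le> Suc N" for i
      using that K(3) less.prems by (cases i) auto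
    moreover have "?K i \<subset> ?K (Suc i) \<and> graded_ore_extension_of_derivation_type s Hc (?K i) (?K (Suc i))"
      if "i < Suc N" for i
      using that K(1,4) L by (cases i) auto
    ultimately show ?thesis using K(2,5,6)
      by (intro exI[of _ "Suc N"] exI[of _ ?K]) simp
  qed
qed

theorem ore_chain:
  assumes A: "stable A" "homogeneous s Hc A" and B: "stable B" "homogeneous s Hc B" and "B \<subseteq> A"
    and gk: "gk_dim s A = ereal m" "gk_dim s B = ereal n"
  shows "\<exists>N. real N = m - n \<and> (\<exists>K. K 0 = B \<and> K N = A \<and>
    (\<forall>i\<le>N. stable (K i) \<and> homogeneous s Hc (K i)) \<and>
    (\<forall>i<N. K i \<subset> K (Suc i) \<and> graded_ore_extension_of_derivation_type s Hc (K i) (K (Suc i))))"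
proof -
  let ?k = "span {1}"
  have ind: "independent {1}" by (simp add: independent_insert)
  have "stable ?k"
    by (auto simp: stable_def subalgebra_def span_base U_span_1 span_zero)
      (auto simp: span_1_iff scale_one_mult intro: exI)
  moreover have "homogeneous s Hc ?k"
    by (rule homogeneousI[OF subspace_span], rule span_mono) (use graded_one span_base in auto)
  moreover have "growth_ge ?k 0" unfolding growth_ge_def
  proof (rule exI[of _ "{}"], rule exI[of _ 0], intro conjI allI)
    fix n :: nat
    have "{1} \<subseteq> span (words {} (0 * n))" by (auto simp: words_def intro!: span_base)
    then show "\<exists>S. finite S \<and> independent S \<and> (n + 1) ^ 0 \<le> card S \<and> S \<subseteq> span (words {} (0 * n))"
      using ind by (intro exI[of _ "{1}"]) simp
  qed auto
  moreover have "growth_le ?k 0" unfolding growth_le_def by (rule allI, rule exI[of _ "{1}"]) auto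
  ultimately obtain p where p: "growth_ge B (0 + p)" "growth_le B (0 + p)"
    using ex_ore_chain[OF B gk(2) _ _ span_1_subset_stable[OF B(1)]] by blast
  have alg: "subalgebra s A" "subalgebra s B" using A B by (auto simp: stable_def)
  \<comment> \<open>The two bounds agree, so \<open>p\<close> is the dimension of \<open>B\<close>;
    they are at hand because \<open>B\<close> has just been built up from the scalars.\<close>
  have n: "n = real p"
    using growth_ge_imp_gk_dim_ge[OF p(1)] growth_le_imp_gk_dim_le[OF alg(2) p(2)] gk(2) by simp
  obtain N K where K: "K 0 = B \<and> K N = A \<and> (\<forall>i\<le>N. stable (K i) \<and> homogeneous s Hc (K i)) \<and>
      (\<forall>i<N. K i \<subset> K (Suc i) \<and> graded_ore_extension_of_derivation_type s Hc (K i) (K (Suc i)))"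
    and q: "growth_ge A (0 + p + N)" "growth_le A (0 + p + N)"
    using ex_ore_chain[OF A gk(1) B assms(5) p] by blast
  have "m = real (p + N)"
    using growth_ge_imp_gk_dim_ge[OF q(1)] growth_le_imp_gk_dim_le[OF alg(1) q(2)] gk(1) by simp
  then have "real N = m - n" using n by simp
  then show ?thesis using K by blast
qed

end

section \<open>Tensors and functionals\<close>

context unital_algebra
begin

lemma lin_ext_superset:
  "finite I \<Longrightarrow> Poly_Mapping.keys z \<subseteq> I \<Longrightarrow>
    lin_ext s \<phi> z = (\<Sum>a\<in>I. s (Poly_Mapping.lookup z a) (\<phi> a))"
  unfolding lin_ext_def by (rule sum.mono_neutral_left) (auto simp: in_keys_iff)

lemma lin_ext_add: "lin_ext s \<phi> (z + w) = lin_ext s \<phi> z + lin_ext s \<phi> w"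
proof -
  let ?I = "Poly_Mapping.keys z \<union> Poly_Mapping.keys w"
  have "lin_ext s \<phi> (z + w) = (\<Sum>a\<in>?I. s (Poly_Mapping.lookup (z + w) a) (\<phi> a))"
    by (rule lin_ext_superset[OF _ keys_add]) simp
  also have "\<dots> = lin_ext s \<phi> z + lin_ext s \<phi> w"
    by (simp add: lookup_add scale_left_distrib sum.distrib lin_ext_superset[of ?I])
  finally show ?thesis .
qed

lemma lin_ext_fscale: "lin_ext s \<phi> (fscale c z) = s c (lin_ext s \<phi> z)"
proof -
  have "Poly_Mapping.keys (fscale c z) \<subseteq> Poly_Mapping.keys z"
    by (auto simp: in_keys_iff lookup_fscale)
  then show ?thesis
    by (subst lin_ext_superset[of "Poly_Mapping.keys z"])
      (auto simp: lookup_fscale lin_ext_def scale_sum_right)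
qed

lemma lin_ext_0: "lin_ext s \<phi> 0 = 0"
  by (simp add: lin_ext_def)

lemma lin_ext_diff: "lin_ext s \<phi> (z - w) = lin_ext s \<phi> z - lin_ext s \<phi> w"
  using lin_ext_add[of \<phi> "z - w" w] by simp

lemma lin_ext_sum: "lin_ext s \<phi> (\<Sum>i\<in>I. z i) = (\<Sum>i\<in>I. lin_ext s \<phi> (z i))"
  by (induction I rule: infinite_finite_induct) (simp_all add: lin_ext_0 lin_ext_add)

lemma lin_ext_pure: "lin_ext s \<phi> (pure a) = \<phi> a"
  by (simp add: lin_ext_def)

lemma lin_ext_lin_ext:
  "lin_ext s \<phi> (lin_ext fscale \<psi> z) = lin_ext s (\<lambda>a. lin_ext s \<phi> (\<psi> a)) z"
  unfolding lin_ext_def[of fscale] lin_ext_sum lin_ext_fscale by (simp add: lin_ext_def)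

lemma lin_ext_fun_add: "lin_ext s (\<lambda>a. \<phi> a + \<psi> a) z = lin_ext s \<phi> z + lin_ext s \<psi> z"
  by (simp add: lin_ext_def scale_right_distrib sum.distrib)

lemma lin_ext_fun_scale: "lin_ext s (\<lambda>a. s c (\<phi> a)) z = s c (lin_ext s \<phi> z)"
  by (simp add: lin_ext_def scale_sum_right mult.commute)

lemma lin_ext_in_subspace:
  assumes Z: "subspace Z" and z: "z \<in> module.span fscale (pure ` P)" and "\<And>p. p \<in> P \<Longrightarrow> \<phi> p \<in> Z"
  shows "lin_ext s \<phi> z \<in> Z"
proof -
  interpret F: vector_space "fscale :: 'k \<Rightarrow> ('c \<Rightarrow>\<^sub>0 'k) \<Rightarrow> _" by (rule vector_space_fscale)
  have "module.span fscale (pure ` P) \<subseteq> {z. lin_ext s \<phi> z \<in> Z}"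
    by (rule F.span_minimal)
      (use assms in \<open>auto simp: lin_ext_pure F.subspace_def lin_ext_0 lin_ext_add lin_ext_fscale
        subspace_0 subspace_add subspace_scale\<close>)
  then show ?thesis using z by blast
qed

text \<open>The coordinates belong to a basis of \<open>H\<close> extending one of \<open>K\<close>.
  Indexing them by the basis vectors \<open>e\<close> themselves avoids naming the basis.\<close>

lemma ex_coordinates:
  assumes "subspace K"
  obtains c where "\<And>e. Vector_Spaces.linear s (*) (\<lambda>v. c v e)" "\<And>v. finite {e. c v e \<noteq> 0}"
    "\<And>v. (\<Sum>e | c v e \<noteq> 0. s (c v e) e) = v" "\<And>v e. v \<in> K \<Longrightarrow> c v e \<noteq> 0 \<Longrightarrow> e \<in> K"
proof -
  obtain b where b: "b \<subseteq> K" "independent b" "K \<subseteq> span b" by (rule basis_exists[of K])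
  let ?E = "extend_basis b"
  note E = extend_basis_superset[OF b(2)] independent_extend_basis[OF b(2)] span_extend_basis[OF b(2)]
  have mem: "e \<in> K" if "v \<in> K" "representation ?E v e \<noteq> 0" for v e
  proof -
    have "v \<in> span b" using that b by blast
    then have "representation ?E v = representation b v" by (rule representation_extend[OF E(2) _ E(1)])
    then have "representation b v e \<noteq> 0" using that by simp
    then have "e \<in> b" by (rule representation_ne_zero)
    then show ?thesis using b by blast
  qed
  have sum: "(\<Sum>e | representation ?E v e \<noteq> 0. s (representation ?E v e) e) = v" for v
    by (rule sum_nonzero_representation_eq[OF E(2)]) (simp add: E(3))
  show thesis
    by (rule that[of "representation ?E"])
      (rule linear_representation[OF E(2,3)] finite_representation sum mem; assumption)+
qed

definition bilin :: "('h \<times> 'h \<Rightarrow> 'h) \<Rightarrow> bool" where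
  "bilin \<phi> \<longleftrightarrow> (\<forall>x x' y. \<phi> (x + x', y) = \<phi> (x, y) + \<phi> (x', y)) \<and>
     (\<forall>x y y'. \<phi> (x, y + y') = \<phi> (x, y) + \<phi> (x, y')) \<and>
     (\<forall>c x y. \<phi> (s c x, y) = s c (\<phi> (x, y))) \<and>
     (\<forall>c x y. \<phi> (x, s c y) = s c (\<phi> (x, y)))"

lemma lin_ext_tensor_eq:
  assumes \<phi>: "bilin \<phi>" and "tensor_eq s z w"
  shows "lin_ext s \<phi> z = lin_ext s \<phi> w"
proof -
  interpret F: vector_space "fscale :: 'k \<Rightarrow> ('h \<times> 'h \<Rightarrow>\<^sub>0 'k) \<Rightarrow> _" by (rule vector_space_fscale)
  have "F.span (bilinear_relations s) \<subseteq> {z. lin_ext s \<phi> z = 0}"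
  proof (rule F.span_minimal)
    show "bilinear_relations s \<subseteq> {z. lin_ext s \<phi> z = 0}"
      using \<phi> unfolding bilin_def bilinear_relations_def
      by (auto simp: lin_ext_diff lin_ext_pure lin_ext_fscale)
  qed (auto simp: F.subspace_def lin_ext_0 lin_ext_add lin_ext_fscale)
  then show ?thesis using assms(2) unfolding tensor_eq_def by (auto simp: lin_ext_diff)
qed

lemma bilin_lin_ext: "(\<And>q. bilin (\<lambda>p. \<phi> p q)) \<Longrightarrow> bilin (\<lambda>p. lin_ext s (\<phi> p) z)"
proof -
  assume \<phi>: "\<And>q. bilin (\<lambda>p. \<phi> p q)"
  have "\<phi> (x + x', y) = (\<lambda>q. \<phi> (x, y) q + \<phi> (x', y) q)"
    "\<phi> (x, y + y') = (\<lambda>q. \<phi> (x, y) q + \<phi> (x, y') q)"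
    "\<phi> (s c x, y) = (\<lambda>q. s c (\<phi> (x, y) q))"
    "\<phi> (x, s c y) = (\<lambda>q. s c (\<phi> (x, y) q))" for x x' y y' c
    using \<phi> unfolding bilin_def by blast+
  then show ?thesis unfolding bilin_def by (simp add: lin_ext_fun_add lin_ext_fun_scale)
qed

lemma
  shows tensor_refl: "tensor_eq s z z"
    and tensor_trans: "tensor_eq s z w \<Longrightarrow> tensor_eq s w v \<Longrightarrow> tensor_eq s z v"
    and tensor_add: "tensor_eq s z w \<Longrightarrow> tensor_eq s z' w' \<Longrightarrow> tensor_eq s (z + z') (w + w')"
    and tensor_fscale: "tensor_eq s z w \<Longrightarrow> tensor_eq s (fscale c z) (fscale c w)"
proof -
  interpret F: vector_space "fscale :: 'k \<Rightarrow> ('h \<times> 'h \<Rightarrow>\<^sub>0 'k) \<Rightarrow> _" by (rule vector_space_fscale)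
  show "tensor_eq s z z" by (simp add: tensor_eq_def F.span_zero)
  show "tensor_eq s z v" if "tensor_eq s z w" "tensor_eq s w v"
    using F.span_add[of "z - w" "bilinear_relations s" "w - v"] that by (simp add: tensor_eq_def)
  show "tensor_eq s (z + z') (w + w')" if "tensor_eq s z w" "tensor_eq s z' w'"
    using F.span_add[of "z - w" "bilinear_relations s" "z' - w'"] that
    by (simp add: tensor_eq_def algebra_simps)
  show "tensor_eq s (fscale c z) (fscale c w)" if "tensor_eq s z w"
    using F.span_scale[of "z - w" "bilinear_relations s" c] that
    by (simp add: tensor_eq_def F.scale_right_diff_distrib)
qed

lemma tensor_sum:
  "(\<And>i. i \<in> I \<Longrightarrow> tensor_eq s (z i) (w i)) \<Longrightarrow> tensor_eq s (\<Sum>i\<in>I. z i) (\<Sum>i\<in>I. w i)"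
  by (induction I rule: infinite_finite_induct) (simp_all add: tensor_refl tensor_add)

lemma tensor_pure_relations:
  "tensor_eq s (pure (x + x', y)) (pure (x, y) + pure (x', y))"
  "tensor_eq s (pure (x, y + y')) (pure (x, y) + pure (x, y'))"
  "tensor_eq s (pure (s c x, y)) (fscale c (pure (x, y)))"
  "tensor_eq s (pure (x, s c y)) (fscale c (pure (x, y)))"
proof -
  interpret F: vector_space "fscale :: 'k \<Rightarrow> ('h \<times> 'h \<Rightarrow>\<^sub>0 'k) \<Rightarrow> _" by (rule vector_space_fscale)
  show "tensor_eq s (pure (x + x', y)) (pure (x, y) + pure (x', y))"
    unfolding tensor_eq_def diff_diff_add[symmetric]
    by (rule F.span_base) (unfold bilinear_relations_def, blast)
  show "tensor_eq s (pure (x, y + y')) (pure (x, y) + pure (x, y'))"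
    unfolding tensor_eq_def diff_diff_add[symmetric]
    by (rule F.span_base) (unfold bilinear_relations_def, blast)
  show "tensor_eq s (pure (s c x, y)) (fscale c (pure (x, y)))"
    unfolding tensor_eq_def by (rule F.span_base) (unfold bilinear_relations_def, blast)
  show "tensor_eq s (pure (x, s c y)) (fscale c (pure (x, y)))"
    unfolding tensor_eq_def by (rule F.span_base) (unfold bilinear_relations_def, blast)
qed

lemma tensor_pure_0: "tensor_eq s (pure (0, y)) 0" "tensor_eq s (pure (x, 0)) 0"
proof -
  have "fscale 0 z = 0" for z :: "'h \<times> 'h \<Rightarrow>\<^sub>0 'k"
    by (rule poly_mapping_eqI) (simp add: lookup_fscale)
  then show "tensor_eq s (pure (0, y)) 0" "tensor_eq s (pure (x, 0)) 0"
    using tensor_pure_relations(3)[of 0 0 y] tensor_pure_relations(4)[of x 0 0] by simp_all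
qed

lemma tensor_pure_sum_left:
  "tensor_eq s (pure (\<Sum>i\<in>I. s (c i) (u i), y)) (\<Sum>i\<in>I. fscale (c i) (pure (u i, y)))"
proof (induction I rule: infinite_finite_induct)
  case (insert i I)
  then show ?case
    unfolding sum.insert[OF insert.hyps]
    by (intro tensor_trans[OF tensor_pure_relations(1) tensor_add[OF tensor_pure_relations(3)]])
qed (simp_all add: tensor_pure_0)

lemma tensor_pure_sum_right:
  "tensor_eq s (pure (x, \<Sum>i\<in>I. s (c i) (u i))) (\<Sum>i\<in>I. fscale (c i) (pure (x, u i)))"
proof (induction I rule: infinite_finite_induct)
  case (insert i I)
  then show ?case
    unfolding sum.insert[OF insert.hyps]
    by (intro tensor_trans[OF tensor_pure_relations(2) tensor_add[OF tensor_pure_relations(4)]])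
qed (simp_all add: tensor_pure_0)

text \<open>For \<open>\<sigma> = id\<close> this is \<open>(f \<otimes> id) z\<close>, and for \<open>\<sigma> = prod.swap\<close> it is \<open>(id \<otimes> f) z\<close>.\<close>

definition contract :: "('h \<times> 'h \<Rightarrow> 'h \<times> 'h) \<Rightarrow> ('h \<Rightarrow> 'k) \<Rightarrow> ('h \<times> 'h \<Rightarrow>\<^sub>0 'k) \<Rightarrow> 'h" where
  "contract \<sigma> f = lin_ext s (\<lambda>p. s (f (fst (\<sigma> p))) (snd (\<sigma> p)))"

abbreviation functional :: "('h \<Rightarrow> 'k) \<Rightarrow> bool" where
  "functional f \<equiv> Vector_Spaces.linear s (*) f"

lemma functional_simps:
  assumes "functional f"
  shows "f (x + y) = f x + f y" "f (x - y) = f x - f y" "f (s c x) = c * f x" "f 0 = 0"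
    "f (\<Sum>i\<in>I. h i) = (\<Sum>i\<in>I. f (h i))"
proof -
  have f: "module_hom s (*) f" using assms by (simp add: Vector_Spaces.linear_def)
  show "f (x + y) = f x + f y" "f (x - y) = f x - f y" "f (s c x) = c * f x" "f 0 = 0"
    "f (\<Sum>i\<in>I. h i) = (\<Sum>i\<in>I. f (h i))"
    using module_hom.add[OF f] module_hom.diff[OF f] module_hom.scale[OF f] module_hom.zero[OF f]
      module_hom.sum[OF f] by auto
qed

lemma bilin_contract:
  assumes f: "functional f" and \<sigma>: "\<sigma> = id \<or> \<sigma> = prod.swap"
  shows "bilin (\<lambda>p. s (f (fst (\<sigma> p))) (snd (\<sigma> p)))"
  using \<sigma> by (auto simp: bilin_def functional_simps[OF f] scale_left_distrib scale_right_distrib mult.commute)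

lemma contract_tensor_eq:
  "functional f \<Longrightarrow> \<sigma> = id \<or> \<sigma> = prod.swap \<Longrightarrow> tensor_eq s z w \<Longrightarrow> contract \<sigma> f z = contract \<sigma> f w"
  unfolding contract_def by (rule lin_ext_tensor_eq[OF bilin_contract])

lemma contract_mem:
  assumes "functional f" "\<sigma> = id \<or> \<sigma> = prod.swap" "subspace K" "z \<in> tensor_span s P"
    "\<And>p. p \<in> P \<Longrightarrow> snd (\<sigma> p) \<in> K"
  shows "contract \<sigma> f z \<in> K"
proof -
  obtain w where w: "w \<in> module.span fscale (pure ` P)" "tensor_eq s z w"
    using assms(4) by (auto simp: tensor_span_def)
  have "contract \<sigma> f w \<in> K" unfolding contract_def
    by (rule lin_ext_in_subspace[OF assms(3) w(1)]) (intro subspace_scale assms)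
  then show ?thesis using contract_tensor_eq[OF assms(1,2) w(2)] by simp
qed

text \<open>This is the converse of \<open>contract_mem\<close>, on both legs at once. In bases
  adapted to \<open>K\<close> and \<open>L\<close>, each coefficient of \<open>z\<close> is a
  coordinate of a contraction of \<open>z\<close> on either leg, so a nonzero one forces its basis
  vectors into \<open>K\<close> and \<open>L\<close>.\<close>

lemma mem_tensor_spanI:
  assumes K: "subspace K" "subspace L"
    and z1: "\<And>f. functional f \<Longrightarrow> contract prod.swap f z \<in> K"
    and z2: "\<And>f. functional f \<Longrightarrow> contract id f z \<in> L"
  shows "z \<in> tensor_span s (K \<times> L)"
proof -
  interpret F: vector_space "fscale :: 'k \<Rightarrow> ('h \<times> 'h \<Rightarrow>\<^sub>0 'k) \<Rightarrow> _" by (rule vector_space_fscale)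
  obtain c where c: "\<And>e. functional (\<lambda>v. c v e)" "\<And>v. finite {e. c v e \<noteq> 0}"
    "\<And>v. (\<Sum>e | c v e \<noteq> 0. s (c v e) e) = v" "\<And>v e. v \<in> K \<Longrightarrow> c v e \<noteq> 0 \<Longrightarrow> e \<in> K"
    by (rule ex_coordinates[OF K(1)], rule that)
  obtain d where d: "\<And>e. functional (\<lambda>v. d v e)" "\<And>v. finite {e. d v e \<noteq> 0}"
    "\<And>v. (\<Sum>e | d v e \<noteq> 0. s (d v e) e) = v" "\<And>v e. v \<in> L \<Longrightarrow> d v e \<noteq> 0 \<Longrightarrow> e \<in> L"
    by (rule ex_coordinates[OF K(2)], rule that)
  define I where "I = (\<Union>p\<in>Poly_Mapping.keys z. {e. c (fst p) e \<noteq> 0})"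
  define J where "J = (\<Union>p\<in>Poly_Mapping.keys z. {e. d (snd p) e \<noteq> 0})"
  have fin: "finite I" "finite J" using c(2) d(2) by (auto simp: I_def J_def)
  define k where "k e e' = (\<Sum>p\<in>Poly_Mapping.keys z. Poly_Mapping.lookup z p * (c (fst p) e * d (snd p) e'))" for e e'
  define w where "w = (\<Sum>e\<in>I. \<Sum>e'\<in>J. fscale (k e e') (pure (e, e')))"
  have pure: "tensor_eq s (pure p) (\<Sum>e\<in>I. \<Sum>e'\<in>J. fscale (c (fst p) e * d (snd p) e') (pure (e, e')))"
    if p: "p \<in> Poly_Mapping.keys z" for p
  proof -
    have "(\<Sum>e\<in>I. s (c (fst p) e) e) = (\<Sum>e | c (fst p) e \<noteq> 0. s (c (fst p) e) e)"
      by (rule sum.mono_neutral_right[OF fin(1)]) (use p in \<open>auto simp: I_def\<close>)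
    then have 1: "fst p = (\<Sum>e\<in>I. s (c (fst p) e) e)" using c(3) by simp
    have "(\<Sum>e\<in>J. s (d (snd p) e) e) = (\<Sum>e | d (snd p) e \<noteq> 0. s (d (snd p) e) e)"
      by (rule sum.mono_neutral_right[OF fin(2)]) (use p in \<open>auto simp: J_def\<close>)
    then have 2: "snd p = (\<Sum>e\<in>J. s (d (snd p) e) e)" using d(3) by simp
    have a: "tensor_eq s (pure (\<Sum>e\<in>I. s (c (fst p) e) e, snd p))
        (\<Sum>e\<in>I. fscale (c (fst p) e) (pure (e, snd p)))"
      by (rule tensor_pure_sum_left)
    have b: "tensor_eq s (pure (e, snd p)) (\<Sum>e'\<in>J. fscale (d (snd p) e') (pure (e, e')))" for e
      using tensor_pure_sum_right[of e "d (snd p)" "\<lambda>e. e" J] 2 by simp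
    have "tensor_eq s (pure p) (\<Sum>e\<in>I. fscale (c (fst p) e) (pure (e, snd p)))"
      using a 1 by simp
    then have "tensor_eq s (pure p) (\<Sum>e\<in>I. fscale (c (fst p) e) (\<Sum>e'\<in>J. fscale (d (snd p) e') (pure (e, e'))))"
      by (rule tensor_trans) (intro tensor_sum tensor_fscale b)
    then show ?thesis by (simp add: F.scale_sum_right)
  qed
  \<comment> \<open>Writing the formal sum \<open>z\<close> out over its keys allows each
    \<open>pure p\<close> to be replaced by its expansion in the two bases.\<close>
  define y where "y = (\<Sum>p\<in>Poly_Mapping.keys z. fscale (Poly_Mapping.lookup z p) (pure p))"
  have y: "y = z"
  proof (rule poly_mapping_eqI)
    fix q
    have "Poly_Mapping.lookup y q
        = (\<Sum>p\<in>Poly_Mapping.keys z. if p = q then Poly_Mapping.lookup z p else 0)"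
      unfolding y_def lookup_sum by (rule sum.cong) (auto simp: lookup_fscale lookup_single when_def)
    also have "\<dots> = (if q \<in> Poly_Mapping.keys z then Poly_Mapping.lookup z q else 0)"
      by (rule sum.delta) simp
    also have "\<dots> = Poly_Mapping.lookup z q" by (simp add: in_keys_iff)
    finally show "Poly_Mapping.lookup y q = Poly_Mapping.lookup z q" .
  qed
  have "tensor_eq s y (\<Sum>p\<in>Poly_Mapping.keys z. fscale (Poly_Mapping.lookup z p)
      (\<Sum>e\<in>I. \<Sum>e'\<in>J. fscale (c (fst p) e * d (snd p) e') (pure (e, e'))))"
    unfolding y_def by (rule tensor_sum[OF tensor_fscale[OF pure]])
  then have "tensor_eq s z (\<Sum>p\<in>Poly_Mapping.keys z. fscale (Poly_Mapping.lookup z p)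
      (\<Sum>e\<in>I. \<Sum>e'\<in>J. fscale (c (fst p) e * d (snd p) e') (pure (e, e'))))"
    unfolding y .
  also have "(\<Sum>p\<in>Poly_Mapping.keys z. fscale (Poly_Mapping.lookup z p)
      (\<Sum>e\<in>I. \<Sum>e'\<in>J. fscale (c (fst p) e * d (snd p) e') (pure (e, e'))))
    = (\<Sum>p\<in>Poly_Mapping.keys z. \<Sum>e\<in>I. \<Sum>e'\<in>J.
        fscale (Poly_Mapping.lookup z p * (c (fst p) e * d (snd p) e')) (pure (e, e')))"
    by (simp add: F.scale_sum_right)
  also have "\<dots> = w"
  proof -
    have "(\<Sum>p\<in>Poly_Mapping.keys z. \<Sum>e\<in>I. \<Sum>e'\<in>J.
        fscale (Poly_Mapping.lookup z p * (c (fst p) e * d (snd p) e')) (pure (e, e')))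
      = (\<Sum>e\<in>I. \<Sum>p\<in>Poly_Mapping.keys z. \<Sum>e'\<in>J.
        fscale (Poly_Mapping.lookup z p * (c (fst p) e * d (snd p) e')) (pure (e, e')))"
      by (rule sum.swap)
    also have "\<dots> = (\<Sum>e\<in>I. \<Sum>e'\<in>J. \<Sum>p\<in>Poly_Mapping.keys z.
        fscale (Poly_Mapping.lookup z p * (c (fst p) e * d (snd p) e')) (pure (e, e')))"
      by (intro sum.cong refl sum.swap)
    also have "\<dots> = w" by (simp add: w_def k_def F.scale_sum_left)
    finally show ?thesis .
  qed
  finally have zw: "tensor_eq s z w" .
  have "w \<in> F.span (pure ` (K \<times> L))"
    unfolding w_def
  proof (intro F.span_sum)
    fix e e' assume "e \<in> I" "e' \<in> J"
    show "fscale (k e e') (pure (e, e')) \<in> F.span (pure ` (K \<times> L))"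
    proof (cases "k e e' = 0")
      case True
      then show ?thesis by (simp add: F.span_zero)
    next
      case False
      have "k e e' = d (contract id (\<lambda>v. c v e) z) e'"
        by (simp add: k_def contract_def lin_ext_def functional_simps[OF d(1)] mult_ac)
      then have "e' \<in> L" using False d(4)[OF z2[OF c(1)]] by simp
      moreover have "k e e' = c (contract prod.swap (\<lambda>v. d v e') z) e"
        by (simp add: k_def contract_def lin_ext_def functional_simps[OF c(1)] mult_ac)
      then have "e \<in> K" using False c(4)[OF z1[OF d(1)]] by simp
      ultimately show ?thesis by (intro F.span_scale F.span_base) auto
    qed
  qed
  then show ?thesis unfolding tensor_span_def using zw by blast
qed

lemma lin_ext_mult_left: "x * lin_ext s \<phi> z = lin_ext s (\<lambda>p. x * \<phi> p) z"
  by (simp add: lin_ext_def sum_distrib_left scale_mult_right)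

lemma lin_ext_mult_right: "lin_ext s \<phi> z * x = lin_ext s (\<lambda>p. \<phi> p * x) z"
  by (simp add: lin_ext_def sum_distrib_right scale_mult_left)

lemma contract_add: "contract \<sigma> f (z + w) = contract \<sigma> f z + contract \<sigma> f w"
  and contract_diff: "contract \<sigma> f (z - w) = contract \<sigma> f z - contract \<sigma> f w"
  and contract_fscale: "contract \<sigma> f (fscale c z) = s c (contract \<sigma> f z)"
  and contract_pure: "contract \<sigma> f (pure p) = s (f (fst (\<sigma> p))) (snd (\<sigma> p))"
  by (simp_all add: contract_def lin_ext_add lin_ext_diff lin_ext_fscale lin_ext_pure)

text \<open>This supplies \<open>U_mult\<close>: of the four terms in the product of
  \<open>1 \<otimes> x + u\<close> and \<open>1 \<otimes> y + v\<close>, three are subtracted, and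
  the one from \<open>u\<close> and \<open>v\<close> remains.\<close>

lemma contract_tensor_mult:
  assumes f: "functional f" and \<sigma>: "\<sigma> = id \<or> \<sigma> = prod.swap" and K: "subspace K" "subspace L"
    and z: "z - pure (\<sigma> (1, x)) \<in> tensor_span s {p. snd (\<sigma> p) \<in> K}"
    and w: "w - pure (\<sigma> (1, y)) \<in> tensor_span s {p. snd (\<sigma> p) \<in> L}"
  shows "contract \<sigma> f (tensor_mult z w) - s (f 1) (x * y)
      - x * (contract \<sigma> f w - s (f 1) y) - (contract \<sigma> f z - s (f 1) x) * y
    \<in> span {a * b | a b. a \<in> K \<and> b \<in> L}"
proof -
  \<comment> \<open>Applying \<open>\<sigma>\<close> to both arguments treats the two sides
    uniformly, because swapping the legs is compatible with the multiplication of tensors.\<close>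
  define g where "g p q = s (f (fst (\<sigma> p) * fst (\<sigma> q))) (snd (\<sigma> p) * snd (\<sigma> q))" for p q
  define M where "M z w = lin_ext s (\<lambda>p. lin_ext s (g p) w) z" for z w
  have g_pure: "contract \<sigma> f (pure (fst p * fst q, snd p * snd q)) = g p q" for p q
    using \<sigma> by (auto simp: contract_pure g_def)
  have M: "contract \<sigma> f (tensor_mult z w) = M z w" for z w
    unfolding M_def g_pure[symmetric] tensor_mult_def contract_def lin_ext_lin_ext
    by (simp add: case_prod_beta lin_ext_lin_ext)
  have bil1: "bilin (\<lambda>p. g p q)" for q
    using \<sigma> by (auto simp: bilin_def g_def functional_simps[OF f] distrib_left distrib_right
        scale_left_distrib scale_right_distrib scale_mult_left[symmetric] mult.commute)
  have bil2: "bilin (g p)" for p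
    using \<sigma> by (auto simp: bilin_def g_def functional_simps[OF f] distrib_left distrib_right
        scale_left_distrib scale_right_distrib scale_mult_right[symmetric] mult.commute)
  have Mcong1: "M z w = M z' w" if "tensor_eq s z z'" for z z' w
    unfolding M_def by (rule lin_ext_tensor_eq[OF bilin_lin_ext[OF bil1] that])
  have Mcong2: "M z w = M z w'" if "tensor_eq s w w'" for z w w'
    unfolding M_def using lin_ext_tensor_eq[OF bil2 that] by simp
  let ?p = "\<sigma> (1, x)" and ?q = "\<sigma> (1, y)"
  have \<sigma>\<sigma>: "\<sigma> (\<sigma> r) = r" for r using \<sigma> by auto
  obtain u where u: "u \<in> module.span fscale (pure ` {p. snd (\<sigma> p) \<in> K})" "tensor_eq s (z - pure ?p) u"
    using z by (auto simp: tensor_span_def)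
  obtain v where v: "v \<in> module.span fscale (pure ` {p. snd (\<sigma> p) \<in> L})" "tensor_eq s (w - pure ?q) v"
    using w by (auto simp: tensor_span_def)
  have zu: "tensor_eq s z (pure ?p + u)" and wv: "tensor_eq s w (pure ?q + v)"
    using u(2) v(2) by (simp_all add: tensor_eq_def diff_diff_add)
  have cz: "contract \<sigma> f z = s (f 1) x + contract \<sigma> f u"
    using contract_tensor_eq[OF f \<sigma> zu] by (simp add: contract_add contract_pure \<sigma>\<sigma>)
  have cw: "contract \<sigma> f w = s (f 1) y + contract \<sigma> f v"
    using contract_tensor_eq[OF f \<sigma> wv] by (simp add: contract_add contract_pure \<sigma>\<sigma>)
  have M1: "M (pure ?p) (pure ?q) = s (f 1) (x * y)"
    by (simp add: M_def lin_ext_pure g_def \<sigma>\<sigma>)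
  have g_fun: "g p = (\<lambda>q. s (f (fst (\<sigma> p) * fst (\<sigma> q))) (snd (\<sigma> p) * snd (\<sigma> q)))" for p
    by (simp add: g_def fun_eq_iff)
  have M2: "M (pure ?p) v = x * contract \<sigma> f v"
    by (simp add: M_def lin_ext_pure g_fun \<sigma>\<sigma> contract_def lin_ext_mult_left scale_mult_right)
  have M3: "M u (pure ?q) = contract \<sigma> f u * y"
    by (simp add: M_def lin_ext_pure g_def \<sigma>\<sigma> contract_def lin_ext_mult_right scale_mult_left)
  have M4: "M u v \<in> span {a * b | a b. a \<in> K \<and> b \<in> L}"
    unfolding M_def
  proof (rule lin_ext_in_subspace[OF subspace_span u(1)], rule lin_ext_in_subspace[OF subspace_span v(1)])
    fix p q assume "p \<in> {p. snd (\<sigma> p) \<in> K}" "q \<in> {p. snd (\<sigma> p) \<in> L}"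
    then show "g p q \<in> span {a * b | a b. a \<in> K \<and> b \<in> L}"
      unfolding g_def by (intro span_scale span_base) auto
  qed
  have add1: "M (z1 + z2) w = M z1 w + M z2 w" for z1 z2 w by (simp add: M_def lin_ext_add)
  have add2: "M z (w1 + w2) = M z w1 + M z w2" for z w1 w2
    by (simp add: M_def lin_ext_add lin_ext_fun_add)
  have "contract \<sigma> f (tensor_mult z w) = M (pure ?p + u) (pure ?q + v)"
    unfolding M using Mcong1[OF zu] Mcong2[OF wv] by simp
  also have "\<dots> = s (f 1) (x * y) + x * contract \<sigma> f v + contract \<sigma> f u * y + M u v"
    by (simp add: add1 add2 M1 M2 M3)
  finally show ?thesis using M4 by (simp add: cz cw)
qed

end

section \<open>Coideal subalgebras of connected graded Hopf algebras\<close>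

context connected_graded_hopf_algebra
begin

text \<open>The defect of \<open>\<Delta> x\<close> from \<open>1 \<otimes> x\<close> (for \<open>\<sigma> = id\<close>) or \<open>x \<otimes> 1\<close> (for \<open>\<sigma> = prod.swap\<close>),
  contracted with the functional \<open>f\<close>. With \<open>\<Sigma> = {id}\<close>, the subspaces stable under these operators
  are the left coideals, with \<open>\<Sigma> = {prod.swap}\<close> the right coideals, and with both the subcoalgebras.\<close>

definition defect :: "('h \<times> 'h \<Rightarrow> 'h \<times> 'h) set \<Rightarrow> ('h \<times> 'h \<Rightarrow> 'h \<times> 'h) \<times> ('h \<Rightarrow> 'k) \<Rightarrow> 'h \<Rightarrow> 'h" where
  "defect \<Sigma> i x = (if fst i \<in> \<Sigma> \<and> functional (snd i)
     then contract (fst i) (snd i) (\<Delta> x) - s (snd i 1) x else 0)"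

lemma defect_eq: "\<sigma> \<in> \<Sigma> \<Longrightarrow> functional f \<Longrightarrow> defect \<Sigma> (\<sigma>, f) x = contract \<sigma> f (\<Delta> x) - s (f 1) x"
  by (simp add: defect_def)

lemma tensor_spanI_defect:
  assumes \<sigma>: "\<sigma> = id \<or> \<sigma> = prod.swap" and K: "subspace K"
    and D: "\<And>f. functional f \<Longrightarrow> contract \<sigma> f (\<Delta> x) - s (f 1) x \<in> K"
  shows "\<Delta> x - pure (\<sigma> (1, x)) \<in> tensor_span s {p. snd (\<sigma> p) \<in> K}"
  using \<sigma>
proof
  assume [simp]: "\<sigma> = id"
  have "\<Delta> x - pure (\<sigma> (1, x)) \<in> tensor_span s (UNIV \<times> K)"
    using D by (intro mem_tensor_spanI subspace_UNIV K) (auto simp: contract_diff contract_pure)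
  moreover have "{p. snd (\<sigma> p) \<in> K} = UNIV \<times> K" by auto
  ultimately show ?thesis by simp
next
  assume [simp]: "\<sigma> = prod.swap"
  have "\<Delta> x - pure (\<sigma> (1, x)) \<in> tensor_span s (K \<times> UNIV)"
    using D by (intro mem_tensor_spanI subspace_UNIV K) (auto simp: contract_diff contract_pure)
  moreover have "{p. snd (\<sigma> p) \<in> K} = K \<times> UNIV" by auto
  ultimately show ?thesis by simp
qed

lemma component_0: "Hc 0 \<subseteq> span {1}"
proof -
  obtain b where b: "b \<subseteq> Hc 0" "independent b" "Hc 0 \<subseteq> span b" "card b = dim (Hc 0)"
    by (rule basis_exists[of "Hc 0"])
  then obtain v where v: "b = {v}" using connected by (auto simp: card_1_singleton_iff)
  have "1 \<in> span {v}" using graded_one b(3) v by blast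
  then obtain c where c: "1 = s c v" by (auto simp: span_singleton)
  then have "c \<noteq> 0" by auto
  then have "v = s (inverse c) 1" by (simp add: c)
  then have "v \<in> span {1}" by (auto simp: span_singleton)
  then have "span {v} \<subseteq> span {1}" by (intro span_minimal) auto
  then show ?thesis using b(3) v by blast
qed

lemma functional_counit: "functional \<epsilon>"
  by (rule counit_linear)

lemma contract_counit: "\<sigma> = id \<or> \<sigma> = prod.swap \<Longrightarrow> contract \<sigma> \<epsilon> (\<Delta> x) = x"
  using counit_left[of x] counit_right[of x] by (auto simp: contract_def case_prod_unfold)

lemma functional_contract_swap:
  assumes "functional f" "functional g" "\<sigma> = id \<or> \<sigma> = prod.swap"
  shows "g (contract \<sigma> f z) = f (contract (prod.swap \<circ> \<sigma>) g z)"
  using assms(3) by (auto simp: contract_def lin_ext_def functional_simps[OF assms(1)]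
      functional_simps[OF assms(2)] mult_ac)

lemma functionals_separate: "(\<And>f. functional f \<Longrightarrow> f x = 0) \<Longrightarrow> x = 0"
proof -
  assume x: "\<And>f. functional f \<Longrightarrow> f x = 0"
  obtain c where c: "\<And>e. functional (\<lambda>v. c v e)" "\<And>v. (\<Sum>e | c v e \<noteq> 0. s (c v e) e) = v"
    by (rule ex_coordinates[OF subspace_UNIV], rule that)
  have "(\<Sum>e | c x e \<noteq> 0. s (c x e) e) = 0" using x[OF c(1)] by simp
  then show "x = 0" using c(2)[of x] by simp
qed

text \<open>Applying the counit to the hypothesis gives \<open>f x = f 1 * \<epsilon> x\<close> for
  every functional \<open>f\<close>, and functionals separate points.\<close>

lemma defect_kernel:
  assumes \<sigma>: "\<sigma> = id \<or> \<sigma> = prod.swap" and D: "\<And>f. functional f \<Longrightarrow> contract \<sigma> f (\<Delta> x) = s (f 1) x"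
  shows "x \<in> span {1}"
proof -
  have "f (x - s (\<epsilon> x) 1) = 0" if f: "functional f" for f
  proof -
    have "\<epsilon> (contract \<sigma> f (\<Delta> x)) = f (contract (prod.swap \<circ> \<sigma>) \<epsilon> (\<Delta> x))"
      by (rule functional_contract_swap[OF f functional_counit \<sigma>])
    also have "contract (prod.swap \<circ> \<sigma>) \<epsilon> (\<Delta> x) = x"
      using \<sigma> by (intro contract_counit) auto
    finally have "f x = f 1 * \<epsilon> x" using D[OF f] by (simp add: functional_simps[OF functional_counit])
    then show ?thesis by (simp add: functional_simps[OF f])
  qed
  then have "x - s (\<epsilon> x) 1 = 0" by (rule functionals_separate)
  then show ?thesis by (simp add: span_singleton)
qed

text \<open>By the counit law the defect is the contraction of \<open>\<Delta> x\<close> with the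
  functional \<open>f - f 1 * \<epsilon>\<close>. This kills scalars, hence all terms whose
  contracted leg has degree 0; in the others the remaining leg has degree below
  \<open>deg \<gamma>\<close>.\<close>

lemma defect_graded:
  fixes deg :: "'g \<Rightarrow> nat"
  assumes deg: "\<And>\<alpha> \<beta>. deg (\<alpha> + \<beta>) = deg \<alpha> + deg \<beta>" "\<And>\<alpha>. deg \<alpha> = 0 \<longleftrightarrow> \<alpha> = 0"
    and \<sigma>: "\<sigma> = id \<or> \<sigma> = prod.swap" and f: "functional f" and x: "x \<in> Hc \<gamma>"
  shows "contract \<sigma> f (\<Delta> x) - s (f 1) x \<in> span (\<Union>\<beta>\<in>{\<beta>. deg \<beta> < deg \<gamma>}. Hc \<beta>)" (is "_ \<in> ?L")
proof -
  interpret F: vector_space "fscale :: 'k \<Rightarrow> ('h \<times> 'h \<Rightarrow>\<^sub>0 'k) \<Rightarrow> _" by (rule vector_space_fscale)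
  let ?P = "\<Union>{Hc \<alpha> \<times> Hc \<beta> | \<alpha> \<beta>. \<alpha> + \<beta> = \<gamma>}"
  obtain w where w: "w \<in> F.span (pure ` ?P)" "tensor_eq s (\<Delta> x) w"
    using graded_comult[OF x] by (auto simp: tensor_span_def)
  let ?V = "{w. contract \<sigma> f w - s (f 1) (contract \<sigma> \<epsilon> w) \<in> ?L}"
  have "F.subspace ?V"
  proof (rule F.subspaceI)
    show "0 \<in> ?V" by (simp add: contract_def lin_ext_0 span_zero)
    show "u + v \<in> ?V" if "u \<in> ?V" "v \<in> ?V" for u v
      using span_add[of "contract \<sigma> f u - s (f 1) (contract \<sigma> \<epsilon> u)" _ "contract \<sigma> f v - s (f 1) (contract \<sigma> \<epsilon> v)"] that
      by (simp add: contract_add scale_right_distrib algebra_simps)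
    show "fscale c u \<in> ?V" if "u \<in> ?V" for c u
      using span_scale[of "contract \<sigma> f u - s (f 1) (contract \<sigma> \<epsilon> u)" _ c] that
      by (simp add: contract_fscale scale_right_diff_distrib mult.commute)
  qed
  moreover have "pure p \<in> ?V" if p: "p \<in> ?P" for p
  proof -
    obtain \<alpha> \<beta> where *: "p \<in> Hc \<alpha> \<times> Hc \<beta>" "\<alpha> + \<beta> = \<gamma>" using p by blast
    have "\<exists>\<alpha> \<beta>. fst (\<sigma> p) \<in> Hc \<alpha> \<and> snd (\<sigma> p) \<in> Hc \<beta> \<and> \<alpha> + \<beta> = \<gamma>"
      using \<sigma>
    proof
      assume "\<sigma> = id"
      then show ?thesis using * by (intro exI[of _ \<alpha>] exI[of _ \<beta>]) auto
    next
      assume "\<sigma> = prod.swap"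
      then show ?thesis using * by (intro exI[of _ \<beta>] exI[of _ \<alpha>]) (auto simp: add.commute)
    qed
    then obtain \<alpha> \<beta> where p: "fst (\<sigma> p) \<in> Hc \<alpha>" "snd (\<sigma> p) \<in> Hc \<beta>" "\<alpha> + \<beta> = \<gamma>" by blast
    show ?thesis
    proof (cases "\<alpha> = 0")
      case True
      then obtain c where "fst (\<sigma> p) = s c 1" using p(1) component_0 by (auto simp: span_singleton)
      then show ?thesis
        by (simp add: contract_pure functional_simps[OF f] functional_simps[OF functional_counit]
            counit_one mult.commute span_zero)
    next
      case False
      then have "\<epsilon> (fst (\<sigma> p)) = 0" using graded_counit p(1) by blast
      moreover have "deg \<beta> < deg \<gamma>" using False deg(2)[of \<alpha>] p(3) deg(1)[of \<alpha> \<beta>] by auto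
      then have "snd (\<sigma> p) \<in> ?L" using p(2) by (intro span_base) blast
      ultimately show ?thesis by (simp add: contract_pure span_scale)
    qed
  qed
  then have "pure ` ?P \<subseteq> ?V" by (rule image_subsetI)
  ultimately have "F.span (pure ` ?P) \<subseteq> ?V" by (intro F.span_minimal)
  then have "contract \<sigma> f w - s (f 1) (contract \<sigma> \<epsilon> w) \<in> ?L" using w(1) by blast
  then show ?thesis
    using contract_tensor_eq[OF f \<sigma> w(2)] contract_tensor_eq[OF functional_counit \<sigma> w(2)]
      contract_counit[OF \<sigma>] by simp
qed

lemma contract_comult_add: "functional f \<Longrightarrow> \<sigma> = id \<or> \<sigma> = prod.swap \<Longrightarrow>
    contract \<sigma> f (\<Delta> (x + y)) = contract \<sigma> f (\<Delta> x) + contract \<sigma> f (\<Delta> y)"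
  using contract_tensor_eq[OF _ _ comult_add] by (simp add: contract_add)

lemma contract_comult_scale: "functional f \<Longrightarrow> \<sigma> = id \<or> \<sigma> = prod.swap \<Longrightarrow>
    contract \<sigma> f (\<Delta> (s c x)) = s c (contract \<sigma> f (\<Delta> x))"
  using contract_tensor_eq[OF _ _ comult_scale] by (simp add: contract_fscale)

lemma left_coideal_subalgebra_iff:
  "left_coideal_subalgebra s \<Delta> K \<longleftrightarrow>
    subalgebra s K \<and> (\<forall>x\<in>K. \<forall>f. functional f \<longrightarrow> contract id f (\<Delta> x) \<in> K)"
  unfolding left_coideal_subalgebra_def
proof (intro conj_cong refl ball_cong)
  fix x assume "subalgebra s K"
  then have K: "subspace K" by (simp add: subalgebra_def)
  show "\<Delta> x \<in> tensor_span s (UNIV \<times> K) \<longleftrightarrow> (\<forall>f. functional f \<longrightarrow> contract id f (\<Delta> x) \<in> K)"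
    using contract_mem[OF _ _ K, of _ id "\<Delta> x" "UNIV \<times> K"] mem_tensor_spanI[OF subspace_UNIV K, of "\<Delta> x"]
    by auto
qed

lemma right_coideal_subalgebra_iff:
  "right_coideal_subalgebra s \<Delta> K \<longleftrightarrow>
    subalgebra s K \<and> (\<forall>x\<in>K. \<forall>f. functional f \<longrightarrow> contract prod.swap f (\<Delta> x) \<in> K)"
  unfolding right_coideal_subalgebra_def
proof (intro conj_cong refl ball_cong)
  fix x assume "subalgebra s K"
  then have K: "subspace K" by (simp add: subalgebra_def)
  show "\<Delta> x \<in> tensor_span s (K \<times> UNIV) \<longleftrightarrow> (\<forall>f. functional f \<longrightarrow> contract prod.swap f (\<Delta> x) \<in> K)"
    using contract_mem[OF _ _ K, of _ prod.swap "\<Delta> x" "K \<times> UNIV"] mem_tensor_spanI[OF K subspace_UNIV, of "\<Delta> x"]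
    by auto
qed

end

section \<open>Coideal and Hopf subalgebras as stable subalgebras\<close>

locale connected_graded_hopf_algebra_degree = connected_graded_hopf_algebra s \<Delta> \<epsilon> S Hc
  for s :: "'k::field_char_0 \<Rightarrow> 'h::ring_1 \<Rightarrow> 'h"
    and \<Delta> :: "'h \<Rightarrow> ('h \<times> 'h \<Rightarrow>\<^sub>0 'k)"
    and \<epsilon> :: "'h \<Rightarrow> 'k"
    and S :: "'h \<Rightarrow> 'h"
    and Hc :: "'g::comm_monoid_add \<Rightarrow> 'h set" +
  fixes deg :: "'g \<Rightarrow> nat"
  assumes degree_add: "deg (\<alpha> + \<beta>) = deg \<alpha> + deg \<beta>"
    and degree_eq_0: "deg \<alpha> = 0 \<longleftrightarrow> \<alpha> = 0"
begin

lemma graded_coaction_defect: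
  assumes \<Sigma>: "\<Sigma> \<subseteq> {id, prod.swap}" "\<Sigma> \<noteq> {}"
  shows "graded_coaction s (defect \<Sigma>) Hc deg"
proof unfold_locales
  have cases: "fst i = id \<or> fst i = prod.swap" if "fst i \<in> \<Sigma>" for i :: "_ \<times> ('h \<Rightarrow> 'k)"
    using that \<Sigma> by blast
  show "defect \<Sigma> i (x + y) = defect \<Sigma> i x + defect \<Sigma> i y" for i x y
    using cases[of i] by (auto simp: defect_def contract_comult_add scale_right_distrib algebra_simps)
  show "defect \<Sigma> i (s c x) = s c (defect \<Sigma> i x)" for i c x
    using cases[of i] by (auto simp: defect_def contract_comult_scale scale_right_diff_distrib mult.commute)
  show "defect \<Sigma> i (x * y) - x * defect \<Sigma> i y - defect \<Sigma> i x * y \<in> span {a * b | a b. a \<in> K \<and> b \<in> L}"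
    if K: "subspace K" "subspace L" and x: "\<And>j. defect \<Sigma> j x \<in> K" and y: "\<And>j. defect \<Sigma> j y \<in> L"
    for K L i x y
  proof (cases "fst i \<in> \<Sigma> \<and> functional (snd i)")
    case True
    obtain \<sigma> f where i: "i = (\<sigma>, f)" by (cases i)
    have \<sigma>: "\<sigma> \<in> \<Sigma>" "\<sigma> = id \<or> \<sigma> = prod.swap" and f: "functional f" using True cases[of i] i by auto
    have "\<Delta> x - pure (\<sigma> (1, x)) \<in> tensor_span s {p. snd (\<sigma> p) \<in> K}"
    proof (rule tensor_spanI_defect[OF \<sigma>(2) K(1)])
      show "contract \<sigma> f (\<Delta> x) - s (f 1) x \<in> K" if "functional f" for f
        using x[of "(\<sigma>, f)"] by (simp add: defect_eq[OF \<sigma>(1) that])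
    qed
    moreover have "\<Delta> y - pure (\<sigma> (1, y)) \<in> tensor_span s {p. snd (\<sigma> p) \<in> L}"
    proof (rule tensor_spanI_defect[OF \<sigma>(2) K(2)])
      show "contract \<sigma> f (\<Delta> y) - s (f 1) y \<in> L" if "functional f" for f
        using y[of "(\<sigma>, f)"] by (simp add: defect_eq[OF \<sigma>(1) that])
    qed
    ultimately show ?thesis
      using contract_tensor_mult[OF f \<sigma>(2) K] contract_tensor_eq[OF f \<sigma>(2) comult_mult]
      by (simp add: i defect_eq[OF \<sigma>(1) f])
  qed (auto simp: defect_def span_zero)
  show "x \<in> span {1}" if "\<And>i. defect \<Sigma> i x = 0" for x
  proof -
    obtain \<sigma> where \<sigma>: "\<sigma> \<in> \<Sigma>" "\<sigma> = id \<or> \<sigma> = prod.swap" using \<Sigma> by blast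
    show ?thesis
    proof (rule defect_kernel[OF \<sigma>(2)])
      show "contract \<sigma> f (\<Delta> x) = s (f 1) x" if f: "functional f" for f
        using \<open>\<And>i. defect \<Sigma> i x = 0\<close>[of "(\<sigma>, f)"] by (simp add: defect_eq[OF \<sigma>(1) f])
    qed
  qed
  show "defect \<Sigma> i x \<in> span (\<Union>\<beta>\<in>{\<beta>. deg \<beta> < deg \<gamma>}. Hc \<beta>)" if "x \<in> Hc \<gamma>" for x \<gamma> i
    using defect_graded[OF degree_add degree_eq_0 _ _ that, of "fst i" "snd i"] cases[of i]
    by (auto simp: defect_def span_zero)
qed (use component_subspace direct_sum graded_one graded_mult degree_add degree_eq_0 in auto)

lemma stable_defect_iff:
  assumes \<Sigma>: "\<Sigma> \<subseteq> {id, prod.swap}" "\<Sigma> \<noteq> {}"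
  shows "graded_coaction.stable s (defect \<Sigma>) K \<longleftrightarrow>
    subalgebra s K \<and> (\<forall>\<sigma>\<in>\<Sigma>. \<forall>x\<in>K. \<forall>f. functional f \<longrightarrow> contract \<sigma> f (\<Delta> x) \<in> K)"
proof -
  interpret G: graded_coaction s "defect \<Sigma>" Hc deg by (rule graded_coaction_defect[OF \<Sigma>])
  have "(\<forall>i. defect \<Sigma> i x \<in> K) \<longleftrightarrow> (\<forall>\<sigma>\<in>\<Sigma>. \<forall>f. functional f \<longrightarrow> contract \<sigma> f (\<Delta> x) \<in> K)"
    if K: "subspace K" and x: "x \<in> K" for x
  proof -
    have "contract \<sigma> f (\<Delta> x) - s (f 1) x \<in> K \<longleftrightarrow> contract \<sigma> f (\<Delta> x) \<in> K" for \<sigma> f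
      using subspace_diff[OF K, of "contract \<sigma> f (\<Delta> x)" "s (f 1) x"] subspace_scale[OF K x]
        subspace_add[OF K, of "contract \<sigma> f (\<Delta> x) - s (f 1) x" "s (f 1) x"] by auto
    then show ?thesis using subspace_0[OF K] by (auto simp: defect_def)
  qed
  then show ?thesis unfolding G.stable_def by (auto simp: subalgebra_def)
qed

text \<open>For homogeneous \<open>x\<close>, \<open>\<Delta> x\<close> is
  \<open>x \<otimes> 1\<close> plus terms \<open>a \<otimes> b\<close> with \<open>a\<close> in
  \<open>K\<close> of smaller degree and \<open>b\<close> in \<open>K\<close>; the antipode law then
  expresses \<open>S x\<close> through \<open>\<epsilon> x\<close> and the products
  \<open>S a * b\<close>.\<close>

lemma hopf_subalgebra_iff:
  assumes hom: "homogeneous s Hc K"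
  shows "hopf_subalgebra s \<Delta> S K \<longleftrightarrow> graded_coaction.stable s (defect {id, prod.swap}) K"
proof
  assume "hopf_subalgebra s \<Delta> S K"
  then have K: "subalgebra s K" "subspace K" and D: "\<And>x. x \<in> K \<Longrightarrow> \<Delta> x \<in> tensor_span s (K \<times> K)"
    by (auto simp: hopf_subalgebra_def subalgebra_def)
  have "contract \<sigma> f (\<Delta> x) \<in> K" if "\<sigma> \<in> {id, prod.swap}" "x \<in> K" "functional f" for \<sigma> x f
  proof (rule contract_mem[OF that(3) _ K(2) D[OF that(2)]])
    show "\<sigma> = id \<or> \<sigma> = prod.swap" using that(1) by simp
    show "snd (\<sigma> p) \<in> K" if "p \<in> K \<times> K" for p using that \<open>\<sigma> \<in> _\<close> by auto
  qed
  then show "graded_coaction.stable s (defect {id, prod.swap}) K"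
    using K(1) by (subst stable_defect_iff) auto
next
  interpret G: graded_coaction s "defect {id, prod.swap}" Hc deg by (rule graded_coaction_defect) auto
  assume st: "G.stable K"
  then have alg: "subalgebra s K"
    and D: "\<And>x f. x \<in> K \<Longrightarrow> functional f \<Longrightarrow> contract id f (\<Delta> x) \<in> K"
      "\<And>x f. x \<in> K \<Longrightarrow> functional f \<Longrightarrow> contract prod.swap f (\<Delta> x) \<in> K"
    by (auto simp: stable_defect_iff)
  then have K: "subspace K" "1 \<in> K" and mult: "\<And>x y. x \<in> K \<Longrightarrow> y \<in> K \<Longrightarrow> x * y \<in> K"
    by (auto simp: subalgebra_def)
  have S: "module_hom s s S" using antipode_linear by (simp add: Vector_Spaces.linear_def)
  note S_simps = module_hom.add[OF S] module_hom.scale[OF S] module_hom.zero[OF S]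
  have subS: "subspace {x. S x \<in> K}"
    using K(1) by (auto simp: subspace_def S_simps)
  have bil: "bilin (\<lambda>(a, b). S a * b)"
    by (simp add: bilin_def S_simps distrib_left distrib_right scale_mult_left[symmetric] scale_mult_right[symmetric])
  have SK: "S x \<in> K" if "x \<in> K" "x \<in> Hc \<gamma>" for x \<gamma>
    using that
  proof (induction "deg \<gamma>" arbitrary: x \<gamma> rule: less_induct)
    case less
    let ?K = "K \<inter> G.Hlt (deg \<gamma>)"
    have low: "S a \<in> K" if a: "a \<in> ?K" for a
    proof -
      have "a \<in> {x. S x \<in> K}"
      proof (rule G.in_span_of_proj[OF subS])
        fix \<beta> show "G.proj \<beta> a \<in> {x. S x \<in> K}"
        proof (cases "deg \<beta> < deg \<gamma>")
          case True
          then show ?thesis using less.hyps[OF True _ G.proj_in] G.homogeneous_proj[OF hom, of a \<beta>] a by simp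
        next
          case False
          then have "G.proj \<beta> a = 0" using a by (intro G.proj_Hlt[of a "deg \<gamma>"]) auto
          then show ?thesis using subspace_0[OF K(1)] by (simp add: S_simps)
        qed
      qed
      then show ?thesis by simp
    qed
    have "\<Delta> x - pure (x, 1) \<in> tensor_span s (?K \<times> K)"
    proof (rule mem_tensor_spanI)
      show "subspace ?K" by (intro subspace_inter K G.subspace_Hlt)
      fix f assume f: "functional f"
      have "contract prod.swap f (\<Delta> x - pure (x, 1)) = defect {id, prod.swap} (prod.swap, f) x"
        by (simp add: contract_diff contract_pure defect_eq[OF _ f])
      also have "\<dots> \<in> ?K"
        using G.stable_U[OF st less.prems(1)] G.U_graded[OF less.prems(2)] by (simp add: G.Hlt_def)
      finally show "contract prod.swap f (\<Delta> x - pure (x, 1)) \<in> ?K" .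
      show "contract id f (\<Delta> x - pure (x, 1)) \<in> K"
        using D(1)[OF less.prems(1) f] subspace_scale[OF K(1) K(2)] subspace_diff[OF K(1)]
        by (simp add: contract_diff contract_pure)
    qed (rule K(1))
    then obtain w where w: "w \<in> module.span fscale (pure ` (?K \<times> K))" "tensor_eq s (\<Delta> x - pure (x, 1)) w"
      by (auto simp: tensor_span_def)
    have "lin_ext s (\<lambda>(a, b). S a * b) w \<in> K"
      by (rule lin_ext_in_subspace[OF K(1) w(1)]) (auto intro!: mult low)
    moreover have "lin_ext s (\<lambda>(a, b). S a * b) (\<Delta> x) - S x = lin_ext s (\<lambda>(a, b). S a * b) w"
      using lin_ext_tensor_eq[OF bil w(2)] by (simp add: lin_ext_diff lin_ext_pure)
    ultimately have "s (\<epsilon> x) 1 - S x \<in> K" by (simp add: antipode_left)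
    then have "s (\<epsilon> x) 1 - (s (\<epsilon> x) 1 - S x) \<in> K"
      by (rule subspace_diff[OF K(1) subspace_scale[OF K(1) K(2)]])
    then show ?case by simp
  qed
  have "K \<subseteq> {x. S x \<in> K}"
    by (rule G.homogeneous_component_subset[OF hom subS]) (simp add: SK)
  moreover have "\<Delta> x \<in> tensor_span s (K \<times> K)" if "x \<in> K" for x
    using D that by (intro mem_tensor_spanI K(1)) auto
  ultimately show "hopf_subalgebra s \<Delta> S K" using alg by (auto simp: hopf_subalgebra_def)
qed

end

text \<open>The degree counts free generators. Uniqueness of the multiset makes it additive, and
  only the empty multiset has size 0.\<close>

lemma ex_degree:
  assumes "free_abelian_monoid TYPE('g::comm_monoid_add)"
  obtains deg :: "'g::comm_monoid_add \<Rightarrow> nat" where "\<And>\<alpha> \<beta>. deg (\<alpha> + \<beta>) = deg \<alpha> + deg \<beta>" "\<And>\<alpha>. deg \<alpha> = 0 \<longleftrightarrow> \<alpha> = 0"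
proof -
  obtain X :: "'g set" where X: "bij_betw sum_mset {M. set_mset M \<subseteq> X} UNIV"
    using assms unfolding free_abelian_monoid_def by blast
  let ?M = "{M. set_mset M \<subseteq> X}"
  define m where "m = the_inv_into ?M sum_mset"
  have m: "m (sum_mset M) = M" if "set_mset M \<subseteq> X" for M
    unfolding m_def using X that by (intro the_inv_into_f_f) (auto simp: bij_betw_def)
  have sum: "sum_mset (m \<alpha>) = \<alpha>" "set_mset (m \<alpha>) \<subseteq> X" for \<alpha>
  proof -
    obtain M where "\<alpha> = sum_mset M" "set_mset M \<subseteq> X" using X unfolding bij_betw_def by blast
    then show "sum_mset (m \<alpha>) = \<alpha>" "set_mset (m \<alpha>) \<subseteq> X" using m by auto
  qed
  have "m (\<alpha> + \<beta>) = m \<alpha> + m \<beta>" for \<alpha> \<beta>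
    using m[of "m \<alpha> + m \<beta>"] sum by simp
  moreover have "m \<alpha> = {#} \<longleftrightarrow> \<alpha> = 0" for \<alpha>
    using m[of "{#}"] sum(1)[of \<alpha>] by auto
  ultimately show thesis by (intro that[of "\<lambda>\<alpha>. size (m \<alpha>)"]) simp_all
qed

theorem theoremB:
  fixes s :: "'k::field_char_0 \<Rightarrow> 'h::ring_1 \<Rightarrow> 'h"
    and \<Delta> :: "'h \<Rightarrow> ('h \<times> 'h \<Rightarrow>\<^sub>0 'k)"
    and \<epsilon> :: "'h \<Rightarrow> 'k"
    and S :: "'h \<Rightarrow> 'h"
    and Hc :: "'g::comm_monoid_add \<Rightarrow> 'h set"
    and A B :: "'h set"
    and m n :: real
    and P :: "'h set \<Rightarrow> bool"
  assumes "free_abelian_monoid TYPE('g)"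
    and "(UNIV :: 'g set) \<noteq> {0}"
    and "connected_graded_hopf_algebra s \<Delta> \<epsilon> S Hc"
    and "P = left_coideal_subalgebra s \<Delta> \<or> P = right_coideal_subalgebra s \<Delta>"
    and "P A" and "homogeneous s Hc A"
    and "P B" and "homogeneous s Hc B"
    and "B \<subseteq> A"
    and "gk_dim s A = ereal m"
    and "gk_dim s B = ereal n"
  shows "\<exists>N::nat. real N = m - n \<and>
           (\<exists>K :: nat \<Rightarrow> 'h set. K 0 = B \<and> K N = A \<and>
              (\<forall>i\<le>N. P (K i) \<and> homogeneous s Hc (K i)) \<and>
              (\<forall>i<N. K i \<subset> K (Suc i) \<and>
                 graded_ore_extension_of_derivation_type s Hc (K i) (K (Suc i)))) \<and>
           (hopf_subalgebra s \<Delta> S A \<and> hopf_subalgebra s \<Delta> S B \<longrightarrow>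
              (\<exists>K :: nat \<Rightarrow> 'h set. K 0 = B \<and> K N = A \<and>
                 (\<forall>i\<le>N. P (K i) \<and> homogeneous s Hc (K i) \<and> hopf_subalgebra s \<Delta> S (K i)) \<and>
                 (\<forall>i<N. K i \<subset> K (Suc i) \<and>
                    graded_ore_extension_of_derivation_type s Hc (K i) (K (Suc i)))))"
proof -
  interpret connected_graded_hopf_algebra s \<Delta> \<epsilon> S Hc by (rule assms(3))
  obtain deg :: "'g \<Rightarrow> nat" where deg: "\<And>\<alpha> \<beta>. deg (\<alpha> + \<beta>) = deg \<alpha> + deg \<beta>" "\<And>\<alpha>. deg \<alpha> = 0 \<longleftrightarrow> \<alpha> = 0"
    using ex_degree[OF assms(1)] by blast
  interpret connected_graded_hopf_algebra_degree s \<Delta> \<epsilon> S Hc deg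
    by unfold_locales (rule deg)+
  let ?all = "{id, prod.swap} :: ('h \<times> 'h \<Rightarrow> 'h \<times> 'h) set"
  have "\<exists>\<Sigma>. \<Sigma> \<subseteq> ?all \<and> \<Sigma> \<noteq> {} \<and> P = graded_coaction.stable s (defect \<Sigma>)"
    using assms(4)
  proof
    assume P: "P = left_coideal_subalgebra s \<Delta>"
    then have "P = graded_coaction.stable s (defect {id})"
      by (auto simp: fun_eq_iff left_coideal_subalgebra_iff stable_defect_iff)
    then show ?thesis by blast
  next
    assume P: "P = right_coideal_subalgebra s \<Delta>"
    then have "P = graded_coaction.stable s (defect {prod.swap})"
      by (auto simp: fun_eq_iff right_coideal_subalgebra_iff stable_defect_iff)
    then show ?thesis by blast
  qed
  then obtain \<Sigma> where \<Sigma>: "\<Sigma> \<subseteq> ?all" "\<Sigma> \<noteq> {}" and P: "P = graded_coaction.stable s (defect \<Sigma>)" by blast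
  interpret G: graded_coaction s "defect \<Sigma>" Hc deg by (rule graded_coaction_defect[OF \<Sigma>])
  interpret G2: graded_coaction s "defect ?all" Hc deg by (rule graded_coaction_defect) auto
  obtain N K where N: "real N = m - n" and K: "K 0 = B \<and> K N = A \<and>
      (\<forall>i\<le>N. P (K i) \<and> homogeneous s Hc (K i)) \<and>
      (\<forall>i<N. K i \<subset> K (Suc i) \<and> graded_ore_extension_of_derivation_type s Hc (K i) (K (Suc i)))"
    using G.ore_chain[of A B m n] assms(5-11) unfolding P by blast
  have "\<exists>K. K 0 = B \<and> K N = A \<and>
      (\<forall>i\<le>N. P (K i) \<and> homogeneous s Hc (K i) \<and> hopf_subalgebra s \<Delta> S (K i)) \<and>
      (\<forall>i<N. K i \<subset> K (Suc i) \<and> graded_ore_extension_of_derivation_type s Hc (K i) (K (Suc i)))"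
    if hopf: "hopf_subalgebra s \<Delta> S A" "hopf_subalgebra s \<Delta> S B"
  proof -
    have st: "G2.stable A" "G2.stable B" using hopf hopf_subalgebra_iff assms(6,8) by auto
    \<comment> \<open>A second run of the construction, with the operators of both sides: for
      homogeneous subspaces stability now means being a Hopf subalgebra, and the length is again
      \<open>m - n\<close>.\<close>
    obtain N' L where N': "real N' = m - n" and L: "L 0 = B \<and> L N' = A \<and>
        (\<forall>i\<le>N'. G2.stable (L i) \<and> homogeneous s Hc (L i)) \<and>
        (\<forall>i<N'. L i \<subset> L (Suc i) \<and> graded_ore_extension_of_derivation_type s Hc (L i) (L (Suc i)))"
      using G2.ore_chain[OF st(1) assms(6) st(2) assms(8-11)] by blast
    have "N' = N" using N N' by simp
    moreover have "P V" if "G2.stable V" for V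
      using that \<Sigma> unfolding P by (auto simp: stable_defect_iff)
    ultimately show ?thesis using L hopf_subalgebra_iff by (intro exI[of _ L]) auto
  qed
  then show ?thesis using N K by blast
qed

end
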